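(* Fix an integer $k \ge 1$ and a real number $c > 0$, let $p = c/n$, and let $H = H_{n,k,p}$ be an $(n,k,p)$ Newman--Watts small world. Then there is a constant $C_0 > 0$ depending only on $c$ and $k$ such that with probability at least $1 - O(n^{-3})$, \[ C_0^{-1} \log^2 n \le \tau_{\mathrm{mix}}(H) \le C_0 \log^2 n . \] Furthermore, $\mathbf{E}[\tau_{\mathrm{mix}}(H)] \le C_0(\log^2 n + 1)$.
   Context: For integers $n \ge k \ge 1$, the $(n,k)$-ring $R_{n,k}$ is the (simple) graph with vertex set $[n]=\{1,\dots,n\}$ and edge set $\{\{i,j\} : i+1 \le j \le i+k\}$, addition being interpreted modulo $n$. For $0<p<1$, the $(n,k,p)$ Newman--Watts small world $H_{n,k,p}$ is the random graph obtained from $R_{n,k}$ by independently replacing each non-edge of $R_{n,k}$ by an edge with probability $p$. With $p=c/n$, $n$ ranges over integers $n \ge k$ with $n > c$ (so that $0<p<1$); the constant implicit in $O(n^{-3})$ may depend on $c$ and $k$ but not on $n$. For a finite simple connected graph $G=(V,E)$, the lazy simple random walk on $G$ is the Markov chain $(X_t)_{t\ge 0}$ on $V$ with transition probabilities $p_{x,y} = 1/2$ if $x=y$, $p_{x,y} = 1/(2 d_G(x))$ if $y$ is a neighbour of $x$, and $p_{x,y}=0$ otherwise, where $d_G(x)$ is the degree of $x$. Its unique stationary distribution is $\pi(x) = d_G(x)/(2|E|)$. (In the degenerate case of a single vertex the walk stays put.) For probability distributions $\mu,\nu$ on $V$, $\|\mu-\nu\|_{\mathrm{TV}} = \sup_{S\subset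 V}|\mu(S)-\nu(S)| = \frac12\sum_{v\in V}|\mu(v)-\nu(v)|$. Writing $\mu_{t,x}(y) = \mathbf{P}(X_t = y \mid X_0 = x)$, the mixing time is \[ \tau_{\mathrm{mix}}(G) = \max_{x \in V} \min\{t : \|\mu_{t,x} - \pi\|_{\mathrm{TV}} \le 1/4\}. \] $\log$ denotes the natural logarithm and $\log^2 n = (\log n)^2$. *)

theory Defs
  imports "HOL-Probability.Probability" "HOL-Number_Theory.Cong"
begin

text \<open>
  A finite simple graph is given by its vertex set \<open>V\<close> and its edge set \<open>E\<close>, a set of
  two-element subsets of \<open>V\<close>.
\<close>

definition ring_edges :: "nat \<Rightarrow> nat \<Rightarrow> nat set set" where
  "ring_edges n k =
     {{i, j} | i j. i \<in> {1..n} \<and> j \<in> {1..n} \<and> i \<noteq> j \<and> (\<exists>l\<in>{1..k}. [j = i + l] (mod n))}"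

definition ring_nonedges :: "nat \<Rightarrow> nat \<Rightarrow> nat set set" where
  "ring_nonedges n k = {e. e \<subseteq> {1..n} \<and> card e = 2} - ring_edges n k"

text \<open>The distribution of the random edge set; the vertex set is always \<open>{1..n}\<close>.\<close>

definition newman_watts :: "nat \<Rightarrow> nat \<Rightarrow> real \<Rightarrow> nat set set pmf" where
  "newman_watts n k p =
     map_pmf (\<lambda>X. ring_edges n k \<union> {e \<in> ring_nonedges n k. X e})
       (Pi_pmf (ring_nonedges n k) False (\<lambda>_. bernoulli_pmf p))"

definition neighbours :: "'a set set \<Rightarrow> 'a \<Rightarrow> 'a set" where
  "neighbours E x = {y. {x, y} \<in> E}"

definition degree :: "'a set set \<Rightarrow> 'a \<Rightarrow> nat" where
  "degree E x = card (neighbours E x)"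

text \<open>At a vertex without neighbours (the one-vertex graph) the walk stays put.\<close>

definition lazy_step :: "'a set set \<Rightarrow> 'a \<Rightarrow> 'a pmf" where
  "lazy_step E x =
     (if neighbours E x = {} then return_pmf x
      else bind_pmf (bernoulli_pmf (1/2))
             (\<lambda>stay. if stay then return_pmf x else pmf_of_set (neighbours E x)))"

lemma pmf_lazy_step:
  assumes "finite (neighbours E x)" "neighbours E x \<noteq> {}" "\<And>e. e \<in> E \<Longrightarrow> card e = 2"
  shows "pmf (lazy_step E x) y =
           (if y = x then 1 / 2
            else if {x, y} \<in> E then 1 / (2 * real (degree E x)) else 0)"
proof -
  have "x \<notin> neighbours E x"
    using assms(3)[of "{x}"] by (auto simp: neighbours_def)
  then show ?thesis
    using assms(1,2)
    by (auto simp: lazy_step_def pmf_bind degree_def indicator_def neighbours_def)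
qed

text \<open>\<open>lazy_walk E t x\<close> is the law of \<open>X\<^sub>t\<close> given \<open>X\<^sub>0 = x\<close>.\<close>

primrec lazy_walk :: "'a set set \<Rightarrow> nat \<Rightarrow> 'a \<Rightarrow> 'a pmf" where
  "lazy_walk E 0 x = return_pmf x"
| "lazy_walk E (Suc t) x = bind_pmf (lazy_walk E t x) (lazy_step E)"

text \<open>
  For the one-vertex graph the quotient would be \<open>0 / 0 = 0\<close> in HOL, whereas the stationary
  distribution is the point mass; the first branch provides this.
\<close>

definition stationary :: "'a set \<Rightarrow> 'a set set \<Rightarrow> 'a \<Rightarrow> real" where
  "stationary V E x =
     (if card V = 1 then 1 else real (degree E x) / (2 * real (card E)))"

definition tv_dist :: "'a set \<Rightarrow> ('a \<Rightarrow> real) \<Rightarrow> ('a \<Rightarrow> real) \<Rightarrow> real" where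
  "tv_dist V \<mu> \<nu> = (1 / 2) * (\<Sum>v\<in>V. \<bar>\<mu> v - \<nu> v\<bar>)"

text \<open>
  Meaningful for finite connected graphs, where a time \<open>t\<close> as below exists for each \<open>x\<close>.
\<close>

definition mixing_time :: "'a set \<Rightarrow> 'a set set \<Rightarrow> nat" where
  "mixing_time V E =
     Max ((\<lambda>x. LEAST t. tv_dist V (pmf (lazy_walk E t x)) (stationary V E) \<le> 1 / 4) ` V)"

end

theory Submission
  imports Defs "HOL-Real_Asymp.Real_Asymp"
begin

text \<open>
  Write \<open>P\<close> for the lazy step as an operator on functions; it is a positive self-adjoint contraction for
  the inner product weighted by the degrees.

  \<^bold>\<open>Upper bound.\<close> The mixing time is controlled by the largest expected time \<open>K\<close> that the walk, from the
  worst starting point, can spend before leaving a set of at most half of the vertices: if the average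
  degree is at most \<open>\<rho>\<close>, then the walk mixes within \<open>1200 \<rho> K\<close> steps (\<open>mixing_from_hitting\<close>). Indeed \<open>K\<close>
  bounds the inverse spectral gap (\<open>poincare\<close>), and by positivity of \<open>P\<close> the increments \<open>P\<^sup>j g - P\<^bsup>j+1\<^esup> g\<close>
  have norm \<open>O(1/j)\<close>, so for the centred indicator \<open>g\<close> of an event the function \<open>P\<^sup>s g\<close> is small
  simultaneously for all \<open>s\<close> in a window of length comparable to \<open>K\<close>, except at few vertices. The walk
  leaves these exceptional vertices within time \<open>O(K)\<close>, whatever its start, and the time that remains then
  lies in the window.

  To bound \<open>K\<close>, consider the Green function of the walk killed outside \<open>B\<close>. Its level sets are
  connected, and the flow through each of their boundaries is bounded. Cauchy-Schwarz
  and integration over the levels give \<open>K \<le> 2 L0\<^sup>2 + 4 J / \<phi>\<^sup>2\<close>, if the connected sets of at most half of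
  the vertices and of volume larger than \<open>L0\<close> have at least \<open>\<phi>\<close> boundary edges per unit of volume, and
  \<open>J\<close> is the number of dyadic scales above \<open>L0\<close> (\<open>hitting_from_isoperimetry\<close>). The restriction to
  connected sets is essential: the union of the many isolated shortcut-free intervals of logarithmic length has
  conductance \<open>1 / log n\<close> and polynomial size, and would only give \<open>log\<^sup>3 n\<close>.

  In the small world \<open>L0 = O(log n)\<close> and constant \<open>\<phi>\<close> are admissible outside an event of probability
  \<open>O(n\<^bsup>-6\<^esup>)\<close>. Divide the ring into blocks of constant but large length \<open>b\<close>. A connected set meets a family
  of blocks that is connected through ring edges and shortcuts. Such families with \<open>s\<close> blocks are enumerated
  by breadth-first explorations, whose expected number is at most \<open>n (8 + 8 b c) ^ s\<close>
  (\<open>union_bound_explorations\<close>), whereas a family has too few outgoing shortcuts with probability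
  exponentially small in \<open>b s\<close>; for large \<open>b\<close> the latter wins. Blocks that are met but not covered supply
  boundary edges of the ring.

  \<^bold>\<open>Lower bound.\<close> Outside an event of probability \<open>O(n\<^bsup>-3\<^esup>)\<close> some interval of length proportional to
  \<open>log n\<close> is free of shortcuts (\<open>shortcut_free_interval_prob\<close>). From its midpoint the walk needs time of
  order \<open>log\<^sup>2 n\<close> to leave it, by the drift of a parabola (\<open>clean_interval_mixing\<close>), while the interval has
  small stationary mass.

  \<^bold>\<open>Expectation.\<close> Every connected graph mixes in \<open>O(n\<^sup>5)\<close> steps (\<open>crude_mixing\<close>), which is compensated by
  the probability \<open>O(n\<^bsup>-6\<^esup>)\<close> of the exceptional event.
\<close>

section \<open>Elementary inequalities\<close>

text \<open>
  Such \<open>b\<close> are the moments \<open>\<langle>P\<^sup>i g, g\<rangle>\<close> of a positive contraction. Decreasing first and second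
  differences are bounded by their averages, each averaging over \<open>m\<close> indices gains a factor \<open>1/m\<close>,
  and this replaces the spectral estimate \<open>\<lambda>\<^bsup>2m\<^esup> (1 - \<lambda>)\<^sup>2 \<le> 1/m\<^sup>2\<close>.
\<close>

lemma second_difference_bound:
  fixes b :: "nat \<Rightarrow> real"
  assumes b: "\<And>i. 0 \<le> b i" and dd: "\<And>i. b (Suc i) \<le> b i"
    and e0: "\<And>i. 0 \<le> b i - 2 * b (Suc i) + b (Suc (Suc i))"
    and e1: "\<And>i. b (Suc i) - 2 * b (Suc (Suc i)) + b (Suc (Suc (Suc i))) \<le> b i - 2 * b (Suc i) + b (Suc (Suc i))"
  shows "real m * real m * (b (2*m) - 2 * b (Suc (2*m)) + b (Suc (Suc (2*m)))) \<le> b 0"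
proof -
  define D where "D i = b i - b (Suc i)" for i
  define e where "e i = D i - D (Suc i)" for i
  have ee: "e i = b i - 2 * b (Suc i) + b (Suc (Suc i))" for i by (simp add: e_def D_def)
  have Dan: "decseq D" using e0 by (intro decseq_SucI) (simp add: D_def algebra_simps)
  have ean: "decseq e" using e1 by (intro decseq_SucI) (simp add: ee)
  have D0: "0 \<le> D i" for i using dd[of i] by (simp add: D_def)
  have "real m * e (2*m) \<le> (\<Sum>i\<in>{m..<2*m}. e i)"
  proof -
    have "(\<Sum>i\<in>{m..<2*m}. e (2*m)) \<le> (\<Sum>i\<in>{m..<2*m}. e i)"
      using ean by (intro sum_mono) (auto simp: decseq_def)
    then show ?thesis by simp
  qed
  also have "(\<Sum>i\<in>{m..<2*m}. e i) = D m - D (2*m)"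
    unfolding e_def using sum_Suc_diff'[of m "2*m" "\<lambda>i. - D i"] by (simp add: algebra_simps)
  finally have 1: "real m * e (2*m) \<le> D m" using D0[of "2*m"] by simp
  have "real m * D m \<le> (\<Sum>i<m. D i)"
  proof -
    have "(\<Sum>i<m. D m) \<le> (\<Sum>i<m. D i)" using Dan by (intro sum_mono) (auto simp: decseq_def)
    then show ?thesis by simp
  qed
  also have "(\<Sum>i<m. D i) = b 0 - b m" unfolding D_def by (rule sum_lessThan_telescope')
  finally have 2: "real m * D m \<le> b 0" using b[of m] by simp
  have "real m * (real m * e (2*m)) \<le> real m * D m" using 1 by (intro mult_left_mono) auto
  then show ?thesis using 2 by (simp add: ee mult.assoc)
qed

text \<open>
  Picone's inequality: the difference of the two sides is a square divided by \<open>a b\<close>. Summed over the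
  edges of a graph it bounds the energy of \<open>p\<close> from below through any positive superharmonic
  function.
\<close>

lemma picone:
  fixes a b p q :: real
  assumes "0 \<le> a" "0 \<le> b" "a = 0 \<Longrightarrow> p = 0" "b = 0 \<Longrightarrow> q = 0"
  shows "(a - b) * (p\<^sup>2 / a - q\<^sup>2 / b) \<le> (p - q) * (p - q)"
proof (cases "a = 0 \<or> b = 0")
  case True
  then show ?thesis using assms by (auto simp: power2_eq_square)
next
  case False
  then have ab: "0 < a" "0 < b" using assms by auto
  have "(p - q) * (p - q) - (a - b) * (p\<^sup>2 / a - q\<^sup>2 / b) = (a * q - b * p)\<^sup>2 / (a * b)"
    using ab by (simp add: field_simps power2_eq_square)
  moreover have "0 \<le> (a * q - b * p)\<^sup>2 / (a * b)" using ab by simp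
  ultimately show ?thesis by linarith
qed

lemma one_minus_ge_exp:
  fixes p :: real assumes "0 \<le> p" "p \<le> 1/2" shows "exp (- (2 * p)) \<le> 1 - p"
proof -
  have "0 \<le> p * (1 - 2 * p)" using assms by simp
  then have "1 \<le> (1 - p) * (1 + 2 * p)" by (simp add: algebra_simps)
  also have "\<dots> \<le> (1 - p) * exp (2 * p)" using assms by (intro mult_left_mono exp_ge_add_one_self) auto
  finally show ?thesis by (simp add: exp_minus inverse_eq_divide pos_divide_le_eq)
qed

lemma ioc_integral:
  fixes a b :: real assumes "a \<le> b"
  shows "has_bochner_integral lborel (indicator {a<..b} :: real \<Rightarrow> real) (b - a)"
  using has_bochner_integral_real_indicator[of "{a<..b}" lborel] assms by simp

lemma consecutive_change:
  fixes P :: "nat \<Rightarrow> bool"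
  assumes "x < y" "P x \<noteq> P y" shows "\<exists>j. x \<le> j \<and> j < y \<and> P j \<noteq> P (Suc j)"
proof (rule ccontr)
  assume no: "\<not> ?thesis"
  have "x + i \<le> y \<Longrightarrow> P (x + i) = P x" for i
    by (induction i) (use no in auto)
  from this[of "y - x"] show False using assms by simp
qed

lemma sum_union_le:
  fixes f :: "'a \<Rightarrow> real"
  assumes "finite A" "finite B" "\<And>x. 0 \<le> f x" shows "sum f (A \<union> B) \<le> sum f A + sum f B"
  using sum.union_inter[OF assms(1,2), of f] sum_nonneg[of "A \<inter> B" f] assms(3) by simp

lemma sum_UN_le:
  fixes f :: "'a \<Rightarrow> real"
  assumes "finite I" "\<And>i. i \<in> I \<Longrightarrow> finite (A i)" "\<And>x. 0 \<le> f x"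
  shows "sum f (\<Union>i\<in>I. A i) \<le> (\<Sum>i\<in>I. sum f (A i))"
  using assms(1,2)
proof (induction I rule: finite_induct)
  case (insert i I)
  then have "sum f (A i \<union> (\<Union>i\<in>I. A i)) \<le> sum f (A i) + sum f (\<Union>i\<in>I. A i)"
    by (intro sum_union_le assms(3)) auto
  then show ?case using insert by simp
qed simp

section \<open>The lazy step as a self-adjoint operator\<close>

text \<open>
  Connectedness is required in the form in which it is used, as the existence of an edge across every
  nontrivial cut; at least two vertices exclude the degenerate walk that stays put.
\<close>

locale connected_graph =
  fixes V :: "'a set" and E :: "'a set set"
  assumes finite_V: "finite V"
    and edge: "\<And>e. e \<in> E \<Longrightarrow> e \<subseteq> V \<and> card e = 2"
    and card_V: "2 \<le> card V"
    and cut: "\<And>A. A \<subseteq> V \<Longrightarrow> A \<noteq> {} \<Longrightarrow> A \<noteq> V \<Longrightarrow> \<exists>u\<in>A. \<exists>w\<in>V - A. {u, w} \<in> E"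
begin

abbreviation nb :: "'a \<Rightarrow> 'a set" where "nb \<equiv> neighbours E"

abbreviation d :: "'a \<Rightarrow> real" where "d x \<equiv> real (degree E x)"

lemma nb_sym: "y \<in> nb x \<longleftrightarrow> x \<in> nb y"
  by (auto simp: neighbours_def insert_commute)

lemma nb_V: "y \<in> nb x \<Longrightarrow> y \<in> V"
  using edge by (auto simp: neighbours_def)

lemma nb_sub: "nb x \<subseteq> V"
  using nb_V by blast

lemma nb_irrefl: "x \<notin> nb x"
  using edge[of "{x}"] by (auto simp: neighbours_def)

lemma finite_nb [simp]: "finite (nb x)"
  using nb_sub finite_V finite_subset by blast

lemma nb_nonempty: assumes "x \<in> V" shows "nb x \<noteq> {}"
proof -
  have "{x} \<noteq> V" using card_V by auto
  then show ?thesis using cut[of "{x}"] assms by (auto simp: neighbours_def)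
qed

lemma d_pos: "x \<in> V \<Longrightarrow> 0 < d x"
  using nb_nonempty by (simp add: degree_def card_gt_0_iff)

lemma d_ge1: "x \<in> V \<Longrightarrow> 1 \<le> d x"
  using d_pos[of x] by simp

lemma swap: "(\<Sum>x\<in>V. \<Sum>y\<in>nb x. F x y) = (\<Sum>x\<in>V. \<Sum>y\<in>nb x. F y x)"
  for F :: "'a \<Rightarrow> 'a \<Rightarrow> real"
proof -
  have nbV: "{y \<in> V. y \<in> nb x} = nb x" for x using nb_V by blast
  have nbV': "{x \<in> V. y \<in> nb x} = nb y" for y using nb_V nb_sym by blast
  have "(\<Sum>x\<in>V. \<Sum>y\<in>{y \<in> V. y \<in> nb x}. F x y) = (\<Sum>y\<in>V. \<Sum>x\<in>{x \<in> V. y \<in> nb x}. F x y)"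
    by (rule sum.swap_restrict[OF finite_V finite_V])
  then show ?thesis unfolding nbV nbV' .
qed

lemma handshake: "(\<Sum>x\<in>V. d x) = 2 * real (card E)"
proof -
  have "finite E" using edge finite_V by (intro finite_subset[of E "Pow V"]) auto
  have "(\<Sum>x\<in>V. degree E x) = (\<Sum>x\<in>V. card {e\<in>E. x \<in> e})"
  proof (rule sum.cong[OF refl])
    fix x assume "x \<in> V"
    have "bij_betw (\<lambda>y. {x, y}) (nb x) {e\<in>E. x \<in> e}"
    proof (rule bij_betw_imageI)
      show "inj_on (\<lambda>y. {x, y}) (nb x)" by (auto simp: inj_on_def doubleton_eq_iff)
      show "(\<lambda>y. {x, y}) ` nb x = {e \<in> E. x \<in> e}"
      proof (intro equalityI subsetI)
        fix e assume "e \<in> {e \<in> E. x \<in> e}"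
        then have e: "e \<in> E" "x \<in> e" by auto
        then have "card e = 2" using edge by blast
        then obtain y where "e = {x, y}" using e by (auto simp: card_2_iff)
        then show "e \<in> (\<lambda>y. {x, y}) ` nb x" using e by (auto simp: neighbours_def)
      qed (auto simp: neighbours_def)
    qed
    then show "degree E x = card {e\<in>E. x \<in> e}" unfolding degree_def by (rule bij_betw_same_card)
  qed
  also have "\<dots> = (\<Sum>x\<in>V. \<Sum>e\<in>{e\<in>E. x \<in> e}. 1)" by simp
  also have "\<dots> = (\<Sum>e\<in>E. \<Sum>x\<in>{x\<in>V. x \<in> e}. 1)"
    by (rule sum.swap_restrict[OF finite_V \<open>finite E\<close>])
  also have "\<dots> = (\<Sum>e\<in>E. 2)"
  proof (rule sum.cong[OF refl])
    fix e assume "e \<in> E"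
    then have "{x\<in>V. x \<in> e} = e" "card e = 2" using edge by auto
    then show "(\<Sum>x\<in>{x\<in>V. x \<in> e}. 1) = (2::nat)" by simp
  qed
  finally have "(\<Sum>x\<in>V. degree E x) = 2 * card E" by simp
  have "(\<Sum>x\<in>V. d x) = real (\<Sum>x\<in>V. degree E x)" by (rule of_nat_sum[symmetric])
  also have "\<dots> = 2 * real (card E)" unfolding \<open>(\<Sum>x\<in>V. degree E x) = 2 * card E\<close> of_nat_mult by simp
  finally show ?thesis .
qed

definition step :: "('a \<Rightarrow> real) \<Rightarrow> 'a \<Rightarrow> real" where
  "step g x = (g x + (\<Sum>y\<in>nb x. g y) / d x) / 2"

text \<open>
  The inner product of \<open>L\<^sup>2(\<pi>)\<close>, scaled by the total degree so that no division is needed.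
\<close>

definition ip :: "('a \<Rightarrow> real) \<Rightarrow> ('a \<Rightarrow> real) \<Rightarrow> real" where
  "ip f g = (\<Sum>x\<in>V. d x * (f x * g x))"

definition energy :: "('a \<Rightarrow> real) \<Rightarrow> ('a \<Rightarrow> real) \<Rightarrow> real" where
  "energy f g = (\<Sum>x\<in>V. \<Sum>y\<in>nb x. (f x - f y) * (g x - g y)) / 4"

lemma d_step: "x \<in> V \<Longrightarrow> d x * step g x = (d x * g x + (\<Sum>y\<in>nb x. g y)) / 2"
  using d_pos[of x] by (simp add: step_def field_simps)

lemma sum_nb_const: "(\<Sum>y\<in>nb x. c) = d x * c"
  by (simp add: degree_def)

lemma d_laplace: "x \<in> V \<Longrightarrow> d x * (g x - step g x) = (\<Sum>y\<in>nb x. g x - g y) / 2"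
  using d_step[of x g] by (simp add: algebra_simps sum_subtractf degree_def)

lemma ip_sym: "ip f g = ip g f" by (simp add: ip_def mult.commute)

lemma ip_diff: "ip (\<lambda>x. f x - g x) h = ip f h - ip g h"
  by (simp add: ip_def algebra_simps sum_subtractf)

lemma ip_diff_right: "ip h (\<lambda>x. f x - g x) = ip h f - ip h g"
  by (simp add: ip_def algebra_simps sum_subtractf)

lemma ip_nonneg: "0 \<le> ip g g" unfolding ip_def by (intro sum_nonneg) simp

text \<open>
  Summation by parts. The swap of the two ends of an edge symmetrises the Laplacian, and
  self-adjointness of \<open>step\<close> follows at once.
\<close>

lemma ip_laplace: "ip f g - ip (step f) g = energy f g"
proof -
  have "ip f g - ip (step f) g = (\<Sum>x\<in>V. (d x * (f x - step f x)) * g x)"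
    by (simp add: ip_def algebra_simps sum_subtractf)
  also have "\<dots> = (\<Sum>x\<in>V. \<Sum>y\<in>nb x. (f x - f y) * g x) / 2"
    by (simp add: d_laplace sum_distrib_right sum_divide_distrib)
  finally have 1: "ip f g - ip (step f) g = (\<Sum>x\<in>V. \<Sum>y\<in>nb x. (f x - f y) * g x) / 2" .
  have 2: "(\<Sum>x\<in>V. \<Sum>y\<in>nb x. (f x - f y) * g x) = (\<Sum>x\<in>V. \<Sum>y\<in>nb x. (f y - f x) * g y)"
    by (rule swap)
  have "4 * energy f g = (\<Sum>x\<in>V. \<Sum>y\<in>nb x. (f x - f y) * g x) + (\<Sum>x\<in>V. \<Sum>y\<in>nb x. (f y - f x) * g y)"
    unfolding energy_def by (simp add: sum.distrib[symmetric] algebra_simps)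
  with 1 2 show ?thesis by simp
qed

lemma energy_sym: "energy f g = energy g f" by (simp add: energy_def mult.commute)

lemma energy_nonneg: "0 \<le> energy g g"
  unfolding energy_def by (intro divide_nonneg_nonneg sum_nonneg) auto

lemma step_self_adjoint: "ip (step f) g = ip f (step g)"
  using ip_laplace[of f g] ip_laplace[of g f] energy_sym[of f g] ip_sym[of g f] ip_sym[of "step g" f]
  by simp

lemma sum_nb_second: "(\<Sum>x\<in>V. \<Sum>y\<in>nb x. g y) = (\<Sum>x\<in>V. d x * g x)"
  using swap[of "\<lambda>x y. g x"] by (simp add: degree_def)

text \<open>
  Laziness makes the operator positive: the quadratic form is a sum of the squares \<open>(g x + g y)\<^sup>2\<close>
  over the edges.
\<close>

lemma step_psd: "0 \<le> ip (step g) g"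
proof -
  have A: "(\<Sum>x\<in>V. \<Sum>y\<in>nb x. (g x)\<^sup>2) = ip g g" by (simp add: ip_def degree_def power2_eq_square)
  have B: "(\<Sum>x\<in>V. \<Sum>y\<in>nb x. (g y)\<^sup>2) = ip g g"
    using sum_nb_second[of "\<lambda>x. (g x)\<^sup>2"] by (simp add: ip_def power2_eq_square)
  have "4 * ip (step g) g = 4 * ip g g - 4 * energy g g" using ip_laplace[of g g] by simp
  also have "\<dots> = 2 * (\<Sum>x\<in>V. \<Sum>y\<in>nb x. (g x)\<^sup>2) + 2 * (\<Sum>x\<in>V. \<Sum>y\<in>nb x. (g y)\<^sup>2)
      - (\<Sum>x\<in>V. \<Sum>y\<in>nb x. (g x - g y) * (g x - g y))"
    unfolding A B energy_def by simp
  also have "\<dots> = (\<Sum>x\<in>V. \<Sum>y\<in>nb x. (g x + g y)\<^sup>2)"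
    unfolding sum_distrib_left sum.distrib[symmetric] sum_subtractf[symmetric]
    by (intro sum.cong refl) (simp add: power2_eq_square algebra_simps)
  also have "\<dots> \<ge> 0" by (intro sum_nonneg) auto
  finally show ?thesis by simp
qed

text \<open>
  The non-lazy average \<open>Q = 2 P - I\<close> is a contraction, whence \<open>P - P\<^sup>2 = (I - Q\<^sup>2) / 4 \<ge> 0\<close>.
\<close>

lemma step_contract: "ip (step g) (step g) \<le> ip (step g) g"
proof -
  define q where "q = (\<lambda>x. (\<Sum>y\<in>nb x. g y) / d x)"
  have "d x * (q x * q x) \<le> (\<Sum>y\<in>nb x. (g y)\<^sup>2)" if "x \<in> V" for x
  proof -
    have "(\<Sum>y\<in>nb x. 1 * g y)\<^sup>2 \<le> (\<Sum>y\<in>nb x. 1\<^sup>2) * (\<Sum>y\<in>nb x. (g y)\<^sup>2)"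
      by (rule Cauchy_Schwarz_ineq_sum)
    then have "(\<Sum>y\<in>nb x. g y)\<^sup>2 \<le> d x * (\<Sum>y\<in>nb x. (g y)\<^sup>2)" by (simp add: degree_def)
    then have "(\<Sum>y\<in>nb x. g y)\<^sup>2 / d x \<le> (\<Sum>y\<in>nb x. (g y)\<^sup>2)"
      using d_pos[OF that] by (simp add: field_simps)
    then show ?thesis using d_pos[OF that] by (simp add: q_def power2_eq_square)
  qed
  then have "ip q q \<le> (\<Sum>x\<in>V. \<Sum>y\<in>nb x. (g y)\<^sup>2)" unfolding ip_def by (rule sum_mono)
  also have "\<dots> = ip g g" using sum_nb_second[of "\<lambda>x. (g x)\<^sup>2"] by (simp add: ip_def power2_eq_square)
  finally have qq: "ip q q \<le> ip g g" .
  have st: "step g = (\<lambda>x. (g x + q x) / 2)" by (auto simp: step_def q_def)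
  have "4 * (ip (step g) g - ip (step g) (step g)) = ip g g - ip q q"
    unfolding ip_def st sum_distrib_left sum_subtractf[symmetric]
    by (intro sum.cong) (auto simp: field_simps)
  then show ?thesis using qq by simp
qed

abbreviation stp :: "nat \<Rightarrow> ('a \<Rightarrow> real) \<Rightarrow> 'a \<Rightarrow> real" where "stp i \<equiv> step ^^ i"

lemma ip_stp: "ip (stp (i + j) g) h = ip (stp i g) (stp j h)"
proof (induction j arbitrary: i h)
  case (Suc j)
  have "ip (stp (i + Suc j) g) h = ip (step (stp (i + j) g)) h" by simp
  also have "\<dots> = ip (stp (i + j) g) (step h)" by (rule step_self_adjoint)
  also have "\<dots> = ip (stp i g) (stp j (step h))" by (rule Suc)
  finally show ?case by (simp add: funpow_swap1)
qed simp

lemma ip_stp_nonneg: "0 \<le> ip (stp i g) g"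
proof (cases "even i")
  case True
  then obtain j where "i = j + j" by (metis evenE mult_2)
  then show ?thesis using ip_stp[of j j g g] ip_nonneg[of "stp j g"] by simp
next
  case False
  then obtain j where "i = Suc j + j" by (metis oddE Suc_eq_plus1 add.commute add_Suc_right mult_2)
  then show ?thesis using ip_stp[of "Suc j" j g g] step_psd[of "stp j g"] by simp
qed

lemma ip_stp_antimono: "ip (stp (Suc i) g) g \<le> ip (stp i g) g"
proof (cases "even i")
  case True
  then obtain j where "i = j + j" by (metis evenE mult_2)
  then show ?thesis using ip_stp[of j j g g] ip_stp[of "Suc j" j g g] ip_laplace[of "stp j g" "stp j g"]
      energy_nonneg[of "stp j g"] by simp
next
  case False
  then obtain j where "i = Suc j + j" by (metis oddE Suc_eq_plus1 add.commute add_Suc_right mult_2)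
  then show ?thesis using ip_stp[of "Suc j" j g g] ip_stp[of "Suc j" "Suc j" g g]
      step_contract[of "stp j g"] by simp
qed

lemma stp_diff: "stp i (\<lambda>x. g x - h x) = (\<lambda>x. stp i g x - stp i h x)"
proof (induction i)
  case (Suc i)
  then show ?case by (auto simp: step_def sum_subtractf diff_divide_distrib add_divide_distrib)
qed simp

text \<open>
  With \<open>g' = g - P g\<close>, the sequence \<open>\<langle>P\<^sup>i g', g'\<rangle>\<close> is the second difference of the moments
  \<open>\<langle>P\<^sup>i g, g\<rangle>\<close>; both sequences are nonnegative and decreasing because \<open>P\<close> is a positive contraction.
\<close>

lemma time_derivative_bound:
  "real m * real m * ip (\<lambda>x. stp m g x - stp (Suc m) g x) (\<lambda>x. stp m g x - stp (Suc m) g x) \<le> ip g g"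
proof -
  define b where "b i = ip (stp i g) g" for i
  define g' where "g' = (\<lambda>x. g x - step g x)"
  have sp: "stp i g' = (\<lambda>x. stp i g x - stp (Suc i) g x)" for i
    unfolding g'_def stp_diff by (simp add: funpow_swap1)
  have e: "ip (stp i g') g' = b i - 2 * b (Suc i) + b (Suc (Suc i))" for i
    unfolding sp unfolding g'_def ip_diff ip_diff_right
    using step_self_adjoint[of "stp i g" g] step_self_adjoint[of "step (stp i g)" g] by (simp add: b_def)
  have "real m * real m * (b (2*m) - 2 * b (Suc (2*m)) + b (Suc (Suc (2*m)))) \<le> b 0"
  proof (rule second_difference_bound)
    fix i
    show "0 \<le> b i" unfolding b_def by (rule ip_stp_nonneg)
    show "b (Suc i) \<le> b i" unfolding b_def by (rule ip_stp_antimono)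
    show "0 \<le> b i - 2 * b (Suc i) + b (Suc (Suc i))"
      unfolding e[symmetric] by (rule ip_stp_nonneg)
    show "b (Suc i) - 2 * b (Suc (Suc i)) + b (Suc (Suc (Suc i))) \<le> b i - 2 * b (Suc i) + b (Suc (Suc i))"
      unfolding e[symmetric] by (rule ip_stp_antimono)
  qed
  also have "b (2*m) - 2 * b (Suc (2*m)) + b (Suc (Suc (2*m))) = ip (stp m g') (stp m g')"
    unfolding e[symmetric] ip_stp[symmetric] by (simp only: mult_2)
  finally show ?thesis unfolding sp b_def by (simp only: funpow_0)
qed

text \<open>
  An elementary substitute for a maximal inequality: all times in the window \<open>{t..t+T}\<close> are
  controlled at once by telescoping from time \<open>t\<close> and Cauchy-Schwarz.
\<close>

lemma window_pointwise:
  assumes "j \<le> T"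
  shows "(stp (t + j) g y)\<^sup>2 \<le> 2 * (stp t g y)\<^sup>2
      + 2 * real T * (\<Sum>i<T. (stp (t + i) g y - stp (Suc (t + i)) g y)\<^sup>2)"
proof -
  define D where "D i = stp (t + i) g y - stp (Suc (t + i)) g y" for i
  have "(\<Sum>i<j. D i) = stp t g y - stp (t + j) g y"
    unfolding D_def using sum_lessThan_telescope'[of "\<lambda>i. stp (t + i) g y" j] by simp
  then have eq: "stp (t + j) g y = stp t g y - (\<Sum>i<j. D i)" by simp
  have "(\<Sum>i<j. 1 * D i)\<^sup>2 \<le> (\<Sum>i<j. 1\<^sup>2) * (\<Sum>i<j. (D i)\<^sup>2)" by (rule Cauchy_Schwarz_ineq_sum)
  also have "\<dots> \<le> real T * (\<Sum>i<T. (D i)\<^sup>2)"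
    using assms by (auto intro!: mult_mono sum_mono2 sum_nonneg)
  finally have 1: "(\<Sum>i<j. D i)\<^sup>2 \<le> real T * (\<Sum>i<T. (D i)\<^sup>2)" by simp
  have "(a - b)\<^sup>2 \<le> 2 * a\<^sup>2 + 2 * b\<^sup>2" for a b :: real
    using sum_squares_ge_zero[of "a + b" 0] by (simp add: power2_eq_square algebra_simps)
  from this[of "stp t g y" "\<Sum>i<j. D i"] 1 show ?thesis
    unfolding eq by (simp add: D_def)
qed

text \<open>
  Each increment after time \<open>t\<close> has norm at most \<open>\<bar>g\<bar> / t\<close>, so a window of length \<open>T\<close> costs a factor
  \<open>(T / t)\<^sup>2\<close>, which is small once the window starts late compared to its length.
\<close>

lemma window_norm:
  assumes "0 < t"
  shows "(\<Sum>y\<in>V. d y * (2 * (stp t g y)\<^sup>2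
      + 2 * real T * (\<Sum>i<T. (stp (t + i) g y - stp (Suc (t + i)) g y)\<^sup>2)))
    \<le> 2 * ip (stp t g) (stp t g) + 2 * (real T)\<^sup>2 / (real t)\<^sup>2 * ip g g"
proof -
  define D where "D i = (\<lambda>y. stp (t + i) g y - stp (Suc (t + i)) g y)" for i
  have Db: "ip (D i) (D i) \<le> ip g g / (real t)\<^sup>2" for i
  proof -
    have "real (t + i) * real (t + i) * ip (D i) (D i) \<le> ip g g"
      unfolding D_def by (rule time_derivative_bound)
    moreover have "real t * real t * ip (D i) (D i) \<le> real (t + i) * real (t + i) * ip (D i) (D i)"
      by (intro mult_right_mono mult_mono ip_nonneg) simp_all
    ultimately have "real t * real t * ip (D i) (D i) \<le> ip g g" by (rule order_trans[rotated])
    then have "ip (D i) (D i) * (real t)\<^sup>2 \<le> ip g g" by (simp only: power2_eq_square mult.commute)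
    moreover have "0 < (real t)\<^sup>2" using assms by simp
    ultimately show ?thesis by (simp only: pos_le_divide_eq)
  qed
  have "(\<Sum>y\<in>V. d y * (2 * (stp t g y)\<^sup>2 + 2 * real T * (\<Sum>i<T. (D i y)\<^sup>2)))
      = 2 * ip (stp t g) (stp t g) + 2 * real T * (\<Sum>y\<in>V. \<Sum>i<T. d y * (D i y)\<^sup>2)"
    by (simp add: ip_def sum.distrib sum_distrib_left algebra_simps power2_eq_square)
  also have "(\<Sum>y\<in>V. \<Sum>i<T. d y * (D i y)\<^sup>2) = (\<Sum>i<T. ip (D i) (D i))"
    by (subst sum.swap) (simp add: ip_def power2_eq_square)
  also have "\<dots> \<le> (\<Sum>i<T. ip g g / (real t)\<^sup>2)" by (intro sum_mono Db)
  finally have "(\<Sum>y\<in>V. d y * (2 * (stp t g y)\<^sup>2 + 2 * real T * (\<Sum>i<T. (D i y)\<^sup>2)))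
     \<le> 2 * ip (stp t g) (stp t g) + 2 * real T * (real T * (ip g g / (real t)\<^sup>2))"
    by (simp add: mult_left_mono)
  then show ?thesis unfolding D_def by (simp add: power2_eq_square)
qed

end

section \<open>Hitting times control variance\<close>

context connected_graph begin

lemma step_mono: "(\<And>y. f y \<le> g y) \<Longrightarrow> step f x \<le> step g x"
  unfolding step_def by (intro divide_right_mono add_mono sum_mono) auto

lemma step_nonneg: "(\<And>y. 0 \<le> f y) \<Longrightarrow> 0 \<le> step f x"
  unfolding step_def by (intro divide_nonneg_nonneg add_nonneg_nonneg sum_nonneg) auto

lemma step_const: "x \<in> V \<Longrightarrow> step (\<lambda>_. c) x = c"
  using d_pos[of x] by (simp add: step_def sum_nb_const del: sum_constant)

lemma step_cong_V: "x \<in> V \<Longrightarrow> (\<And>y. y \<in> V \<Longrightarrow> f y = g y) \<Longrightarrow> step f x = step g x"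
  unfolding step_def using nb_V by (metis (no_types, lifting) sum.cong)

lemma step_mono_V: "x \<in> V \<Longrightarrow> (\<And>y. y \<in> V \<Longrightarrow> f y \<le> g y) \<Longrightarrow> step f x \<le> step g x"
  unfolding step_def using nb_V by (intro divide_right_mono add_mono sum_mono) auto

lemma step_add: "step (\<lambda>y. f y + g y) x = step f x + step g x"
  by (simp add: step_def sum.distrib add_divide_distrib)

lemma step_sum: "step (\<lambda>y. \<Sum>j\<in>J. f j y) x = (\<Sum>j\<in>J. step (f j) x)"
proof -
  have "(\<Sum>y\<in>nb x. \<Sum>j\<in>J. f j y) = (\<Sum>j\<in>J. \<Sum>y\<in>nb x. f j y)" by (rule sum.swap)
  then show ?thesis unfolding step_def by (simp only: sum.distrib sum_divide_distrib[symmetric])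
qed

lemma step_abs_le: "\<bar>step f x\<bar> \<le> step (\<lambda>y. \<bar>f y\<bar>) x"
proof -
  have "\<bar>(\<Sum>y\<in>nb x. f y) / d x\<bar> \<le> (\<Sum>y\<in>nb x. \<bar>f y\<bar>) / d x"
    by (simp add: divide_right_mono sum_abs)
  moreover have "\<bar>(a + b) / 2\<bar> \<le> (\<bar>a\<bar> + c) / 2" if "\<bar>b\<bar> \<le> c" for a b c :: real
    using that abs_triangle_ineq[of a b] by simp
  ultimately show ?thesis unfolding step_def by blast
qed

definition kill :: "'a set \<Rightarrow> ('a \<Rightarrow> real) \<Rightarrow> 'a \<Rightarrow> real" where
  "kill B f x = (if x \<in> B then step f x else 0)"

text \<open>
  \<open>surv B j x\<close> is the probability that the walk from \<open>x\<close> is in \<open>B\<close> at all times \<open>0..j\<close>.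
\<close>

definition surv :: "'a set \<Rightarrow> nat \<Rightarrow> 'a \<Rightarrow> real" where
  "surv B j = (kill B ^^ j) (\<lambda>x. of_bool (x \<in> B))"

lemma surv_0: "surv B 0 x = of_bool (x \<in> B)" by (simp add: surv_def)

lemma surv_Suc: "surv B (Suc j) x = (if x \<in> B then step (surv B j) x else 0)"
  by (simp add: surv_def kill_def)

lemma surv_off: "x \<notin> B \<Longrightarrow> surv B j x = 0"
  by (cases j) (auto simp: surv_0 surv_Suc)

lemma surv_nonneg: "0 \<le> surv B j x"
proof (induction j arbitrary: x)
  case (Suc j) then show ?case using step_nonneg by (auto simp: surv_Suc)
qed (simp add: surv_0)

lemma surv_antimono_Suc: assumes "B \<subseteq> V" shows "surv B (Suc j) x \<le> surv B j x"
proof (induction j arbitrary: x)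
  case 0
  show ?case
  proof (cases "x \<in> B")
    case True
    then have "step (surv B 0) x \<le> step (\<lambda>_. 1) x" by (intro step_mono) (simp add: surv_0)
    also have "\<dots> = 1" using True assms by (intro step_const) auto
    finally show ?thesis using True by (simp add: surv_Suc surv_0)
  qed (simp add: surv_off)
next
  case (Suc j)
  then have "step (surv B (Suc j)) x \<le> step (surv B j) x" by (intro step_mono)
  then show ?case by (simp add: surv_Suc[of B "Suc j"] surv_Suc[of B j])
qed

lemma surv_antimono: "B \<subseteq> V \<Longrightarrow> i \<le> j \<Longrightarrow> surv B j x \<le> surv B i x"
  using lift_Suc_antimono_le[of "\<lambda>j. surv B j x"] surv_antimono_Suc by blast

text \<open>
  The sum is the expected time to leave \<open>B\<close>, truncated at \<open>N\<close>. Smallness of \<open>B\<close> is measured by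
  cardinality rather than by \<open>\<pi>\<close>, because the expansion of the small world is obtained by counting
  vertices.
\<close>

definition hitting_bound :: "real \<Rightarrow> bool" where
  "hitting_bound K \<longleftrightarrow> (\<forall>B. B \<subseteq> V \<and> 2 * card B \<le> card V \<longrightarrow>
      (\<forall>x\<in>V. \<forall>N. (\<Sum>j<N. surv B j x) \<le> K))"

lemma surv_le:
  assumes "hitting_bound K" "B \<subseteq> V" "2 * card B \<le> card V" "x \<in> V"
  shows "real N * surv B N x \<le> K"
proof -
  have "(\<Sum>j<N. surv B N x) \<le> (\<Sum>j<N. surv B j x)"
    using surv_antimono[OF assms(2)] by (intro sum_mono) auto
  also have "\<dots> \<le> K" using assms unfolding hitting_bound_def by blast
  finally show ?thesis by simp
qed

text \<open>
  Up to a factor 2, the Dirichlet eigenvalue of \<open>B\<close> is at least the inverse of the maximal expected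
  exit time. The
  truncated exit time \<open>h\<close> satisfies \<open>h - P h \<ge> 1/2\<close> on \<open>B\<close>, because the walk survives \<open>2 K\<close> steps with
  probability at most \<open>1/2\<close>, and Picone's inequality transfers this to \<open>\<phi>\<close>.
\<close>

lemma energy_supported:
  assumes hit: "hitting_bound K" and K: "0 < K" and B: "B \<subseteq> V" "2 * card B \<le> card V"
    and off: "\<And>x. x \<notin> B \<Longrightarrow> \<phi> x = 0"
  shows "ip \<phi> \<phi> \<le> 2 * K * energy \<phi> \<phi>"
proof -
  \<comment> \<open>survival beyond time \<open>2 K\<close> has probability at most \<open>1/2\<close>\<close>
  define N where "N = nat \<lceil>2 * K\<rceil>"
  have N: "2 * K \<le> real N" "0 < N" using K unfolding N_def by linarith+
  define h where "h = (\<lambda>x. \<Sum>j<N. surv B j x)"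
  have h0: "0 \<le> h x" for x unfolding h_def by (intro sum_nonneg surv_nonneg)
  have hK: "h x \<le> K" if "x \<in> V" for x
    using hit B that unfolding hitting_bound_def h_def by blast
  have h1: "1 \<le> h x" if "x \<in> B" for x
  proof -
    have "surv B 0 x \<le> h x" unfolding h_def using N by (intro member_le_sum) (auto simp: surv_nonneg)
    then show ?thesis using that by (simp add: surv_0)
  qed
  have lap: "1 / 2 \<le> h x - step h x" if "x \<in> B" for x
  proof -
    have "step h x = (\<Sum>j<N. surv B (Suc j) x)"
      unfolding h_def step_sum using that by (simp add: surv_Suc)
    then have "h x - step h x = (\<Sum>j<N. surv B j x - surv B (Suc j) x)"
      by (simp add: h_def sum_subtractf)
    also have "\<dots> = surv B 0 x - surv B N x" by (rule sum_lessThan_telescope')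
    finally have eq: "h x - step h x = 1 - surv B N x" using that by (simp add: surv_0)
    have "real N * surv B N x \<le> K" using surv_le[OF hit B] that B by auto
    then have "2 * K * surv B N x \<le> K * 1"
      using mult_right_mono[OF N(1) surv_nonneg[of B N x]] by simp
    then have "K * (2 * surv B N x) \<le> K * 1" by (simp only: mult.assoc mult.left_commute[of 2])
    then have "2 * surv B N x \<le> 1" using K by (simp only: mult_le_cancel_left_pos)
    then show ?thesis using eq by simp
  qed
  define \<psi> where "\<psi> = (\<lambda>x. (\<phi> x)\<^sup>2 / h x)"
  have "(h x - h y) * (\<psi> x - \<psi> y) \<le> (\<phi> x - \<phi> y) * (\<phi> x - \<phi> y)" for x y
    unfolding \<psi>_def using h1 off by (intro picone h0) force+
  then have "energy h \<psi> \<le> energy \<phi> \<phi>"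
    unfolding energy_def by (intro divide_right_mono sum_mono) auto
  moreover have "ip \<phi> \<phi> / (2 * K) \<le> energy h \<psi>"
  proof -
    have "energy h \<psi> = (\<Sum>x\<in>V. d x * ((h x - step h x) * \<psi> x))"
      unfolding ip_laplace[symmetric] by (simp add: ip_def algebra_simps sum_subtractf)
    moreover have "ip \<phi> \<phi> / (2 * K) \<le> (\<Sum>x\<in>V. d x * ((h x - step h x) * \<psi> x))"
      unfolding ip_def sum_divide_distrib
    proof (rule sum_mono)
      fix x assume x: "x \<in> V"
      have "\<phi> x * \<phi> x / (2 * K) \<le> (h x - step h x) * \<psi> x"
      proof (cases "x \<in> B")
        case True
        have p: "0 < h x" using h1[OF True] by simp
        have "(\<phi> x)\<^sup>2 / K \<le> \<psi> x"
          unfolding \<psi>_def using p hK[OF x] by (intro divide_left_mono) (auto simp: K)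
        then have "1/2 * ((\<phi> x)\<^sup>2 / K) \<le> (h x - step h x) * \<psi> x"
          using lap[OF True] K by (intro mult_mono) auto
        then show ?thesis by (simp add: power2_eq_square)
      next
        case False
        then show ?thesis using off by (simp add: \<psi>_def)
      qed
      then have "d x * (\<phi> x * \<phi> x / (2 * K)) \<le> d x * ((h x - step h x) * \<psi> x)"
        by (intro mult_left_mono) auto
      then show "d x * (\<phi> x * \<phi> x) / (2 * K) \<le> d x * ((h x - step h x) * \<psi> x)" by simp
    qed
    ultimately show ?thesis by simp
  qed
  ultimately have "ip \<phi> \<phi> / (2 * K) \<le> energy \<phi> \<phi>" by linarith
  then show ?thesis using K by (simp add: pos_divide_le_eq mult.commute)
qed

lemma median_exists:
  fixes g :: "'a \<Rightarrow> real"
  obtains m where "2 * card {x\<in>V. m < g x} \<le> card V" "2 * card {x\<in>V. g x < m} \<le> card V"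
proof -
  have ne: "V \<noteq> {}" using card_V by auto
  \<comment> \<open>the least value with at most half of the vertices strictly above it is a median\<close>
  define W where "W = {v \<in> g ` V. 2 * card {x\<in>V. v < g x} \<le> card V}"
  have fW: "finite W" unfolding W_def using finite_V by simp
  have "{x\<in>V. Max (g ` V) < g x} = {}"
    using finite_V by (auto simp: not_less)
  then have e0: "card {x\<in>V. Max (g ` V) < g x} = 0" by (simp only: card.empty)
  have "Max (g ` V) \<in> W" unfolding W_def mem_Collect_eq e0 using finite_V ne by (simp add: Max_in)
  then have mW: "Min W \<in> W" using fW by (intro Min_in) auto
  define m where "m = Min W"
  have 1: "2 * card {x\<in>V. m < g x} \<le> card V" using mW by (simp add: m_def W_def)
  have 2: "2 * card {x\<in>V. g x < m} \<le> card V"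
  proof (cases "{x\<in>V. g x < m} = {}")
    case True
    then show ?thesis by (simp only: card.empty)
  next
    case False
    define L where "L = g ` {x\<in>V. g x < m}"
    have L: "finite L" "L \<noteq> {}" using False finite_V by (auto simp: L_def)
    then have MxL: "Max L \<in> L" by simp
    then have lt: "Max L < m" "Max L \<in> g ` V" by (auto simp: L_def)
    have "Max L \<notin> W"
    proof
      assume "Max L \<in> W"
      then have "m \<le> Max L" unfolding m_def by (intro Min_le fW)
      then show False using lt by simp
    qed
    then have big: "card V < 2 * card {x\<in>V. Max L < g x}" using lt by (simp add: W_def)
    have "V = {x\<in>V. g x < m} \<union> {x\<in>V. Max L < g x}"
      using lt by auto
    moreover have "{x\<in>V. g x < m} \<inter> {x\<in>V. Max L < g x} = {}"
    proof -
      have "g x \<le> Max L" if "x \<in> V" "g x < m" for x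
        using that L by (intro Max_ge) (auto simp: L_def)
      then show ?thesis by force
    qed
    ultimately have "card V = card {x\<in>V. g x < m} + card {x\<in>V. Max L < g x}"
      using finite_V by (metis (no_types, lifting) card_Un_disjoint finite_Un)
    then show ?thesis using big by linarith
  qed
  show ?thesis by (rule that[OF 1 2])
qed

text \<open>
  The parts of \<open>g\<close> above and below a median live on sets of at most half the vertices, and truncation
  does not increase the energy. Replacing \<open>g\<close> by \<open>g - m\<close> can only increase the norm, since \<open>g\<close> has
  mean zero.
\<close>

lemma poincare:
  assumes hit: "hitting_bound K" and K: "0 < K" and mean: "ip g (\<lambda>_. 1) = 0"
  shows "ip g g \<le> 2 * K * energy g g"
proof -
  obtain m where m: "2 * card {x\<in>V. m < g x} \<le> card V" "2 * card {x\<in>V. g x < m} \<le> card V"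
    by (rule median_exists)
  define p where "p = (\<lambda>x. if x \<in> V then max (g x - m) 0 else 0)"
  define q where "q = (\<lambda>x. if x \<in> V then max (m - g x) 0 else 0)"
  have p: "ip p p \<le> 2 * K * energy p p"
    by (rule energy_supported[OF hit K _ m(1)]) (auto simp: p_def)
  have q: "ip q q \<le> 2 * K * energy q q"
    by (rule energy_supported[OF hit K _ m(2)]) (auto simp: q_def)
  have pt: "(p x - p y) * (p x - p y) + (q x - q y) * (q x - q y) \<le> (g x - g y) * (g x - g y)"
    if "x \<in> V" "y \<in> V" for x y
  proof -
    have key: "(max a 0 - max b 0) * (max a 0 - max b 0) + (max (-a) 0 - max (-b) 0) * (max (-a) 0 - max (-b) 0)
        \<le> (a - b) * (a - b)" for a b :: real
      using mult_nonneg_nonneg[of a "-b"] mult_nonneg_nonneg[of "-a" b] by (auto simp: max_def algebra_simps)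
    show ?thesis using key[of "g x - m" "g y - m"] that by (simp add: p_def q_def)
  qed
  have "energy p p + energy q q \<le> energy g g"
    unfolding energy_def add_divide_distrib[symmetric] sum.distrib[symmetric]
    using pt nb_V by (intro divide_right_mono sum_mono) auto
  then have "2 * K * (energy p p + energy q q) \<le> 2 * K * energy g g" using K by (intro mult_left_mono) auto
  then have "ip p p + ip q q \<le> 2 * K * energy g g" using p q by (simp add: distrib_left)
  moreover have "ip p p + ip q q = ip g g + m\<^sup>2 * (\<Sum>x\<in>V. d x)"
  proof -
    have "p x * p x + q x * q x = (g x - m) * (g x - m)" if "x \<in> V" for x
      using that by (auto simp: p_def q_def max_def algebra_simps)
    then have "ip p p + ip q q = (\<Sum>x\<in>V. d x * ((g x - m) * (g x - m)))"
      unfolding ip_def sum.distrib[symmetric] distrib_left[symmetric] by (intro sum.cong) auto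
    also have "\<dots> = ip g g - 2 * m * ip g (\<lambda>_. 1) + m\<^sup>2 * (\<Sum>x\<in>V. d x)"
      unfolding ip_def sum_distrib_left sum.distrib[symmetric] sum_subtractf[symmetric]
      by (intro sum.cong refl) (simp add: power2_eq_square algebra_simps)
    finally show ?thesis using mean by simp
  qed
  moreover have "0 \<le> m\<^sup>2 * (\<Sum>x\<in>V. d x)" by (intro mult_nonneg_nonneg sum_nonneg) auto
  ultimately show ?thesis by linarith
qed

lemma mean_step: "ip (step g) (\<lambda>_. 1) = ip g (\<lambda>_. 1)"
  unfolding step_self_adjoint unfolding ip_def by (intro sum.cong refl) (simp add: step_const)

lemma mean_stp: "ip (stp t g) (\<lambda>_. 1) = ip g (\<lambda>_. 1)"
  by (induction t) (simp_all add: mean_step)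

lemma variance_decay:
  assumes hit: "hitting_bound K" and K: "0 < K" and mean: "ip g (\<lambda>_. 1) = 0"
  shows "ip (stp t g) (stp t g) \<le> exp (- (real t / (2 * K))) * ip g g"
proof (induction t)
  case (Suc t)
  let ?h = "stp t g"
  have "ip ?h ?h \<le> 2 * K * energy ?h ?h" using mean by (intro poincare[OF hit K]) (simp add: mean_stp)
  then have 1: "ip ?h ?h / (2 * K) \<le> energy ?h ?h" using K by (simp add: pos_divide_le_eq mult.commute)
  have "ip (step ?h) (step ?h) \<le> ip ?h ?h - energy ?h ?h"
    using step_contract[of ?h] ip_laplace[of ?h ?h] by simp
  also have "\<dots> \<le> (1 + (- (1 / (2 * K)))) * ip ?h ?h" using 1 by (simp add: algebra_simps)
  also have "\<dots> \<le> exp (- (1 / (2 * K))) * ip ?h ?h"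
    by (intro mult_right_mono exp_ge_add_one_self ip_nonneg)
  also have "\<dots> \<le> exp (- (1 / (2 * K))) * (exp (- (real t / (2 * K))) * ip g g)"
    by (intro mult_left_mono Suc) auto
  also have "\<dots> = exp (- (real (Suc t) / (2 * K))) * ip g g"
    by (simp add: mult.assoc[symmetric] exp_add[symmetric] add_divide_distrib)
  finally show ?case by simp
qed simp

lemma stp_abs_le1: assumes "\<And>y. y \<in> V \<Longrightarrow> \<bar>g y\<bar> \<le> 1" "x \<in> V" shows "\<bar>stp s g x\<bar> \<le> 1"
  using assms(2)
proof (induction s arbitrary: x)
  case (Suc s)
  have "\<bar>step (stp s g) x\<bar> \<le> step (\<lambda>y. \<bar>stp s g y\<bar>) x" by (rule step_abs_le)
  also have "\<dots> \<le> step (\<lambda>_. 1) x" using Suc by (intro step_mono_V) auto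
  finally show ?case using Suc.prems by (simp add: step_const)
qed (use assms in simp)

text \<open>
  Strong Markov property without stopping times: up to probability \<open>surv B j\<close> the walk has left \<open>B\<close>
  within \<open>j\<close> steps, and at that moment the time still to run lies in the window \<open>{t..t + T}\<close>, on which
  the walk started outside \<open>B\<close> is already close to its mean.
\<close>

lemma hit_then_window:
  assumes B: "B \<subseteq> V" and g1: "\<And>y. y \<in> V \<Longrightarrow> \<bar>g y\<bar> \<le> 1" and "0 \<le> a"
    and win: "\<And>y j. y \<in> V - B \<Longrightarrow> j \<le> T \<Longrightarrow> \<bar>stp (t + j) g y\<bar> \<le> a"
  shows "x \<in> V \<Longrightarrow> j \<le> T \<Longrightarrow> \<bar>stp (t + j) g x\<bar> \<le> a + surv B j x"
proof (induction j arbitrary: x)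
  case 0
  show ?case
  proof (cases "x \<in> B")
    case True
    then show ?thesis using stp_abs_le1[of g x "t + 0", OF g1 0(1)] assms(3) by (simp add: surv_0)
  next
    case False
    then show ?thesis using win[of x 0] 0 by (simp add: surv_0)
  qed
next
  case (Suc j)
  show ?case
  proof (cases "x \<in> B")
    case True
    have "\<bar>stp (t + Suc j) g x\<bar> = \<bar>step (stp (t + j) g) x\<bar>" by simp
    also have "\<dots> \<le> step (\<lambda>y. \<bar>stp (t + j) g y\<bar>) x" by (rule step_abs_le)
    also have "\<dots> \<le> step (\<lambda>y. a + surv B j y) x" using Suc by (intro step_mono_V) auto
    also have "\<dots> = a + surv B (Suc j) x" using True Suc.prems by (simp add: step_add step_const surv_Suc)
    finally show ?thesis .
  next
    case False
    then show ?thesis using win[of x "Suc j"] Suc.prems by (simp add: surv_off)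
  qed
qed

text \<open>
  \<open>B\<close> collects the vertices from which \<open>g\<close> has not relaxed throughout the window. Chebyshev's
  inequality bounds its cardinality, as all degrees are at least one.
\<close>

lemma bad_set_small:
  assumes hit: "hitting_bound K" and K: "0 < K" and mean: "ip g (\<lambda>_. 1) = 0" and a: "0 < a" and t: "0 < t"
  obtains B where "B \<subseteq> V" "\<And>y j. y \<in> V - B \<Longrightarrow> j \<le> T \<Longrightarrow> \<bar>stp (t + j) g y\<bar> \<le> a"
    "real (card B) \<le> 2 * (exp (- (real t / (2 * K))) + (real T)\<^sup>2 / (real t)\<^sup>2) * ip g g / a\<^sup>2"
proof -
  define M where "M y = 2 * (stp t g y)\<^sup>2
      + 2 * real T * (\<Sum>i<T. (stp (t + i) g y - stp (Suc (t + i)) g y)\<^sup>2)" for y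
  define B where "B = {y\<in>V. a\<^sup>2 < M y}"
  have M0: "0 \<le> M y" for y unfolding M_def by (intro add_nonneg_nonneg mult_nonneg_nonneg sum_nonneg) auto
  have 1: "\<bar>stp (t + j) g y\<bar> \<le> a" if "y \<in> V - B" "j \<le> T" for y j
  proof -
    have "(stp (t + j) g y)\<^sup>2 \<le> M y" unfolding M_def by (rule window_pointwise[OF that(2)])
    also have "\<dots> \<le> a\<^sup>2" using that by (auto simp: B_def)
    finally show ?thesis using a abs_le_square_iff[of "stp (t + j) g y" a] by simp
  qed
  have "real (card B) * a\<^sup>2 = (\<Sum>y\<in>B. a\<^sup>2)" by simp
  also have "\<dots> \<le> (\<Sum>y\<in>B. d y * M y)"
  proof (rule sum_mono)
    fix y assume y: "y \<in> B"
    then have "1 * a\<^sup>2 \<le> d y * M y" using d_ge1[of y] by (intro mult_mono) (auto simp: B_def)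
    then show "a\<^sup>2 \<le> d y * M y" by simp
  qed
  also have "\<dots> \<le> (\<Sum>y\<in>V. d y * M y)"
    using M0 finite_V by (intro sum_mono2) (auto simp: B_def)
  also have "\<dots> \<le> 2 * ip (stp t g) (stp t g) + 2 * (real T)\<^sup>2 / (real t)\<^sup>2 * ip g g"
    unfolding M_def by (rule window_norm[OF t])
  also have "\<dots> \<le> 2 * (exp (- (real t / (2 * K))) * ip g g) + 2 * (real T)\<^sup>2 / (real t)\<^sup>2 * ip g g"
    using variance_decay[OF hit K mean, of t] by simp
  also have "\<dots> = 2 * (exp (- (real t / (2 * K))) + (real T)\<^sup>2 / (real t)\<^sup>2) * ip g g"
    by (simp add: algebra_simps)
  finally have "real (card B) \<le> 2 * (exp (- (real t / (2 * K))) + (real T)\<^sup>2 / (real t)\<^sup>2) * ip g g / a\<^sup>2"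
    using a by (simp add: pos_le_divide_eq)
  then show ?thesis using 1 by (intro that[of B]) (auto simp: B_def)
qed

end

section \<open>Hitting times control the mixing time\<close>

context connected_graph begin

lemma edge_imp: "e \<in> E \<Longrightarrow> card e = 2" using edge by blast

lemma lazy_step_sum:
  assumes "z \<in> V"
  shows "(\<Sum>y\<in>V. pmf (lazy_step E z) y * g y) = step g z"
proof -
  have p: "pmf (lazy_step E z) y = (if y = z then 1/2 else 0) + (if y \<in> nb z then 1 / (2 * d z) else 0)" for y
    using pmf_lazy_step[OF finite_nb nb_nonempty[OF assms] edge_imp, where y = y] nb_irrefl[of z]
    by (auto simp: neighbours_def)
  have "(\<Sum>y\<in>V. pmf (lazy_step E z) y * g y)
      = (\<Sum>y\<in>V. if y = z then g y / 2 else 0) + (\<Sum>y\<in>V. if y \<in> nb z then g y / (2 * d z) else 0)"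
    unfolding sum.distrib[symmetric] by (intro sum.cong refl) (auto simp: p distrib_right)
  also have "(\<Sum>y\<in>V. if y = z then g y / 2 else 0) = g z / 2" using assms finite_V by simp
  also have "(\<Sum>y\<in>V. if y \<in> nb z then g y / (2 * d z) else 0) = (\<Sum>y\<in>nb z. g y / (2 * d z))"
    using finite_V nb_sub[of z] by (simp add: sum.inter_restrict[symmetric] Int_absorb1)
  also have "\<dots> = (\<Sum>y\<in>nb z. g y) / d z / 2" by (simp add: sum_divide_distrib mult.commute)
  finally show ?thesis by (simp add: step_def add_divide_distrib)
qed

lemma set_lazy_step: "z \<in> V \<Longrightarrow> set_pmf (lazy_step E z) \<subseteq> V"
  using nb_sub[of z] set_pmf_of_set[OF nb_nonempty finite_nb, of z] by (auto simp: lazy_step_def split: if_splits)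

lemma set_lazy_walk: "x \<in> V \<Longrightarrow> set_pmf (lazy_walk E t x) \<subseteq> V"
proof (induction t)
  case (Suc t)
  then show ?case using set_lazy_step by (auto simp: set_bind_pmf)
qed simp

text \<open>
  Duality between the law of the walk and the action of \<open>step\<close> on functions.
\<close>

lemma walk_stp:
  assumes "x \<in> V"
  shows "(\<Sum>y\<in>V. pmf (lazy_walk E t x) y * g y) = stp t g x"
proof (induction t arbitrary: g)
  case 0
  have "(\<Sum>y\<in>V. pmf (return_pmf x) y * g y) = (\<Sum>y\<in>V. if y = x then g y else 0)"
    by (intro sum.cong refl) simp
  then show ?case using assms finite_V by simp
next
  case (Suc t)
  have b: "pmf (lazy_walk E (Suc t) x) y = (\<Sum>z\<in>V. pmf (lazy_walk E t x) z * pmf (lazy_step E z) y)" for y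
  proof -
    have "pmf (lazy_walk E (Suc t) x) y = measure_pmf.expectation (lazy_walk E t x) (\<lambda>z. pmf (lazy_step E z) y)"
      by (simp add: pmf_bind)
    also have "\<dots> = (\<Sum>z\<in>V. pmf (lazy_step E z) y * pmf (lazy_walk E t x) z)"
      using set_lazy_walk[OF assms, of t] by (intro integral_measure_pmf_real finite_V) auto
    finally show ?thesis by (simp add: mult.commute)
  qed
  have "(\<Sum>y\<in>V. pmf (lazy_walk E (Suc t) x) y * g y)
      = (\<Sum>y\<in>V. \<Sum>z\<in>V. pmf (lazy_walk E t x) z * (pmf (lazy_step E z) y * g y))"
    unfolding b by (simp only: sum_distrib_right mult.assoc)
  also have "\<dots> = (\<Sum>z\<in>V. pmf (lazy_walk E t x) z * (\<Sum>y\<in>V. pmf (lazy_step E z) y * g y))"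
    by (subst sum.swap) (simp only: sum_distrib_left)
  also have "\<dots> = (\<Sum>z\<in>V. pmf (lazy_walk E t x) z * step g z)"
    using lazy_step_sum by (intro sum.cong) auto
  also have "\<dots> = stp t (step g) x" by (rule Suc)
  finally show ?case by (simp add: funpow_swap1)
qed

lemma stationary_eq: "stationary V E x = d x / (\<Sum>x\<in>V. d x)"
  using card_V handshake by (simp add: stationary_def)

lemma vol_pos: "0 < (\<Sum>x\<in>V. d x)"
  using d_pos finite_V card_V by (intro sum_pos) auto

lemma stp_const: "x \<in> V \<Longrightarrow> stp t (\<lambda>_. c) x = c"
proof (induction t arbitrary: x)
  case (Suc t)
  have "step (stp t (\<lambda>_. c)) x = step (\<lambda>_. c) x" using Suc by (intro step_cong_V) auto
  then show ?case using Suc.prems by (simp add: step_const)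
qed simp

text \<open>
  The total variation distance is attained at the event \<open>{\<pi> < \<mu>}\<close> and at its complement.
\<close>

lemma tv_le:
  assumes x: "x \<in> V"
    and b: "\<And>A. A \<subseteq> V \<Longrightarrow> \<bar>stp t (\<lambda>y. of_bool (y \<in> A) - (\<Sum>y\<in>A. stationary V E y)) x\<bar> \<le> a"
  shows "tv_dist V (pmf (lazy_walk E t x)) (stationary V E) \<le> a"
proof -
  define \<mu> where "\<mu> = pmf (lazy_walk E t x)"
  define \<pi> where "\<pi> = stationary V E"
  have diff: "\<bar>(\<Sum>y\<in>A. \<mu> y - \<pi> y)\<bar> \<le> a" if A: "A \<subseteq> V" for A
  proof -
    have "stp t (\<lambda>y. of_bool (y \<in> A)) x = (\<Sum>y\<in>V. \<mu> y * of_bool (y \<in> A))"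
      unfolding \<mu>_def by (rule walk_stp[OF x, symmetric])
    also have "\<dots> = (\<Sum>y\<in>A. \<mu> y)"
      using A finite_V by (intro sum.mono_neutral_cong_right) auto
    finally have "stp t (\<lambda>y. of_bool (y \<in> A) - (\<Sum>y\<in>A. stationary V E y)) x = (\<Sum>y\<in>A. \<mu> y) - (\<Sum>y\<in>A. \<pi> y)"
      unfolding stp_diff stp_const[OF x] \<pi>_def by simp
    then show ?thesis using b[OF A] by (simp add: sum_subtractf)
  qed
  have "(\<Sum>y\<in>V. \<bar>\<mu> y - \<pi> y\<bar>) = (\<Sum>y\<in>{y\<in>V. \<pi> y < \<mu> y}. \<bar>\<mu> y - \<pi> y\<bar>) + (\<Sum>y\<in>V - {y\<in>V. \<pi> y < \<mu> y}. \<bar>\<mu> y - \<pi> y\<bar>)"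
    using finite_V by (subst sum.subset_diff[of "{y\<in>V. \<pi> y < \<mu> y}" V]) auto
  also have "(\<Sum>y\<in>{y\<in>V. \<pi> y < \<mu> y}. \<bar>\<mu> y - \<pi> y\<bar>) = (\<Sum>y\<in>{y\<in>V. \<pi> y < \<mu> y}. \<mu> y - \<pi> y)"
    by (intro sum.cong) auto
  also have "\<dots> \<le> a" using diff[of "{y\<in>V. \<pi> y < \<mu> y}"] by auto
  also have "(\<Sum>y\<in>V - {y\<in>V. \<pi> y < \<mu> y}. \<bar>\<mu> y - \<pi> y\<bar>) = - (\<Sum>y\<in>V - {y\<in>V. \<pi> y < \<mu> y}. \<mu> y - \<pi> y)"
    unfolding sum_negf[symmetric] by (intro sum.cong) auto
  also have "\<dots> \<le> a" using diff[of "V - {y\<in>V. \<pi> y < \<mu> y}"] by auto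
  finally show ?thesis unfolding tv_dist_def \<mu>_def[symmetric] \<pi>_def[symmetric] by simp
qed

text \<open>
  Fix an event \<open>A\<close> and let \<open>g\<close> be its centred indicator. By the spectral gap and the window bound,
  \<open>\<bar>P\<^bsup>s\<^esup> g\<bar> \<le> 1/16\<close> for all \<open>s\<close> in \<open>{t..t + T}\<close> outside a set of at most half the vertices; from any
  vertex the walk leaves this set before time \<open>T\<close> with probability at least \<open>15/16\<close>.
\<close>

lemma mixing_from_hitting:
  assumes hit: "hitting_bound K" and K: "1 \<le> K" and \<rho>: "1 \<le> \<rho>"
    and vol: "(\<Sum>x\<in>V. d x) \<le> \<rho> * real (card V)"
  obtains t where "real t \<le> 1200 * \<rho> * K"
    "\<And>x. x \<in> V \<Longrightarrow> tv_dist V (pmf (lazy_walk E t x)) (stationary V E) \<le> 1/4"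
proof -
  \<comment> \<open>hitting within \<open>T\<close> fails with probability at most \<open>K / T \<le> 1/16\<close>\<close>
  define T where "T = nat \<lceil>16 * K\<rceil>"
  have T: "16 * K \<le> real T" "real T \<le> 17 * K" "0 < T" using K unfolding T_def by linarith+
  \<comment> \<open>late enough that the bad set has at most half of the vertices\<close>
  define t where "t = nat \<lceil>64 * \<rho> * real T\<rceil>"
  have \<rho>T: "1 \<le> \<rho> * real T" using T \<rho> mult_mono[of 1 \<rho> 1 "real T"] by simp
  have t: "64 * \<rho> * real T \<le> real t" "real t \<le> 65 * (\<rho> * real T)" "0 < t"
    using \<rho>T unfolding t_def by linarith+
  have K0: "0 < K" and a0: "0 < (1/16::real)" using K by simp_all
  have small: "exp (- (real t / (2 * K))) + (real T)\<^sup>2 / (real t)\<^sup>2 \<le> 1 / (1024 * \<rho>)"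
  proof -
    have "64 * \<rho> * (16 * K) \<le> 64 * \<rho> * real T" using T \<rho> by (intro mult_left_mono) auto
    then have "512 * \<rho> \<le> real t / (2 * K)" using t(1) K by (simp add: field_simps)
    then have "2 * (11 * ln 2 + ln \<rho>) \<le> 2 * (real t / (2*K))"
    proof -
      have "ln \<rho> \<le> \<rho> - 1" using \<rho> by (intro ln_le_minus_one) simp
      then show ?thesis using \<open>512 * \<rho> \<le> real t / (2 * K)\<close> ln_2_less_1 \<rho> by argo
    qed
    then have "11 * ln 2 + ln \<rho> \<le> real t / (2*K)" by simp
    then have "exp (- (real t / (2 * K))) \<le> exp (- (11 * ln 2 + ln \<rho>))" by simp
    also have "11 * ln 2 + ln \<rho> = ln (2048 * \<rho>)"
      using \<rho> ln_mult[of 2048 \<rho>] ln_realpow[of 2 11] by simp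
    also have "exp (- ln (2048 * \<rho>)) = 1 / (2048 * \<rho>)" using \<rho> by (simp add: exp_minus inverse_eq_divide)
    finally have 1: "exp (- (real t / (2 * K))) \<le> 1 / (2048 * \<rho>)" .
    have "(64 * \<rho> * real T)\<^sup>2 \<le> (real t)\<^sup>2" using t(1) \<rho> by (intro power_mono) auto
    then have "(4096 * \<rho>\<^sup>2) * (real T)\<^sup>2 \<le> (real t)\<^sup>2" by (simp add: power_mult_distrib)
    moreover have "2048 * \<rho> * (real T)\<^sup>2 \<le> (4096 * \<rho>\<^sup>2) * (real T)\<^sup>2"
    proof (rule mult_right_mono)
      have "\<rho> * 1 \<le> \<rho> * \<rho>" using \<rho> by (intro mult_left_mono) auto
      then show "2048 * \<rho> \<le> 4096 * \<rho>\<^sup>2" using \<rho> by (simp add: power2_eq_square)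
    qed simp
    ultimately have "2048 * \<rho> * (real T)\<^sup>2 \<le> (real t)\<^sup>2" by linarith
    then have "(real T)\<^sup>2 / (real t)\<^sup>2 \<le> 1 / (2048 * \<rho>)"
      using t(3) \<rho> by (simp add: divide_le_eq pos_le_divide_eq mult.commute)
    then show ?thesis using 1 by simp
  qed
  have tot: "real (t + T) \<le> 1200 * \<rho> * K"
  proof -
    have "real T \<le> \<rho> * real T" using mult_right_mono[of 1 \<rho> "real T"] \<rho> by simp
    then have "real (t + T) \<le> 66 * (\<rho> * real T)" using t(2) by simp
    also have "\<dots> \<le> 66 * (\<rho> * (17 * K))" using T(2) \<rho> by simp
    finally have "real (t + T) \<le> 1122 * (\<rho> * K)" by simp
    moreover have "0 \<le> \<rho> * K" using \<rho> K by simp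
    ultimately show ?thesis by simp
  qed
  show ?thesis
  proof (rule that[OF tot])
    fix x assume x: "x \<in> V"
    have "\<bar>stp (t + T) (\<lambda>y. of_bool (y \<in> A) - (\<Sum>y\<in>A. stationary V E y)) x\<bar> \<le> 1/4" if A: "A \<subseteq> V" for A
    proof -
      define g where "g = (\<lambda>y. of_bool (y \<in> A) - (\<Sum>y\<in>A. stationary V E y))"
      have pA: "(\<Sum>y\<in>A. stationary V E y) = (\<Sum>y\<in>A. d y) / (\<Sum>y\<in>V. d y)"
        by (simp add: stationary_eq sum_divide_distrib)
      have "(\<Sum>y\<in>A. d y) \<le> (\<Sum>y\<in>V. d y)" using A finite_V by (intro sum_mono2) auto
      then have p01: "0 \<le> (\<Sum>y\<in>A. stationary V E y)" "(\<Sum>y\<in>A. stationary V E y) \<le> 1"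
        unfolding pA using vol_pos by (auto intro!: divide_nonneg_nonneg sum_nonneg)
      have g1: "\<bar>g y\<bar> \<le> 1" for y using p01 by (auto simp: g_def)
      have mean: "ip g (\<lambda>_. 1) = 0"
      proof -
        have "ip g (\<lambda>_. 1) = (\<Sum>y\<in>V. d y * of_bool (y \<in> A)) - (\<Sum>y\<in>V. d y) * (\<Sum>y\<in>A. stationary V E y)"
          by (simp add: ip_def g_def sum_subtractf right_diff_distrib sum_distrib_right)
        also have "(\<Sum>y\<in>V. d y * of_bool (y \<in> A)) = (\<Sum>y\<in>A. d y)"
          using A finite_V by (intro sum.mono_neutral_cong_right) auto
        finally show ?thesis unfolding pA using vol_pos by simp
      qed
      have gg: "ip g g \<le> \<rho> * real (card V)"
      proof -
        have "ip g g \<le> (\<Sum>y\<in>V. d y * 1)" unfolding ip_def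
        proof (intro sum_mono mult_left_mono)
          fix y show "g y * g y \<le> 1" using g1[of y] abs_le_square_iff[of "g y" 1] by (simp add: power2_eq_square)
        qed simp
        then show ?thesis using vol by simp
      qed
      obtain B where B: "B \<subseteq> V" "\<And>y j. y \<in> V - B \<Longrightarrow> j \<le> T \<Longrightarrow> \<bar>stp (t + j) g y\<bar> \<le> 1/16"
        "real (card B) \<le> 2 * (exp (- (real t / (2 * K))) + (real T)\<^sup>2 / (real t)\<^sup>2) * ip g g / (1/16)\<^sup>2"
        using bad_set_small[OF hit K0 mean a0 t(3), where T = T] by blast
      have "2 * (exp (- (real t / (2 * K))) + (real T)\<^sup>2 / (real t)\<^sup>2) * ip g g
          \<le> 2 * (1 / (1024 * \<rho>)) * (\<rho> * real (card V))"
        using small gg ip_nonneg \<rho> by (intro mult_mono) auto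
      then have "real (card B) \<le> 256 * (2 * (1 / (1024 * \<rho>)) * (\<rho> * real (card V)))"
        using B(3) by (simp add: power2_eq_square)
      also have "\<dots> = real (card V) / 2" using \<rho> by simp
      finally have half: "2 * card B \<le> card V" by linarith
      have "real T * surv B T x \<le> K" by (rule surv_le[OF hit B(1) half x])
      moreover have "16 * K * surv B T x \<le> real T * surv B T x" using T by (intro mult_right_mono surv_nonneg) auto
      ultimately have "K * (16 * surv B T x) \<le> K * 1" by simp
      then have s: "surv B T x \<le> 1/16" using K by (simp only: mult_le_cancel_left_pos)
      have "\<bar>stp (t + T) g x\<bar> \<le> 1/16 + surv B T x"
        by (rule hit_then_window[OF B(1) g1 _ B(2)]) (use x in auto)
      then show ?thesis using s unfolding g_def by linarith
    qed
    then show "tv_dist V (pmf (lazy_walk E (t + T) x)) (stationary V E) \<le> 1/4"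
      by (rule tv_le[OF x])
  qed
qed

lemma mixing_time_le:
  assumes "\<And>x. x \<in> V \<Longrightarrow> tv_dist V (pmf (lazy_walk E t x)) (stationary V E) \<le> 1/4"
  shows "mixing_time V E \<le> t"
proof -
  have "V \<noteq> {}" using card_V by auto
  then show ?thesis unfolding mixing_time_def
    using finite_V assms by (subst Max_le_iff) (auto intro!: Least_le)
qed

lemma mixing_time_ge:
  assumes "\<And>x. x \<in> V \<Longrightarrow> tv_dist V (pmf (lazy_walk E t x)) (stationary V E) \<le> 1/4" and "x \<in> V"
    and lb: "\<And>t. t < s \<Longrightarrow> 1/4 < tv_dist V (pmf (lazy_walk E t x)) (stationary V E)"
  shows "s \<le> mixing_time V E"
proof -
  define L where "L = (LEAST t. tv_dist V (pmf (lazy_walk E t x)) (stationary V E) \<le> 1/4)"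
  have "tv_dist V (pmf (lazy_walk E L x)) (stationary V E) \<le> 1/4"
    unfolding L_def by (rule LeastI) (rule assms(1)[OF assms(2)])
  then have "s \<le> L" using lb[of L] by linarith
  also have "L \<le> mixing_time V E" unfolding mixing_time_def L_def
    using finite_V assms(2) by (intro Max_ge) auto
  finally show ?thesis .
qed

end

section \<open>Isoperimetry of connected sets controls hitting times\<close>

definition internally_connected :: "'a set set \<Rightarrow> 'a set \<Rightarrow> bool" where
  "internally_connected E S \<longleftrightarrow>
     (\<forall>A. A \<subseteq> S \<and> A \<noteq> {} \<and> A \<noteq> S \<longrightarrow> (\<exists>u\<in>A. \<exists>w\<in>S - A. {u, w} \<in> E))"

definition boundary :: "'a set set \<Rightarrow> 'a set \<Rightarrow> nat" where
  "boundary E S = (\<Sum>v\<in>S. card (neighbours E v - S))"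

definition vol :: "'a set set \<Rightarrow> 'a set \<Rightarrow> real" where
  "vol E S = (\<Sum>v\<in>S. real (degree E v))"

lemma boundary_card_Sigma:
  assumes "finite S" "\<And>v. finite (neighbours E v)"
  shows "boundary E S = card (Sigma S (\<lambda>v. neighbours E v - S))"
  unfolding boundary_def using assms by (subst card_SigmaI) auto

context connected_graph begin

text \<open>
  Green's identity: contributions of edges inside \<open>S\<close> cancel.
\<close>

lemma flux:
  assumes "S \<subseteq> V"
  shows "(\<Sum>v\<in>S. d v * (f v - step f v)) = (\<Sum>v\<in>S. \<Sum>y\<in>nb v - S. f v - f y) / 2"
proof -
  have fS: "finite S" using assms finite_V finite_subset by blast
  have inner: "(\<Sum>v\<in>S. \<Sum>y\<in>nb v \<inter> S. f v - f y) = 0"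
  proof -
    have e1: "{y\<in>S. y \<in> nb v} = nb v \<inter> S" "{v\<in>S. y \<in> nb v} = nb y \<inter> S" for v y using nb_sym by blast+
    have "(\<Sum>v\<in>S. \<Sum>y\<in>nb v \<inter> S. f v - f y) = (\<Sum>y\<in>S. \<Sum>v\<in>nb y \<inter> S. f v - f y)"
      using sum.swap_restrict[OF fS fS, of "\<lambda>v y. f v - f y" "\<lambda>v y. y \<in> nb v"] unfolding e1 .
    also have "\<dots> = - (\<Sum>y\<in>S. \<Sum>v\<in>nb y \<inter> S. f y - f v)" by (simp add: sum_negf[symmetric])
    finally show ?thesis by simp
  qed
  have "(\<Sum>v\<in>S. d v * (f v - step f v)) = (\<Sum>v\<in>S. (\<Sum>y\<in>nb v. f v - f y) / 2)"
    using assms d_laplace by (intro sum.cong) auto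
  also have "\<dots> = (\<Sum>v\<in>S. \<Sum>y\<in>nb v. f v - f y) / 2" by (simp only: sum_divide_distrib)
  also have "(\<Sum>v\<in>S. \<Sum>y\<in>nb v. f v - f y)
      = (\<Sum>v\<in>S. (\<Sum>y\<in>nb v \<inter> S. f v - f y) + (\<Sum>y\<in>nb v - S. f v - f y))"
    by (intro sum.cong refl sum.Int_Diff) simp
  finally show ?thesis using inner by (simp add: sum.distrib)
qed

lemma boundary_ge1:
  assumes "S \<subseteq> V" "S \<noteq> {}" "S \<noteq> V" shows "1 \<le> boundary E S"
proof -
  obtain u w where "u \<in> S" "w \<in> V - S" "{u, w} \<in> E" using cut[OF assms] by blast
  then have "w \<in> nb u - S" by (auto simp: neighbours_def)
  then have "card (nb u - S) \<noteq> 0" by auto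
  moreover have "card (nb u - S) \<le> boundary E S"
    unfolding boundary_def using \<open>u \<in> S\<close> assms finite_V finite_subset by (intro member_le_sum) auto
  ultimately show ?thesis by linarith
qed

end

text \<open>
  The setting is that of a Green function with pole \<open>x\<close>: \<open>f\<close> is subharmonic away from \<open>x\<close> where it is
  positive, and its total flux is at most one.
\<close>

locale pole_function = connected_graph V E for V :: "'a set" and E +
  fixes f :: "'a \<Rightarrow> real" and x :: 'a
  assumes f0: "\<And>v. 0 \<le> f v" and x: "x \<in> V"
    and sub: "\<And>v. v \<in> V \<Longrightarrow> 0 < f v \<Longrightarrow> d v * (f v - step f v) \<le> of_bool (v = x)"
    and half: "2 * card {v\<in>V. 0 < f v} \<le> card V"
begin

definition level :: "real \<Rightarrow> 'a set" where "level t = {v\<in>V. t \<le> f v}"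

lemma level_sub: "level t \<subseteq> V" by (auto simp: level_def)

lemma finite_level: "finite (level t)" using level_sub finite_V finite_subset by blast

lemma level_half: assumes "0 < t" shows "2 * card (level t) \<le> card V"
proof -
  have "card (level t) \<le> card {v\<in>V. 0 < f v}"
    using assms finite_V by (intro card_mono) (auto simp: level_def)
  then show ?thesis using half by linarith
qed

lemma level_not_V: assumes "0 < t" shows "level t \<noteq> V"
  using level_half[OF assms] card_V by auto

text \<open>
  Away from the pole \<open>f\<close> is subharmonic, so no flux can leave a part \<open>D\<close> of the level set that avoids
  the pole. But if no edge joins \<open>D\<close> to the rest of the level set, then \<open>f\<close> drops along every edge that
  leaves \<open>D\<close>, and such edges exist since the graph is connected.
\<close>

lemma isolated_part_contains_pole:
  assumes t: "0 < t" and D: "D \<subseteq> level t" "D \<noteq> {}" and iso: "\<And>u w. u \<in> D \<Longrightarrow> w \<in> level t - D \<Longrightarrow> {u, w} \<notin> E"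
  shows "x \<in> D"
proof (rule ccontr)
  assume nx: "x \<notin> D"
  have DV: "D \<subseteq> V" using D level_sub by blast
  have fD: "finite D" using DV finite_V finite_subset by blast
  have "(\<Sum>v\<in>D. d v * (f v - step f v)) \<le> (\<Sum>v\<in>D. 0)"
  proof (rule sum_mono)
    fix v assume v: "v \<in> D"
    then have "v \<in> V" "0 < f v" using D t by (auto simp: level_def)
    then show "d v * (f v - step f v) \<le> 0" using sub[of v] v nx by (cases "v = x") auto
  qed
  then have le: "(\<Sum>v\<in>D. \<Sum>y\<in>nb v - D. f v - f y) \<le> 0" using flux[OF DV, of f] by simp
  have pos: "0 < f v - f y" if "v \<in> D" "y \<in> nb v - D" for v y
  proof -
    have "y \<notin> level t" using iso[of v y] that by (auto simp: neighbours_def)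
    moreover have "y \<in> V" using that nb_V by blast
    moreover have "t \<le> f v" using that D by (auto simp: level_def)
    ultimately show ?thesis by (auto simp: level_def)
  qed
  have "D \<noteq> V" using D level_not_V[OF t] level_sub[of t] by blast
  then obtain u w where uw: "u \<in> D" "w \<in> V - D" "{u, w} \<in> E" using cut[OF DV D(2)] by blast
  have "0 < (\<Sum>v\<in>D. \<Sum>y\<in>nb v - D. f v - f y)"
  proof (rule sum_pos2[OF fD uw(1)])
    show "0 < (\<Sum>y\<in>nb u - D. f u - f y)"
    proof (rule sum_pos)
      show "finite (nb u - D)" by simp
      show "nb u - D \<noteq> {}" using uw by (auto simp: neighbours_def)
    qed (use pos uw in blast)
    show "0 \<le> (\<Sum>y\<in>nb v - D. f v - f y)" if "v \<in> D" for v
      by (intro sum_nonneg less_imp_le pos[OF that])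
  qed
  then show False using le by simp
qed

text \<open>
  If the level set split into two parts without an edge between them, both would contain the pole. This
  is the reason why only connected sets have to expand.
\<close>

lemma level_connected: assumes "0 < t" shows "internally_connected E (level t)"
  unfolding internally_connected_def
proof (intro allI impI, rule ccontr)
  fix A assume A: "A \<subseteq> level t \<and> A \<noteq> {} \<and> A \<noteq> level t" and no: "\<not> (\<exists>u\<in>A. \<exists>w\<in>level t - A. {u, w} \<in> E)"
  have "x \<in> A" using A no by (intro isolated_part_contains_pole[OF assms]) auto
  moreover have "x \<in> level t - A"
  proof (rule isolated_part_contains_pole[OF assms])
    fix u w assume "u \<in> level t - A" "w \<in> level t - (level t - A)"
    then show "{u, w} \<notin> E" using no by (auto simp: insert_commute)
  qed (use A in auto)
  ultimately show False by simp
qed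

lemma level_flow:
  assumes "0 < t"
  shows "(\<Sum>v\<in>level t. \<Sum>y\<in>nb v - level t. f v - f y) \<le> 2"
proof -
  have "(\<Sum>v\<in>level t. d v * (f v - step f v)) \<le> (\<Sum>v\<in>level t. of_bool (v = x))"
    using assms by (intro sum_mono sub) (auto simp: level_def)
  also have "\<dots> \<le> 1" using finite_level by (simp add: of_bool_def)
  finally show ?thesis using flux[OF level_sub, of f t] by simp
qed

text \<open>
  The flow through the boundary of a level set is at most 2, so a boundary of many edges forces the
  drops along them to be small on average (Cauchy-Schwarz).
\<close>

lemma boundary_resistance:
  assumes "0 < t"
  shows "(real (boundary E (level t)))\<^sup>2 \<le> (\<Sum>v\<in>level t. \<Sum>y\<in>nb v - level t. 2 / (f v - f y))"
proof -
  define P where "P = Sigma (level t) (\<lambda>v. nb v - level t)"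
  have sP: "(\<Sum>v\<in>level t. \<Sum>y\<in>nb v - level t. F v y) = (\<Sum>p\<in>P. F (fst p) (snd p))" for F :: "'a \<Rightarrow> 'a \<Rightarrow> real"
    unfolding P_def using finite_level by (subst sum.Sigma) (auto simp: case_prod_beta)
  define a where "a p = f (fst p) - f (snd p)" for p
  have pos: "0 < a p" if "p \<in> P" for p
  proof -
    obtain v y where p0: "p = (v, y)" by (cases p)
    then have p: "v \<in> level t" "y \<in> nb v" "y \<notin> level t" using that by (auto simp: P_def)
    then show ?thesis using nb_V[of y v] p0 by (auto simp: level_def a_def)
  qed
  have "real (boundary E (level t)) = (\<Sum>p\<in>P. 1)"
    unfolding sP[symmetric, of "\<lambda>_ _. 1"] boundary_def by simp
  also have "\<dots> = (\<Sum>p\<in>P. sqrt (a p) * (1 / sqrt (a p)))"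
  proof (rule sum.cong[OF refl])
    fix p assume "p \<in> P"
    then have "sqrt (a p) \<noteq> 0" using pos[of p] by simp
    then show "1 = sqrt (a p) * (1 / sqrt (a p))" by simp
  qed
  finally have "(real (boundary E (level t)))\<^sup>2 \<le> (\<Sum>p\<in>P. (sqrt (a p))\<^sup>2) * (\<Sum>p\<in>P. (1 / sqrt (a p))\<^sup>2)"
    using Cauchy_Schwarz_ineq_sum[of "\<lambda>p. sqrt (a p)" "\<lambda>p. 1 / sqrt (a p)" P] by simp
  also have "(\<Sum>p\<in>P. (sqrt (a p))\<^sup>2) = (\<Sum>p\<in>P. a p)"
    by (intro sum.cong refl real_sqrt_pow2 less_imp_le pos)
  also have "(\<Sum>p\<in>P. (1 / sqrt (a p))\<^sup>2) = (\<Sum>p\<in>P. 1 / a p)"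
  proof (rule sum.cong[OF refl])
    fix p assume "p \<in> P"
    then have "0 \<le> a p" using pos[of p] by simp
    then show "(1 / sqrt (a p))\<^sup>2 = 1 / a p" by (simp add: power_divide)
  qed
  also have "(\<Sum>p\<in>P. a p) * (\<Sum>p\<in>P. 1 / a p) \<le> 2 * (\<Sum>p\<in>P. 1 / a p)"
  proof (rule mult_right_mono)
    show "(\<Sum>p\<in>P. a p) \<le> 2" using level_flow[OF assms] unfolding sP a_def .
    show "0 \<le> (\<Sum>p\<in>P. 1 / a p)" by (intro sum_nonneg divide_nonneg_pos pos) auto
  qed
  finally show ?thesis unfolding sP a_def by (simp add: sum_distrib_left)
qed

definition top_part :: "real \<Rightarrow> 'a set" where
  "top_part M = {v\<in>V. 0 < f v \<and> vol E (level (f v)) \<le> M}"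

text \<open>
  Every edge contributes a multiple of the indicator of the levels that it crosses, with total mass 2.
  Hence the integral over all levels merely counts the edges with upper end in \<open>top_part M\<close>.
\<close>

definition resistance :: "real \<Rightarrow> real \<Rightarrow> real" where
  "resistance M t = (\<Sum>v\<in>top_part M. \<Sum>y\<in>nb v.
      if f y < f v then 2 / (f v - f y) * indicator {f y<..f v} t else 0)"

lemma vol_mono: "A \<subseteq> B \<Longrightarrow> B \<subseteq> V \<Longrightarrow> vol E A \<le> vol E B"
  unfolding vol_def using finite_V finite_subset by (intro sum_mono2) auto

text \<open>
  \<open>top_part M\<close> is contained in one of the level sets of volume at most \<open>M\<close>, namely that of its lowest
  vertex.
\<close>

lemma vol_top_part: assumes "0 \<le> M" shows "vol E (top_part M) \<le> M"
proof (cases "top_part M = {}")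
  case False
  have fin: "finite (top_part M)" using finite_V by (auto simp: top_part_def)
  have "Min (f ` top_part M) \<in> f ` top_part M" using fin False by (intro Min_in) auto
  then obtain v where "v \<in> top_part M" "f v = Min (f ` top_part M)" by auto
  then have v: "v \<in> top_part M" "\<And>w. w \<in> top_part M \<Longrightarrow> f v \<le> f w" using fin by auto
  have "top_part M \<subseteq> level (f v)" using v(2) by (auto simp: level_def top_part_def)
  then have "vol E (top_part M) \<le> vol E (level (f v))" by (rule vol_mono[OF _ level_sub])
  then show ?thesis using v by (auto simp: top_part_def)
qed (use assms in \<open>simp add: vol_def\<close>)

lemma resistance_nonneg: "0 \<le> resistance M t"
  unfolding resistance_def by (intro sum_nonneg) auto

lemma boundary_le_resistance:
  assumes t: "0 < t" and V: "vol E (level t) \<le> M"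
  shows "(real (boundary E (level t)))\<^sup>2 \<le> resistance M t"
proof -
  have sub: "level t \<subseteq> top_part M"
  proof
    fix v assume v: "v \<in> level t"
    then have "level (f v) \<subseteq> level t" by (auto simp: level_def)
    then have "vol E (level (f v)) \<le> M" using V vol_mono[OF _ level_sub] by (meson order_trans)
    then show "v \<in> top_part M" using v t by (auto simp: top_part_def level_def)
  qed
  have "(\<Sum>v\<in>level t. \<Sum>y\<in>nb v - level t. 2 / (f v - f y))
      = (\<Sum>v\<in>level t. \<Sum>y\<in>nb v - level t. if f y < f v then 2 / (f v - f y) * indicator {f y<..f v} t else 0)"
  proof (intro sum.cong refl)
    fix v y assume v: "v \<in> level t" and y: "y \<in> nb v - level t"
    then have "t \<le> f v" "f y < t" using nb_V[of y v] by (auto simp: level_def)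
    then show "2 / (f v - f y) = (if f y < f v then 2 / (f v - f y) * indicator {f y<..f v} t else 0)" by simp
  qed
  also have "\<dots> \<le> (\<Sum>v\<in>level t. \<Sum>y\<in>nb v. if f y < f v then 2 / (f v - f y) * indicator {f y<..f v} t else 0)"
    by (intro sum_mono sum_mono2) auto
  also have "\<dots> \<le> resistance M t"
    unfolding resistance_def using sub finite_V by (intro sum_mono2 sum_nonneg) (auto simp: top_part_def)
  finally show ?thesis using boundary_resistance[OF t] by linarith
qed

lemma resistance_integral:
  assumes "0 \<le> M"
  obtains I where "has_bochner_integral lborel (resistance M) I" "I \<le> 2 * M"
proof -
  define I where "I = (\<Sum>v\<in>top_part M. \<Sum>y\<in>nb v. if f y < f v then 2 else (0::real))"
  have "has_bochner_integral lborel (\<lambda>t. resistance M t) I"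
    unfolding resistance_def I_def
  proof (intro has_bochner_integral_sum)
    fix v y
    have unit: "0 < g \<Longrightarrow> 2 / g * g = 2" for g :: real by simp
    show "has_bochner_integral lborel (\<lambda>t. if f y < f v then 2 / (f v - f y) * indicator {f y<..f v} t else 0)
        (if f y < f v then 2 else 0)"
    proof (cases "f y < f v")
      case True
      have "has_bochner_integral lborel (\<lambda>t. 2 / (f v - f y) * indicator {f y<..f v} t) (2 / (f v - f y) * (f v - f y))"
        using True by (intro has_bochner_integral_mult_right ioc_integral) auto
      moreover have "2 / (f v - f y) * (f v - f y) = 2" by (rule unit) (use True in simp)
      ultimately show ?thesis using True by (simp only: if_True)
    qed (simp add: has_bochner_integral_zero)
  qed
  moreover have "I \<le> 2 * M"
  proof -
    have "I \<le> (\<Sum>v\<in>top_part M. \<Sum>y\<in>nb v. 2)" unfolding I_def by (intro sum_mono) auto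
    also have "\<dots> = 2 * vol E (top_part M)"
      by (simp add: vol_def degree_def sum_distrib_left mult.commute)
    finally show ?thesis using vol_top_part[OF assms] by simp
  qed
  ultimately show ?thesis by (intro that[of I]) (auto simp: eta_contract_eq)
qed

text \<open>
  The left-hand side is the integral over \<open>t\<close> of the volume of \<open>{f \<ge> t}\<close>. On the levels of volume at
  most \<open>M\<close> the squared boundary integrates to at most \<open>2 M\<close>. Where the volume is at most \<open>L0\<close>, a boundary
  of at least one edge gives the contribution \<open>2 L0\<^sup>2\<close>; on each dyadic scale above \<open>L0\<close> linear
  expansion gives \<open>4 / \<phi>\<^sup>2\<close>. Thus the number \<open>J\<close> of scales is not multiplied by \<open>L0\<^sup>2\<close>.
\<close>

lemma level_set_bound:
  assumes L0: "0 < L0" and ph: "0 < \<phi>" and J: "vol E V \<le> 2 ^ J * L0"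
    and iso: "\<And>S. S \<subseteq> V \<Longrightarrow> S \<noteq> {} \<Longrightarrow> internally_connected E S \<Longrightarrow> 2 * card S \<le> card V \<Longrightarrow>
        L0 < vol E S \<Longrightarrow> \<phi> * vol E S \<le> real (boundary E S)"
  shows "(\<Sum>v\<in>V. d v * f v) \<le> 2 * L0\<^sup>2 + 4 * real J / \<phi>\<^sup>2"
proof -
  \<comment> \<open>\<open>I M\<close> is the integral of \<open>resistance M\<close>\<close>
  define I where "I M = (SOME I. has_bochner_integral lborel (resistance M) I \<and> I \<le> 2 * M)" for M
  have I: "has_bochner_integral lborel (resistance M) (I M)" "I M \<le> 2 * M" if "0 \<le> M" for M
  proof -
    have "\<exists>I. has_bochner_integral lborel (resistance M) I \<and> I \<le> 2 * M"
      using resistance_integral[OF that] by blast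
    from someI_ex[OF this] show "has_bochner_integral lborel (resistance M) (I M)" "I M \<le> 2 * M"
      unfolding I_def by auto
  qed
  define lhs where "lhs t = (\<Sum>v\<in>V. d v * indicator {0<..f v} t)" for t :: real
  define rhs where "rhs t = L0 * resistance L0 t
      + (\<Sum>j<J. 1 / (\<phi>\<^sup>2 * (2 ^ j * L0)) * resistance (2 ^ Suc j * L0) t)" for t
  have il: "has_bochner_integral lborel lhs (\<Sum>v\<in>V. d v * f v)"
  proof -
    have "has_bochner_integral lborel (\<lambda>t. \<Sum>v\<in>V. d v * indicator {0<..f v} t) (\<Sum>v\<in>V. d v * (f v - 0))"
      by (intro has_bochner_integral_sum has_bochner_integral_mult_right ioc_integral f0)
    then show ?thesis unfolding lhs_def by simp
  qed
  have ir: "has_bochner_integral lborel rhs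
      (L0 * I L0 + (\<Sum>j<J. 1 / (\<phi>\<^sup>2 * (2 ^ j * L0)) * I (2 ^ Suc j * L0)))"
    unfolding rhs_def using L0
    by (intro has_bochner_integral_add has_bochner_integral_sum has_bochner_integral_mult_right I) auto
  have pos: "0 \<le> 1 / (\<phi>\<^sup>2 * (2 ^ j * L0))" for j :: nat using L0 by simp
  have pt: "lhs t \<le> rhs t" for t
  proof (cases "0 < t \<and> level t \<noteq> {}")
    case False
    then have "lhs t = 0" unfolding lhs_def
      by (intro sum.neutral) (auto simp: level_def indicator_def)
    moreover have "0 \<le> rhs t" unfolding rhs_def
      using L0 pos by (intro add_nonneg_nonneg sum_nonneg mult_nonneg_nonneg resistance_nonneg) auto
    ultimately show ?thesis by simp
  next
    case True
    then have t: "0 < t" and ne: "level t \<noteq> {}" by auto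
    define v where "v = vol E (level t)"
    have lv: "lhs t = v"
    proof -
      have "lhs t = (\<Sum>w\<in>V. if w \<in> level t then d w else 0)"
        unfolding lhs_def using t by (intro sum.cong) (auto simp: level_def indicator_def)
      also have "\<dots> = v"
        unfolding v_def vol_def using finite_V level_sub[of t]
        by (simp add: sum.inter_restrict[symmetric] Int_absorb1)
      finally show ?thesis .
    qed
    define c where "c = real (boundary E (level t))"
    have c1: "1 \<le> c" unfolding c_def using boundary_ge1[OF level_sub ne level_not_V[OF t]] by simp
    show ?thesis
    proof (cases "v \<le> L0")
      case True
      have "c\<^sup>2 \<le> resistance L0 t" unfolding c_def
        using True by (intro boundary_le_resistance[OF t]) (simp add: v_def)
      moreover have "1 \<le> c\<^sup>2" using c1 by simp
      ultimately have "L0 * 1 \<le> L0 * resistance L0 t" using L0 by (intro mult_left_mono) auto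
      moreover have "0 \<le> (\<Sum>j<J. 1 / (\<phi>\<^sup>2 * (2 ^ j * L0)) * resistance (2 ^ Suc j * L0) t)"
        using pos by (intro sum_nonneg mult_nonneg_nonneg resistance_nonneg)
      ultimately show ?thesis using True lv by (simp add: rhs_def)
    next
      case False
      have vJ: "v \<le> 2 ^ J * L0" using J vol_mono[OF level_sub, of t] by (simp add: v_def)
      \<comment> \<open>the dyadic scale of the level set\<close>
      define i where "i = (LEAST i. v \<le> 2 ^ i * L0)"
      have i: "v \<le> 2 ^ i * L0" unfolding i_def using vJ by (rule LeastI)
      have iJ: "i \<le> J" unfolding i_def using vJ by (rule Least_le)
      have "i \<noteq> 0" using i False by (cases i) auto
      then obtain j where j: "i = Suc j" by (cases i) auto
      have low: "2 ^ j * L0 < v"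
        using not_less_Least[of j "\<lambda>i. v \<le> 2 ^ i * L0"] j unfolding i_def[symmetric] by auto
      have jJ: "j < J" using iJ j by simp
      have "\<phi> * v \<le> c" unfolding c_def v_def
        using False by (intro iso level_sub ne level_connected[OF t] level_half[OF t]) (simp add: v_def)
      then have "(\<phi> * v)\<^sup>2 \<le> c\<^sup>2" using ph False L0 by (intro power_mono) auto
      also have "\<dots> \<le> resistance (2 ^ Suc j * L0) t" unfolding c_def
        using i j by (intro boundary_le_resistance[OF t]) (simp add: v_def)
      finally have R: "(\<phi> * v)\<^sup>2 \<le> resistance (2 ^ Suc j * L0) t" .
      have pd: "0 < \<phi>\<^sup>2 * (2 ^ j * L0)" using ph L0 by simp
      have "v * (\<phi>\<^sup>2 * (2 ^ j * L0)) \<le> (\<phi> * v)\<^sup>2"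
      proof -
        have "(\<phi>\<^sup>2 * v) * (2 ^ j * L0) \<le> (\<phi>\<^sup>2 * v) * v" using low False L0 by (intro mult_left_mono) auto
        then show ?thesis by (simp add: power2_eq_square mult_ac)
      qed
      then have "v * (\<phi>\<^sup>2 * (2 ^ j * L0)) \<le> resistance (2 ^ Suc j * L0) t" using R by linarith
      then have "v \<le> resistance (2 ^ Suc j * L0) t / (\<phi>\<^sup>2 * (2 ^ j * L0))"
        using pd by (simp only: pos_le_divide_eq)
      also have "\<dots> = 1 / (\<phi>\<^sup>2 * (2 ^ j * L0)) * resistance (2 ^ Suc j * L0) t" by simp
      also have "\<dots> \<le> (\<Sum>j<J. 1 / (\<phi>\<^sup>2 * (2 ^ j * L0)) * resistance (2 ^ Suc j * L0) t)"
        using jJ pos resistance_nonneg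
        by (intro member_le_sum[where f = "\<lambda>j. 1 / (\<phi>\<^sup>2 * (2 ^ j * L0)) * resistance (2 ^ Suc j * L0) t"] mult_nonneg_nonneg) auto
      also have "\<dots> \<le> rhs t" unfolding rhs_def using L0 resistance_nonneg by simp
      finally show ?thesis using lv by simp
    qed
  qed
  have "(\<Sum>v\<in>V. d v * f v) = integral\<^sup>L lborel lhs" using il by (simp add: has_bochner_integral_iff)
  also have "\<dots> \<le> integral\<^sup>L lborel rhs"
    using il ir pt by (intro integral_mono) (auto simp: has_bochner_integral_iff)
  also have "\<dots> = L0 * I L0 + (\<Sum>j<J. 1 / (\<phi>\<^sup>2 * (2 ^ j * L0)) * I (2 ^ Suc j * L0))"
    using ir by (simp add: has_bochner_integral_iff)
  also have "\<dots> \<le> L0 * (2 * L0) + (\<Sum>j<J. 1 / (\<phi>\<^sup>2 * (2 ^ j * L0)) * (2 * (2 ^ Suc j * L0)))"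
    using L0 pos by (intro add_mono sum_mono mult_left_mono I(2)) auto
  also have "(\<Sum>j<J. 1 / (\<phi>\<^sup>2 * (2 ^ j * L0)) * (2 * (2 ^ Suc j * L0))) = (\<Sum>j<J. 4 / \<phi>\<^sup>2)"
    using L0 ph by (intro sum.cong) (auto simp: field_simps)
  finally show ?thesis by (simp add: power2_eq_square mult_ac)
qed

end

context connected_graph begin

lemma kill_off: "v \<notin> B \<Longrightarrow> kill B f v = 0" by (simp add: kill_def)

lemma ip_kill:
  assumes "\<And>v. v \<notin> B \<Longrightarrow> f v = 0" "\<And>v. v \<notin> B \<Longrightarrow> g v = 0"
  shows "ip (kill B f) g = ip f (kill B g)"
proof -
  have "ip (kill B f) g = ip (step f) g" unfolding ip_def
    using assms by (intro sum.cong) (auto simp: kill_def)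
  also have "\<dots> = ip f (step g)" by (rule step_self_adjoint)
  also have "\<dots> = ip f (kill B g)" unfolding ip_def
    using assms by (intro sum.cong) (auto simp: kill_def)
  finally show ?thesis .
qed

lemma kill_pow_off: "(\<And>v. v \<notin> B \<Longrightarrow> f v = 0) \<Longrightarrow> v \<notin> B \<Longrightarrow> (kill B ^^ j) f v = 0"
  by (cases j) (auto simp: kill_off)

lemma ip_kill_pow:
  assumes "\<And>v. v \<notin> B \<Longrightarrow> f v = 0" "\<And>v. v \<notin> B \<Longrightarrow> g v = 0"
  shows "ip ((kill B ^^ j) f) g = ip f ((kill B ^^ j) g)"
  using assms(2)
proof (induction j arbitrary: g)
  case (Suc j)
  have "ip ((kill B ^^ Suc j) f) g = ip ((kill B ^^ j) f) (kill B g)"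
    using ip_kill[of B "(kill B ^^ j) f" g] kill_pow_off[of B f] assms(1) Suc.prems by simp
  also have "\<dots> = ip f ((kill B ^^ j) (kill B g))" by (rule Suc.IH) (simp add: kill_off)
  finally show ?case by (simp add: funpow_swap1)
qed simp

text \<open>
  The expected time before leaving \<open>B\<close> is \<open>\<Sum>v. d v * f v\<close> for the Green function \<open>f\<close> of the walk killed
  outside \<open>B\<close>. Stopping the Green function after \<open>N\<close> steps avoids limits and keeps it subharmonic away
  from its pole.
\<close>

lemma hitting_from_isoperimetry:
  assumes L0: "0 < L0" and ph: "0 < \<phi>" and J: "vol E V \<le> 2 ^ J * L0"
    and iso: "\<And>S. S \<subseteq> V \<Longrightarrow> S \<noteq> {} \<Longrightarrow> internally_connected E S \<Longrightarrow> 2 * card S \<le> card V \<Longrightarrow>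
        L0 < vol E S \<Longrightarrow> \<phi> * vol E S \<le> real (boundary E S)"
  shows "hitting_bound (2 * L0\<^sup>2 + 4 * real J / \<phi>\<^sup>2)"
  unfolding hitting_bound_def
proof (intro allI impI ballI)
  fix B x N assume B: "B \<subseteq> V \<and> 2 * card B \<le> card V" and x: "x \<in> V"
  show "(\<Sum>j<N. surv B j x) \<le> 2 * L0\<^sup>2 + 4 * real J / \<phi>\<^sup>2"
  proof (cases "x \<in> B")
    case False
    then have "(\<Sum>j<N. surv B j x) = 0" by (simp add: surv_off)
    moreover have "0 \<le> 2 * L0\<^sup>2 + 4 * real J / \<phi>\<^sup>2" by simp
    ultimately show ?thesis by linarith
  next
    case True
    define u where "u j = (kill B ^^ j) (\<lambda>v. of_bool (v = x) / d x)" for j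
    define f where "f v = (\<Sum>j<N. u j v)" for v
    have uS: "u (Suc j) v = (if v \<in> B then step (u j) v else 0)" for j v by (simp add: u_def kill_def)
    have u0: "u 0 v = of_bool (v = x) / d x" for v by (simp add: u_def)
    have uoff: "u j v = 0" if "v \<notin> B" for j v
      unfolding u_def using True that by (intro kill_pow_off) auto
    have unn: "0 \<le> u j v" for j v
      by (induction j arbitrary: v) (auto simp: u0 uS intro: step_nonneg)
    have fB: "f v = 0" if "v \<notin> B" for v unfolding f_def by (simp add: uoff that)
    have "pole_function V E f x"
    proof
      show "0 \<le> f v" for v unfolding f_def by (intro sum_nonneg unn)
      show "x \<in> V" by fact
      show "d v * (f v - step f v) \<le> of_bool (v = x)" if "v \<in> V" "0 < f v" for v
      proof -
        have vB: "v \<in> B" using fB[of v] that by auto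
        have "step f v = (\<Sum>j<N. step (u j) v)" using step_sum[of "\<lambda>j v. u j v" "{..<N}" v] by (simp add: f_def[abs_def])
        also have "\<dots> = (\<Sum>j<N. u (Suc j) v)" using vB by (simp add: uS)
        finally have "f v - step f v = (\<Sum>j<N. u j v - u (Suc j) v)" by (simp add: f_def sum_subtractf)
        also have "\<dots> = u 0 v - u N v" by (rule sum_lessThan_telescope')
        also have "\<dots> \<le> of_bool (v = x) / d x" using unn[of N v] u0[of v] by simp
        finally have "d v * (f v - step f v) \<le> d v * (of_bool (v = x) / d x)" by (intro mult_left_mono) auto
        also have "\<dots> = of_bool (v = x)" using d_pos[OF x] by (auto simp: of_bool_def)
        finally show ?thesis .
      qed
      have "card {v\<in>V. 0 < f v} \<le> card B"
      proof (rule card_mono)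
        show "finite B" using B finite_V finite_subset by blast
        show "{v\<in>V. 0 < f v} \<subseteq> B" using fB by force
      qed
      then show "2 * card {v\<in>V. 0 < f v} \<le> card V" using B by linarith
    qed
    then interpret pole_function V E f x .
    have "(\<Sum>j<N. surv B j x) = (\<Sum>j<N. ip (u 0) (surv B j))"
    proof (rule sum.cong[OF refl])
      fix j
      have "ip (u 0) (surv B j) = (\<Sum>v\<in>V. if v = x then surv B j x else 0)"
        unfolding ip_def using d_pos[OF x] by (intro sum.cong) (auto simp: u0)
      then show "surv B j x = ip (u 0) (surv B j)" using finite_V x by simp
    qed
    also have "\<dots> = (\<Sum>j<N. ip (u j) (\<lambda>v. of_bool (v \<in> B)))"
      unfolding u_def surv_def using True by (intro sum.cong refl) (subst ip_kill_pow; auto)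
    also have "\<dots> = (\<Sum>v\<in>V. d v * f v)"
    proof -
      have "(\<Sum>j<N. ip (u j) (\<lambda>v. of_bool (v \<in> B))) = (\<Sum>j<N. \<Sum>v\<in>V. d v * u j v)"
        unfolding ip_def using uoff by (intro sum.cong) (auto simp: of_bool_def)
      then show ?thesis unfolding f_def sum_distrib_left by (subst sum.swap) simp
    qed
    also have "\<dots> \<le> 2 * L0\<^sup>2 + 4 * real J / \<phi>\<^sup>2" by (rule level_set_bound[OF L0 ph J iso])
    finally show ?thesis .
  qed
qed

lemma vol_V: "vol E V = (\<Sum>x\<in>V. d x)" by (simp add: vol_def)

text \<open>
  A bound valid for every connected graph: with \<open>L0\<close> the total volume there is nothing to expand.
\<close>

lemma hitting_crude: "hitting_bound (2 * (vol E V)\<^sup>2)"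
proof -
  have "0 < vol E V" using vol_pos by (simp add: vol_V)
  then have "hitting_bound (2 * (vol E V)\<^sup>2 + 4 * real 0 / 1\<^sup>2)"
  proof (intro hitting_from_isoperimetry)
    fix S assume S: "S \<subseteq> V" "vol E V < vol E S"
    have "vol E S \<le> vol E V" unfolding vol_def using S finite_V by (intro sum_mono2) auto
    then show "1 * vol E S \<le> real (boundary E S)" using S by simp
  qed auto
  then show ?thesis by simp
qed

end

section \<open>The ring and its division into blocks\<close>

lemma cong_interval_unique:
  fixes a b n :: nat
  assumes "[a = b] (mod n)" "a \<in> {1..n}" "b \<in> {1..n}" shows "a = b"
proof -
  have "int n dvd int a - int b"
    using assms(1) by (simp add: cong_int_iff[symmetric] cong_iff_dvd_diff)
  moreover have "\<bar>int a - int b\<bar> < int n" using assms(2,3) by auto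
  ultimately show ?thesis using zdvd_imp_le[of "int n" "\<bar>int a - int b\<bar>"]
    by (cases "a = b") auto
qed

lemma ring_edge_iff:
  "{u, w} \<in> ring_edges n k \<longleftrightarrow> u \<in> {1..n} \<and> w \<in> {1..n} \<and> u \<noteq> w \<and>
     (\<exists>l\<in>{1..k}. [w = u + l] (mod n) \<or> [u = w + l] (mod n))"
proof -
  have "{u, w} \<in> ring_edges n k \<longleftrightarrow> (\<exists>i j. ((u = i \<and> w = j) \<or> (u = j \<and> w = i)) \<and> i \<in> {1..n} \<and> j \<in> {1..n} \<and> i \<noteq> j \<and> (\<exists>l\<in>{1..k}. [j = i + l] (mod n)))"
    unfolding ring_edges_def by (auto simp: doubleton_eq_iff)
  then show ?thesis by metis
qed

lemma ring_edges_pairs: "ring_edges n k \<subseteq> {e. e \<subseteq> {1..n} \<and> card e = 2}"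
  unfolding ring_edges_def by auto

lemma finite_pairs: "finite {e. e \<subseteq> {1..n::nat} \<and> card e = 2}"
  by (rule finite_subset[of _ "Pow {1..n}"]) auto

lemma finite_nonedges: "finite (ring_nonedges n k)"
  unfolding ring_nonedges_def using finite_pairs by blast

lemma nonedge_pair: "e \<in> ring_nonedges n k \<Longrightarrow> e \<subseteq> {1..n} \<and> card e = 2"
  by (auto simp: ring_nonedges_def)

lemma nonedge_iff:
  "{u, w} \<in> ring_nonedges n k \<longleftrightarrow> u \<in> {1..n} \<and> w \<in> {1..n} \<and> u \<noteq> w \<and> {u, w} \<notin> ring_edges n k"
  unfolding ring_nonedges_def by (auto simp: card_2_iff doubleton_eq_iff)

lemma ring_step: assumes "1 \<le> k" "i \<in> {1..n}" "Suc i \<in> {1..n}" shows "{i, Suc i} \<in> ring_edges n k"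
  unfolding ring_edge_iff using assms by (auto intro!: bexI[of _ 1])

text \<open>
  Each of the \<open>k\<close> distances determines at most one neighbour in either direction.
\<close>

lemma ring_degree_le: "card (neighbours (ring_edges n k) v) \<le> 2 * k"
proof -
  define A where "A l = {w\<in>{1..n}. [w = v + l] (mod n)}" for l
  define B where "B l = {w\<in>{1..n}. [v = w + l] (mod n)}" for l
  have A1: "card (A l) \<le> 1" for l
    by (rule card_le_Suc0_iff_eq[THEN iffD2, unfolded One_nat_def[symmetric]])
       (auto simp: A_def intro!: cong_interval_unique intro: cong_trans cong_sym)
  have B1: "card (B l) \<le> 1" for l
  proof -
    have "w = w'" if "w \<in> B l" "w' \<in> B l" for w w'
    proof (rule cong_interval_unique)
      have "[w + l = w' + l] (mod n)" using that by (auto simp: B_def intro: cong_trans cong_sym)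
      then show "[w = w'] (mod n)" by (simp add: cong_add_rcancel_nat)
    qed (use that in \<open>auto simp: B_def\<close>)
    then show ?thesis by (simp add: card_le_Suc0_iff_eq B_def)
  qed
  have "neighbours (ring_edges n k) v \<subseteq> (\<Union>l\<in>{1..k}. A l \<union> B l)"
  proof
    fix w assume "w \<in> neighbours (ring_edges n k) v"
    then have "{v, w} \<in> ring_edges n k" by (simp add: neighbours_def)
    then show "w \<in> (\<Union>l\<in>{1..k}. A l \<union> B l)" unfolding ring_edge_iff A_def B_def by blast
  qed
  then have "card (neighbours (ring_edges n k) v) \<le> card (\<Union>l\<in>{1..k}. A l \<union> B l)"
    by (intro card_mono) (auto simp: A_def B_def)
  also have "\<dots> \<le> (\<Sum>l\<in>{1..k}. card (A l \<union> B l))" by (intro card_UN_le) auto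
  also have "\<dots> \<le> (\<Sum>l\<in>{1..k}. 2)"
  proof (rule sum_mono)
    fix l show "card (A l \<union> B l) \<le> 2" using card_Un_le[of "A l" "B l"] A1[of l] B1[of l] by linarith
  qed
  finally show ?thesis by simp
qed

definition small_world :: "nat \<Rightarrow> nat \<Rightarrow> (nat set \<Rightarrow> bool) \<Rightarrow> nat set set" where
  "small_world n k X = ring_edges n k \<union> {e \<in> ring_nonedges n k. X e}"

lemma small_world_connected:
  assumes "1 \<le> k" "2 \<le> n" shows "connected_graph {1..n} (small_world n k X)"
proof
  show "finite {1..n}" by simp
  show "e \<subseteq> {1..n} \<and> card e = 2" if "e \<in> small_world n k X" for e
    using that ring_edges_pairs nonedge_pair unfolding small_world_def by blast
  show "2 \<le> card {1..n}" using assms by simp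
  fix A :: "nat set" assume A: "A \<subseteq> {1..n}" "A \<noteq> {}" "A \<noteq> {1..n}"
  have "\<exists>i. i \<in> {1..n} \<and> Suc i \<in> {1..n} \<and> (i \<in> A \<longleftrightarrow> Suc i \<notin> A)"
  proof (rule ccontr)
    assume "\<not> ?thesis"
    then have st: "i \<in> A \<longleftrightarrow> Suc i \<in> A" if "i \<in> {1..n}" "Suc i \<in> {1..n}" for i using that by blast
    have "Suc i \<in> {1..n} \<longrightarrow> (Suc i \<in> A \<longleftrightarrow> Suc 0 \<in> A)" for i
    proof (induction i)
      case (Suc i)
      then show ?case using st[of "Suc i"] by auto
    qed simp
    then have all: "v \<in> A \<longleftrightarrow> Suc 0 \<in> A" if "v \<in> {1..n}" for v
      using that by (metis Suc_le_D Suc_pred' atLeastAtMost_iff less_eq_Suc_le One_nat_def)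
    show False using A all by blast
  qed
  then obtain i where i: "i \<in> {1..n}" "Suc i \<in> {1..n}" "i \<in> A \<longleftrightarrow> Suc i \<notin> A" by blast
  then have e: "{i, Suc i} \<in> small_world n k X" "{Suc i, i} \<in> small_world n k X"
    using ring_step[OF assms(1) i(1,2)] by (auto simp: small_world_def insert_commute)
  show "\<exists>u\<in>A. \<exists>w\<in>{1..n} - A. {u, w} \<in> small_world n k X"
  proof (cases "i \<in> A")
    case True
    then show ?thesis using i e by (intro bexI[of _ i] bexI[of _ "Suc i"]) auto
  next
    case False
    then show ?thesis using i e by (intro bexI[of _ i] bexI[of _ "Suc i"]) auto
  qed
qed

text \<open>
  The last block absorbs the remainder, so blocks have between \<open>b\<close> and \<open>2 b - 1\<close> elements.
\<close>

definition block :: "nat \<Rightarrow> nat \<Rightarrow> nat \<Rightarrow> nat" where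
  "block n b v = min ((v - 1) div b) (n div b - 1)"

definition cyclic_nb :: "nat \<Rightarrow> nat \<Rightarrow> nat set" where
  "cyclic_nb N i = {(i + 1) mod N, (i + N - 1) mod N}"

definition cells :: "nat \<Rightarrow> nat \<Rightarrow> nat set \<Rightarrow> nat set" where
  "cells n b S = {v\<in>{1..n}. block n b v \<in> S}"

lemma block_lt: assumes "1 \<le> b" "b \<le> n" shows "block n b v < n div b"
proof -
  have "0 < n div b" using assms by (simp add: div_greater_zero_iff)
  then show ?thesis by (simp add: block_def)
qed

lemma block_Suc_or_same:
  assumes "1 \<le> b" "b \<le> n" "u \<in> {1..n}" "l \<le> b" "u + l \<le> n"
  shows "block n b (u + l) = block n b u \<or> block n b (u + l) = block n b u + 1"
proof -
  have "(u - 1) div b \<le> (u + l - 1) div b" by (intro div_le_mono) auto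
  moreover have "(u + l - 1) div b \<le> (u - 1 + b) div b" using assms by (intro div_le_mono) auto
  moreover have "(u - 1 + b) div b = (u - 1) div b + 1" by (rule div_add_self2) (use assms in simp)
  ultimately show ?thesis by (auto simp: block_def min_def)
qed

lemma block_wrap:
  assumes "1 \<le> b" "b \<le> n" "u \<in> {1..n}" "l \<le> b" "n < u + l"
  shows "block n b u = n div b - 1"
proof -
  have "n - b \<le> u - 1" using assms by auto
  then have "(n - b) div b \<le> (u - 1) div b" by (rule div_le_mono)
  moreover have "(n - b) div b = n div b - 1" using assms by (simp add: le_div_geq)
  ultimately show ?thesis by (simp add: block_def)
qed

lemma directed_ring_blocks:
  assumes b: "1 \<le> b" "b \<le> n" and u: "u \<in> {1..n}" and w: "w \<in> {1..n}" and l: "l \<in> {1..b}" and c: "[w = u + l] (mod n)"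
  shows "block n b w = block n b u \<or> block n b w = (block n b u + 1) mod (n div b)"
proof (cases "u + l \<le> n")
  case True
  then have "w = u + l" using c w l by (intro cong_interval_unique[OF c]) auto
  moreover have "block n b w < n div b" by (rule block_lt[OF b])
  ultimately show ?thesis using block_Suc_or_same[OF b u _ True] l by auto
next
  case False
  have "[u + l - n = u + l] (mod n)" using False by (simp add: cong_def le_mod_geq)
  then have "[w = u + l - n] (mod n)" using c by (metis cong_sym cong_trans)
  then have "w = u + l - n" using False u w l b by (intro cong_interval_unique) auto
  then have "w - 1 < b" using u l b by auto
  then have "block n b w = 0" by (simp add: block_def)
  moreover have "block n b u = n div b - 1" using False u l by (intro block_wrap[OF b u, of l]) auto
  moreover have "0 < n div b" using b by (simp add: div_greater_zero_iff)
  ultimately show ?thesis by simp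
qed

text \<open>
  Blocks are at least as long as the ring edges, which therefore join equal or cyclically adjacent
  blocks.
\<close>

lemma ring_blocks:
  assumes b: "1 \<le> b" "b \<le> n" "k \<le> b" and e: "{u, w} \<in> ring_edges n k"
  shows "block n b w = block n b u \<or> block n b w \<in> cyclic_nb (n div b) (block n b u)"
proof -
  define N where "N = n div b"
  have N: "0 < N" using b by (simp add: N_def div_greater_zero_iff)
  have lt: "block n b u < N" "block n b w < N" using block_lt[OF b(1,2)] by (auto simp: N_def)
  obtain l where l: "l \<in> {1..b}" "[w = u + l] (mod n) \<or> [u = w + l] (mod n)" and uw: "u \<in> {1..n}" "w \<in> {1..n}"
    using e b(3) unfolding ring_edge_iff by force
  consider "block n b w = block n b u" | "block n b w = (block n b u + 1) mod N" | "block n b u = (block n b w + 1) mod N"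
    using l directed_ring_blocks[OF b(1,2)] uw unfolding N_def by metis
  then show ?thesis
  proof cases
    case 3
    have "block n b w = (block n b u + N - 1) mod N"
    proof (cases "block n b w + 1 = N")
      case True
      then show ?thesis using 3 N by auto
    next
      case False
      then have "block n b u = block n b w + 1" using 3 lt by simp
      then show ?thesis using lt by simp
    qed
    then show ?thesis by (simp add: cyclic_nb_def N_def)
  qed (auto simp: cyclic_nb_def N_def)
qed

lemma cells_single_ge:
  assumes "1 \<le> b" "i < n div b" shows "b \<le> card (cells n b {i})"
proof -
  have "{i * b + 1..i * b + b} \<subseteq> cells n b {i}"
  proof
    fix v assume v: "v \<in> {i * b + 1..i * b + b}"
    have "i * b + b \<le> (n div b) * b" using assms(2) by (metis Suc_leI add.commute mult_Suc mult_le_mono1)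
    also have "\<dots> \<le> n" by simp
    finally have "v \<in> {1..n}" using v by auto
    moreover have "(v - 1) div b = i" using v by (intro div_nat_eqI) (auto simp: mult.commute)
    ultimately show "v \<in> cells n b {i}" using assms by (auto simp: cells_def block_def)
  qed
  then have "card {i * b + 1..i * b + b} \<le> card (cells n b {i})"
    by (intro card_mono) (auto simp: cells_def)
  then show ?thesis by simp
qed

lemma cells_single_le:
  assumes "1 \<le> b" shows "card (cells n b {i}) \<le> 2 * b"
proof -
  have "cells n b {i} \<subseteq> {i * b + 1..i * b + 2 * b}"
  proof
    fix v assume v: "v \<in> cells n b {i}"
    then have v1: "1 \<le> v" "v \<le> n" and bi: "block n b v = i" by (auto simp: cells_def)
    define q where "q = (v - 1) div b"
    have "q \<le> n div b" unfolding q_def using v1 by (intro div_le_mono) auto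
    then have "i \<le> q" "q \<le> i + 1" using bi unfolding block_def q_def[symmetric] by (auto simp: min_def split: if_splits)
    moreover have "q * b \<le> v - 1" unfolding q_def by simp
    moreover have "v - 1 < (q + 1) * b"
      using dividend_less_div_times[of b "v - 1"] assms by (simp add: q_def)
    ultimately have "i * b \<le> v - 1" "v - 1 < (i + 2) * b"
      using mult_le_mono1[of i q b] mult_le_mono1[of "q + 1" "i + 2" b] by linarith+
    then show "v \<in> {i * b + 1..i * b + 2 * b}" using v1 by (auto simp: algebra_simps)
  qed
  then have "card (cells n b {i}) \<le> card {i * b + 1..i * b + 2 * b}" by (intro card_mono) auto
  then show ?thesis by simp
qed

lemma card_cells: "finite S \<Longrightarrow> card (cells n b S) = (\<Sum>i\<in>S. card (cells n b {i}))"
proof -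
  assume "finite S"
  have "cells n b S = (\<Union>i\<in>S. cells n b {i})" by (auto simp: cells_def)
  moreover have "card (\<Union>i\<in>S. cells n b {i}) = (\<Sum>i\<in>S. card (cells n b {i}))"
  proof (rule card_UN_disjoint[OF \<open>finite S\<close>])
    show "\<forall>i\<in>S. finite (cells n b {i})" by (simp add: cells_def)
    show "\<forall>i\<in>S. \<forall>j\<in>S. i \<noteq> j \<longrightarrow> cells n b {i} \<inter> cells n b {j} = {}" by (auto simp: cells_def)
  qed
  ultimately show ?thesis by simp
qed

lemma card_cells_le: "1 \<le> b \<Longrightarrow> finite S \<Longrightarrow> card (cells n b S) \<le> 2 * b * card S"
  unfolding card_cells using sum_bounded_above[of S "\<lambda>i. card (cells n b {i})" "2 * b"] cells_single_le[of b n]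
  by (simp add: mult.commute)

lemma card_cells_ge: "1 \<le> b \<Longrightarrow> S \<subseteq> {..<n div b} \<Longrightarrow> b * card S \<le> card (cells n b S)"
proof -
  assume a: "1 \<le> b" "S \<subseteq> {..<n div b}"
  then have "finite S" using finite_subset by blast
  have "(\<Sum>i\<in>S. b) \<le> (\<Sum>i\<in>S. card (cells n b {i}))" using a by (intro sum_mono cells_single_ge) auto
  then show ?thesis unfolding card_cells[OF \<open>finite S\<close>] by (simp add: mult.commute)
qed

section \<open>Exponential moments of independent edges\<close>

definition independent_edges :: "'e set \<Rightarrow> real \<Rightarrow> ('e \<Rightarrow> bool) pmf" where
  "independent_edges A p = Pi_pmf A False (\<lambda>_. bernoulli_pmf p)"

lemma finite_set_independent_edges: "finite A \<Longrightarrow> finite (set_pmf (independent_edges A p))"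
  unfolding independent_edges_def by (subst set_Pi_pmf) (auto intro!: finite_PiE_dflt)

lemma prob_le_expectation:
  fixes M :: "'a pmf"
  assumes "finite (set_pmf M)" "\<And>x. x \<in> A \<Longrightarrow> 1 \<le> f x" "\<And>x. 0 \<le> f x"
  shows "measure_pmf.prob M A \<le> measure_pmf.expectation M f"
proof -
  have "measure_pmf.expectation M (indicator A) \<le> measure_pmf.expectation M f"
    using assms by (intro integral_mono integrable_measure_pmf_finite) (auto simp: indicator_def)
  then show ?thesis by simp
qed

text \<open>
  Requiring the edges of \<open>T\<close> to be open costs the factor \<open>p ^ card T\<close> and leaves the edges of \<open>Z\<close>
  untouched.
\<close>

lemma exponential_moment:
  assumes A: "finite A" and T: "T \<subseteq> A" and Z: "Z \<subseteq> A" and TZ: "T \<inter> Z = {}" and l: "0 \<le> l" and p: "0 \<le> p" "p \<le> 1"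
  shows "measure_pmf.expectation (independent_edges A p)
      (\<lambda>X. of_bool (\<forall>e\<in>T. X e) * l ^ card {e\<in>Z. X e}) = p ^ card T * (1 + p * (l - 1)) ^ card Z"
proof -
  have split: "(\<Prod>e\<in>A. if e \<in> T then f e else if e \<in> Z then g e else 1) = (\<Prod>e\<in>T. f e) * (\<Prod>e\<in>Z. g e)"
    for f g :: "'a \<Rightarrow> real"
  proof -
    have "(\<Prod>e\<in>A. if e \<in> T then f e else if e \<in> Z then g e else 1)
        = (\<Prod>e\<in>A. (if e \<in> T then f e else 1) * (if e \<in> Z then g e else 1))"
      using TZ by (intro prod.cong) auto
    also have "\<dots> = (\<Prod>e\<in>A \<inter> T. f e) * (\<Prod>e\<in>A \<inter> Z. g e)"
      unfolding prod.distrib using A by (simp add: prod.inter_restrict)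
    finally show ?thesis using T Z by (simp add: Int_absorb1)
  qed
  have fT: "finite T" and fZ: "finite Z" using A T Z finite_subset by blast+
  define h where "h e x = (if e \<in> T then of_bool x else if e \<in> Z then (if x then l else 1) else (1::real))" for e and x :: bool
  have pT: "(\<Prod>e\<in>T. of_bool (X e)) = (of_bool (\<forall>e\<in>T. X e) :: real)" for X :: "'a \<Rightarrow> bool"
    using fT by (induction T rule: finite_induct) auto
  have pZ: "(\<Prod>e\<in>Z. if X e then l else 1) = l ^ card {e\<in>Z. X e}" for X :: "'a \<Rightarrow> bool"
    using fZ by (simp add: prod.inter_filter[symmetric])
  have "(\<lambda>X. of_bool (\<forall>e\<in>T. X e) * l ^ card {e\<in>Z. X e}) = (\<lambda>X. \<Prod>e\<in>A. h e (X e))"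
    unfolding h_def split pT pZ ..
  then have "measure_pmf.expectation (independent_edges A p) (\<lambda>X. of_bool (\<forall>e\<in>T. X e) * l ^ card {e\<in>Z. X e})
      = (\<Prod>e\<in>A. measure_pmf.expectation (bernoulli_pmf p) (h e))"
    unfolding independent_edges_def using l
    by (simp only:) (intro expectation_prod_Pi_pmf A integrable_measure_pmf_finite, auto simp: h_def)
  also have "\<dots> = (\<Prod>e\<in>A. if e \<in> T then p else if e \<in> Z then 1 + p * (l - 1) else 1)"
  proof (rule prod.cong[OF refl])
    fix e
    have "measure_pmf.expectation (bernoulli_pmf p) (h e) = h e True * p + h e False * (1 - p)"
      using p by simp
    also have "\<dots> = (if e \<in> T then p else if e \<in> Z then 1 + p * (l - 1) else 1)"
      by (auto simp: h_def algebra_simps)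
    finally show "measure_pmf.expectation (bernoulli_pmf p) (h e) = (if e \<in> T then p else if e \<in> Z then 1 + p * (l - 1) else 1)" .
  qed
  finally show ?thesis unfolding split by simp
qed

lemma exponential_moment_le:
  assumes A: "finite A" and T: "T \<subseteq> A" and Z: "Z \<subseteq> A" and TZ: "T \<inter> Z = {}" and l: "0 \<le> l" and p: "0 \<le> p" "p \<le> 1"
  shows "measure_pmf.expectation (independent_edges A p)
      (\<lambda>X. of_bool (\<forall>e\<in>T. X e) * l ^ card {e\<in>Z. X e}) \<le> p ^ card T * exp (p * (l - 1) * real (card Z))"
proof -
  have "0 \<le> 1 + p * (l - 1)"
  proof -
    have "0 \<le> (1 - p) + p * l" using l p by (intro add_nonneg_nonneg mult_nonneg_nonneg) auto
    then show ?thesis by (simp add: algebra_simps)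
  qed
  then have "(1 + p * (l - 1)) ^ card Z \<le> exp (p * (l - 1)) ^ card Z"
    by (intro power_mono exp_ge_add_one_self)
  also have "\<dots> = exp (p * (l - 1) * real (card Z))" by (simp add: exp_of_nat_mult[symmetric] mult.commute)
  finally show ?thesis unfolding exponential_moment[OF assms] using p by (intro mult_left_mono) auto
qed

lemma few_open:
  assumes A: "finite A" and T: "T \<subseteq> A" and Z: "Z \<subseteq> A" and TZ: "T \<inter> Z = {}" and p: "0 \<le> p" "p \<le> 1"
  shows "measure_pmf.prob (independent_edges A p) {X. (\<forall>e\<in>T. X e) \<and> card {e\<in>Z. X e} < a}
     \<le> p ^ card T * exp (real a - p * real (card Z) / 2)"
proof -
  have "measure_pmf.prob (independent_edges A p) {X. (\<forall>e\<in>T. X e) \<and> card {e\<in>Z. X e} < a}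
      \<le> measure_pmf.expectation (independent_edges A p) (\<lambda>X. exp (real a) * (of_bool (\<forall>e\<in>T. X e) * exp (-1) ^ card {e\<in>Z. X e}))"
    by (intro prob_le_expectation finite_set_independent_edges A)
       (auto simp: exp_of_nat_mult[symmetric] mult_exp_exp)
  also have "\<dots> = exp (real a) * measure_pmf.expectation (independent_edges A p) (\<lambda>X. of_bool (\<forall>e\<in>T. X e) * exp (-1) ^ card {e\<in>Z. X e})"
    by simp
  also have "\<dots> \<le> exp (real a) * (p ^ card T * exp (p * (exp (-1) - 1) * real (card Z)))"
    by (intro mult_left_mono exponential_moment_le assms) auto
  also have "\<dots> \<le> exp (real a) * (p ^ card T * exp (- (p * real (card Z) / 2)))"
  proof -
    have "exp (-1::real) \<le> 1/2" using exp_ge_add_one_self[of "1::real"] by (simp add: exp_minus field_simps)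
    then have "(p * real (card Z)) * (exp (-1) - 1) \<le> (p * real (card Z)) * (-1/2)" using p by (intro mult_left_mono) auto
    then have "p * (exp (-1) - 1) * real (card Z) \<le> - (p * real (card Z) / 2)" by (simp add: mult_ac)
    then show ?thesis using p by (intro mult_left_mono) auto
  qed
  also have "\<dots> = p ^ card T * exp (real a - p * real (card Z) / 2)"
    unfolding mult.left_commute[of "exp (real a)"] mult_exp_exp by simp
  finally show ?thesis .
qed

lemma many_open:
  assumes A: "finite A" and T: "T \<subseteq> A" and Z: "Z \<subseteq> A" and p: "0 \<le> p" "p \<le> 1" and a: "a' \<le> real a"
  shows "measure_pmf.prob (independent_edges A p) {X. (\<forall>e\<in>T. X e) \<and> a \<le> card {e\<in>Z. X e}}
     \<le> p ^ card T * exp (real (card T) - a' + 2 * p * real (card Z))"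
proof -
  have fT: "finite T" and fZ: "finite Z" using A T Z finite_subset by blast+
  let ?f = "\<lambda>X. exp (real (card T) - a') * (of_bool (\<forall>e\<in>T. X e) * exp 1 ^ card {e\<in>Z - T. X e})"
  have "measure_pmf.prob (independent_edges A p) {X. (\<forall>e\<in>T. X e) \<and> a \<le> card {e\<in>Z. X e}}
      \<le> measure_pmf.expectation (independent_edges A p) ?f"
  proof (intro prob_le_expectation finite_set_independent_edges A)
    fix X assume X: "X \<in> {X. (\<forall>e\<in>T. X e) \<and> a \<le> card {e\<in>Z. X e}}"
    have "card {e\<in>Z. X e} \<le> card ({e\<in>Z - T. X e} \<union> T)" using fT fZ by (intro card_mono) auto
    also have "\<dots> \<le> card {e\<in>Z - T. X e} + card T" by (rule card_Un_le)
    finally have "a \<le> card {e\<in>Z - T. X e} + card T" using X by auto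
    then have "a' \<le> real (card {e\<in>Z - T. X e}) + real (card T)" using a by linarith
    then have "0 \<le> real (card T) - a' + real (card {e\<in>Z - T. X e})" by linarith
    then have "1 \<le> exp (real (card T) - a' + real (card {e\<in>Z - T. X e}))" by simp
    then show "1 \<le> ?f X" using X by (simp add: exp_of_nat_mult[symmetric] mult_exp_exp)
  qed auto
  also have "\<dots> = exp (real (card T) - a') * measure_pmf.expectation (independent_edges A p) (\<lambda>X. of_bool (\<forall>e\<in>T. X e) * exp 1 ^ card {e\<in>Z - T. X e})"
    by simp
  also have "\<dots> \<le> exp (real (card T) - a') * (p ^ card T * exp (p * (exp 1 - 1) * real (card (Z - T))))"
    using assms by (intro mult_left_mono exponential_moment_le) auto
  also have "\<dots> \<le> exp (real (card T) - a') * (p ^ card T * exp (2 * p * real (card Z)))"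
  proof -
    have "card (Z - T) \<le> card Z" using fZ by (intro card_mono) auto
    then have "(p * (exp 1 - 1)) * real (card (Z - T)) \<le> (p * 2) * real (card Z)"
      using p exp_le by (intro mult_mono mult_left_mono) auto
    then show ?thesis using p by (intro mult_left_mono) (auto simp: mult_ac)
  qed
  also have "\<dots> = p ^ card T * exp (real (card T) - a' + 2 * p * real (card Z))"
    by (simp add: exp_add)
  finally show ?thesis .
qed

section \<open>Counting connected families of blocks\<close>

text \<open>
  A breadth-first exploration: the blocks found so far in order of discovery, the number of blocks
  already processed, and the shortcuts by which blocks were found.
\<close>

type_synonym exploration = "nat list \<times> nat \<times> nat set set"

text \<open>
  The parameter \<open>b\<close> is the length of the blocks; it is chosen later as a large constant, so that the
  number of shortcuts leaving a block is large on average even if \<open>c\<close> is small.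
\<close>

locale blocks =
  fixes n k b :: nat and p :: real
  assumes k1: "1 \<le> k" and kb: "k \<le> b" and bn: "b \<le> n" and p01: "0 \<le> p" "p \<le> 1"
begin

abbreviation N :: nat where "N \<equiv> n div b"
abbreviation NE :: "nat set set" where "NE \<equiv> ring_nonedges n k"
abbreviation bl :: "nat \<Rightarrow> nat" where "bl \<equiv> block n b"
abbreviation cell :: "nat set \<Rightarrow> nat set" where "cell \<equiv> cells n b"

lemma b1: "1 \<le> b" using k1 kb by simp

definition link :: "(nat set \<Rightarrow> bool) \<Rightarrow> nat \<Rightarrow> nat \<Rightarrow> bool" where
  "link X i j \<longleftrightarrow> j \<in> cyclic_nb N i \<or> (\<exists>u w. {u, w} \<in> NE \<and> X {u, w} \<and> bl u = i \<and> bl w = j)"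

definition link_connected :: "(nat set \<Rightarrow> bool) \<Rightarrow> nat set \<Rightarrow> bool" where
  "link_connected X S \<longleftrightarrow> (\<forall>A. A \<subseteq> S \<and> A \<noteq> {} \<and> A \<noteq> S \<longrightarrow> (\<exists>i\<in>A. \<exists>j\<in>S - A. link X i j))"

text \<open>
  Either the current block is finished, or a new block is discovered from it, through the ring or
  through a shortcut. The fixed order of processing keeps the number of explorations of \<open>s\<close> blocks
  exponential in \<open>s\<close>; arbitrary parent relations would give a factor \<open>s!\<close>.
\<close>

fun nexts :: "exploration \<Rightarrow> exploration set" where
  "nexts (L, q, T) = insert (L, Suc q, T)
     (if q < length L then
        (\<lambda>j. (L @ [j], q, T)) ` {j \<in> cyclic_nb N (L ! q). j < N \<and> j \<notin> set L} \<union>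
        (\<lambda>(u, w). (L @ [bl w], q, insert {u, w} T)) ` {(u, w). {u, w} \<in> NE \<and> bl u = L ! q \<and> bl w \<notin> set L}
      else {})"

primrec reach :: "nat \<Rightarrow> nat \<Rightarrow> exploration set" where
  "reach i 0 = {([i], 0, {})}"
| "reach i (Suc m) = (\<Union>\<sigma>\<in>reach i m. nexts \<sigma>)"

fun consistent :: "exploration \<Rightarrow> bool" where
  "consistent (L, q, T) \<longleftrightarrow> finite T \<and> T \<subseteq> NE \<and> \<Union>T \<subseteq> cell (set L) \<and> distinct L \<and> set L \<subseteq> {..<N} \<and> Suc (card T) \<le> length L"

lemma pairs_subset: "{(u, w). {u, w} \<in> NE \<and> bl u = i \<and> bl w \<notin> S} \<subseteq> cell {i} \<times> {1..n}"
  by (auto simp: nonedge_iff cells_def)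

lemma finite_cell [simp]: "finite (cell S)" by (simp add: cells_def)

lemma finite_pairs': "finite {(u, w). {u, w} \<in> NE \<and> bl u = i \<and> bl w \<notin> S}"
  by (rule finite_subset[OF pairs_subset]) simp

lemma finite_cyclic: "finite (cyclic_nb m i)" by (simp add: cyclic_nb_def)

lemma finite_nexts: "finite (nexts \<sigma>)"
proof -
  obtain L q T where \<sigma>: "\<sigma> = (L, q, T)" by (cases \<sigma>)
  show ?thesis unfolding \<sigma> nexts.simps
    using finite_pairs' finite_cyclic by (auto intro!: finite_imageI)
qed

lemma finite_reach: "finite (reach i m)"
  by (induction m) (auto intro: finite_nexts)

lemma consistent_nexts: assumes "consistent \<sigma>" "\<tau> \<in> nexts \<sigma>" shows "consistent \<tau>"
proof -
  obtain L q T where \<sigma>: "\<sigma> = (L, q, T)" by (cases \<sigma>)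
  have inv: "finite T" "T \<subseteq> NE" "\<Union>T \<subseteq> cell (set L)" "distinct L" "set L \<subseteq> {..<N}" "Suc (card T) \<le> length L"
    using assms(1) by (auto simp: \<sigma>)
  consider "\<tau> = (L, Suc q, T)"
    | j where "j < N" "j \<notin> set L" "\<tau> = (L @ [j], q, T)"
    | u w where "q < length L" "{u, w} \<in> NE" "bl u = L ! q" "bl w \<notin> set L" "\<tau> = (L @ [bl w], q, insert {u, w} T)"
    using assms(2) unfolding \<sigma> nexts.simps by (auto split: if_splits)
  then show ?thesis
  proof cases
    case 1
    then show ?thesis using assms(1) by (simp add: \<sigma>)
  next
    case 2
    have "cell (set L) \<subseteq> cell (set (L @ [j]))" by (auto simp: cells_def)
    then show ?thesis using 2 inv by auto
  next
    case 3
    have "cell (set L) \<subseteq> cell (set (L @ [bl w]))" by (auto simp: cells_def)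
    moreover have "{u, w} \<subseteq> cell (set (L @ [bl w]))"
      using 3 nonedge_iff[of u w n k] by (auto simp: cells_def)
    moreover have "bl w < N" by (rule block_lt[OF b1 bn])
    moreover have "card (insert {u, w} T) \<le> Suc (card T)" by (rule card_insert_le_m1) auto
    ultimately show ?thesis using 3 inv by auto
  qed
qed

lemma consistent_reach: assumes "i < N" shows "\<sigma> \<in> reach i m \<Longrightarrow> consistent \<sigma>"
proof (induction m arbitrary: \<sigma>)
  case (Suc m)
  then obtain \<sigma>' where \<sigma>': "\<sigma>' \<in> reach i m" "\<sigma> \<in> nexts \<sigma>'" by auto
  show ?case by (rule consistent_nexts[OF Suc.IH[OF \<sigma>'(1)] \<sigma>'(2)])
qed (use assms in auto)

text \<open>
  An upper bound for the expected number of ways to leave a block: two ring neighbours, and at most \<open>2 b n\<close> possible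
  shortcuts of probability \<open>p\<close>.
\<close>

definition branching :: real where "branching = 2 + 2 * real b * real n * p"

fun weight :: "real \<Rightarrow> exploration \<Rightarrow> real" where
  "weight y (L, q, T) = p ^ card T * y ^ length L"

lemma weight_nonneg: "0 \<le> y \<Longrightarrow> 0 \<le> weight y \<sigma>"
  using p01 by (cases \<sigma>) auto

text \<open>
  The new shortcut is never among the old ones, since it ends in a new block; so each discovery by a
  shortcut contributes exactly one factor \<open>p\<close>.
\<close>

lemma weight_nexts:
  assumes y: "0 \<le> y" and c: "consistent \<sigma>"
  shows "(\<Sum>\<tau>\<in>nexts \<sigma>. weight y \<tau>) \<le> (1 + branching * y) * weight y \<sigma>"
proof -
  obtain L q T where \<sigma>: "\<sigma> = (L, q, T)" by (cases \<sigma>)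
  have inv: "finite T" "\<Union>T \<subseteq> cell (set L)" using c by (auto simp: \<sigma>)
  define w0 where "w0 = p ^ card T * y ^ length L"
  have w0: "0 \<le> w0" using y p01 by (simp add: w0_def)
  define J where "J = {j \<in> cyclic_nb N (L ! q). j < N \<and> j \<notin> set L}"
  define P where "P = {(u, w). {u, w} \<in> NE \<and> bl u = L ! q \<and> bl w \<notin> set L}"
  define A where "A = (\<lambda>j. (L @ [j], q, T)) ` J"
  define B where "B = (\<lambda>(u, w). (L @ [bl w], q, insert {u, w} T)) ` P"
  have fJ: "finite J" unfolding J_def using finite_cyclic by auto
  have fP: "finite P" unfolding P_def by (rule finite_pairs')
  have imP: "sum (weight y) (f ` P) \<le> (\<Sum>e\<in>P. weight y (f e))" for f
    unfolding o_def[symmetric, of "weight y" f] by (rule sum_image_le[OF fP]) (rule weight_nonneg[OF y])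
  have imJ: "sum (weight y) (f ` J) \<le> (\<Sum>e\<in>J. weight y (f e))" for f
    unfolding o_def[symmetric, of "weight y" f] by (rule sum_image_le[OF fJ]) (rule weight_nonneg[OF y])
  have fAB: "finite A" "finite B" unfolding A_def B_def using fJ fP by auto
  have cJ: "card J \<le> 2"
  proof -
    have "card J \<le> card (cyclic_nb N (L ! q))" unfolding J_def using finite_cyclic by (intro card_mono) auto
    also have "\<dots> \<le> 2" unfolding cyclic_nb_def by (simp add: card_insert_if)
    finally show ?thesis .
  qed
  have cP: "card P \<le> 2 * b * n"
  proof -
    have "card P \<le> card (cell {L ! q} \<times> {1..n})" unfolding P_def by (intro card_mono pairs_subset) auto
    also have "\<dots> = card (cell {L ! q}) * n" by (simp add: card_cartesian_product)
    also have "\<dots> \<le> 2 * b * n" using cells_single_le[OF b1] by simp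
    finally show ?thesis .
  qed
  have "nexts \<sigma> \<subseteq> {(L, Suc q, T)} \<union> (A \<union> B)"
    unfolding \<sigma> A_def B_def J_def P_def by auto
  then have "(\<Sum>\<tau>\<in>nexts \<sigma>. weight y \<tau>) \<le> (\<Sum>\<tau>\<in>{(L, Suc q, T)} \<union> (A \<union> B). weight y \<tau>)"
    using fAB weight_nonneg[OF y] by (intro sum_mono2) auto
  also have "\<dots> \<le> (\<Sum>\<tau>\<in>{(L, Suc q, T)}. weight y \<tau>) + (\<Sum>\<tau>\<in>A \<union> B. weight y \<tau>)"
    using fAB by (intro sum_union_le weight_nonneg[OF y]) auto
  also have "\<dots> \<le> w0 + ((\<Sum>\<tau>\<in>A. weight y \<tau>) + (\<Sum>\<tau>\<in>B. weight y \<tau>))"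
    using sum_union_le[OF fAB, of "weight y"] weight_nonneg[OF y] by (simp add: w0_def)
  also have "(\<Sum>\<tau>\<in>A. weight y \<tau>) \<le> 2 * (y * w0)"
  proof -
    have "(\<Sum>\<tau>\<in>A. weight y \<tau>) \<le> (\<Sum>j\<in>J. y * w0)"
      unfolding A_def by (rule order_trans[OF imJ]) (simp add: w0_def mult_ac)
    also have "\<dots> = real (card J) * (y * w0)" by simp
    also have "\<dots> \<le> 2 * (y * w0)" using cJ y w0 by (intro mult_right_mono) auto
    finally show ?thesis .
  qed
  also have "(\<Sum>\<tau>\<in>B. weight y \<tau>) \<le> (2 * real b * real n) * (p * (y * w0))"
  proof -
    have "(\<Sum>\<tau>\<in>B. weight y \<tau>) \<le> (\<Sum>e\<in>P. weight y (case e of (u, w) \<Rightarrow> (L @ [bl w], q, insert {u, w} T)))"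
      unfolding B_def by (rule imP)
    also have "\<dots> = (\<Sum>e\<in>P. p * (y * w0))"
    proof (rule sum.cong[OF refl])
      fix e assume "e \<in> P"
      then obtain u w where e: "e = (u, w)" "bl w \<notin> set L" by (auto simp: P_def)
      have "{u, w} \<notin> T" using inv(2) e(2) by (auto simp: cells_def)
      then show "weight y (case e of (u, w) \<Rightarrow> (L @ [bl w], q, insert {u, w} T)) = p * (y * w0)"
        using inv(1) by (simp add: e w0_def mult_ac)
    qed
    also have "\<dots> = real (card P) * (p * (y * w0))" by simp
    also have "\<dots> \<le> (2 * real b * real n) * (p * (y * w0))"
    proof (rule mult_right_mono)
      show "real (card P) \<le> 2 * real b * real n" using cP by (metis of_nat_le_iff of_nat_mult of_nat_numeral)
    qed (use y w0 p01 in auto)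
    finally show ?thesis .
  qed
  finally show ?thesis by (simp add: branching_def \<sigma> w0_def[symmetric] algebra_simps)
qed

lemma weight_reach:
  assumes "0 \<le> y" "i < N" shows "(\<Sum>\<tau>\<in>reach i m. weight y \<tau>) \<le> (1 + branching * y) ^ m * y"
proof (induction m)
  case (Suc m)
  have "(\<Sum>\<tau>\<in>reach i (Suc m). weight y \<tau>) \<le> (\<Sum>\<sigma>\<in>reach i m. \<Sum>\<tau>\<in>nexts \<sigma>. weight y \<tau>)"
    unfolding reach.simps by (intro sum_UN_le finite_reach finite_nexts weight_nonneg assms)
  also have "\<dots> \<le> (\<Sum>\<sigma>\<in>reach i m. (1 + branching * y) * weight y \<sigma>)"
    using consistent_reach[OF assms(2)] by (intro sum_mono weight_nexts assms) auto
  also have "\<dots> = (1 + branching * y) * (\<Sum>\<sigma>\<in>reach i m. weight y \<sigma>)" by (simp add: sum_distrib_left)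
  also have "\<dots> \<le> (1 + branching * y) * ((1 + branching * y) ^ m * y)"
    using Suc assms p01 by (intro mult_left_mono) (auto simp: branching_def)
  finally show ?case by simp
qed simp

text \<open>
  Each move either finishes a block or discovers one, so that the number of discovered blocks plus the
  number of finished blocks grows by one. A stop before all of \<open>S\<close> is discovered would leave a part of
  \<open>S\<close> without links to the rest.
\<close>

lemma exploration_exists:
  assumes S: "finite S" "S \<subseteq> {..<N}" "i \<in> S" and conn: "link_connected X S"
  shows "\<exists>L q T. (L, q, T) \<in> reach i (2 * card S - 1) \<and> set L = S \<and> (\<forall>e\<in>T. X e)"
proof -
  have claim: "m < 2 * card S \<Longrightarrow> \<exists>L q T. (L, q, T) \<in> reach i m \<and> set L \<subseteq> S \<and> distinct L \<and> q \<le> length L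
      \<and> length L + q = Suc m \<and> (\<forall>e\<in>T. X e) \<and> (\<forall>r<q. \<forall>j\<in>S - set L. \<not> link X (L ! r) j)" for m
  proof (induction m)
    case 0
    show ?case using S by (intro exI[of _ "[i]"] exI[of _ 0] exI[of _ "{}"]) auto
  next
    case (Suc m)
    then obtain L q T where IH: "(L, q, T) \<in> reach i m" "set L \<subseteq> S" "distinct L" "q \<le> length L"
      "length L + q = Suc m" "\<forall>e\<in>T. X e" "\<forall>r<q. \<forall>j\<in>S - set L. \<not> link X (L ! r) j" by auto
    have lenL: "length L = card (set L)" by (simp add: distinct_card IH(3))
    have q: "q < length L"
    proof (rule ccontr)
      assume "\<not> q < length L"
      then have ql: "q = length L" using IH by simp
      then have "length L < card S" using IH Suc.prems by linarith
      then have "set L \<noteq> S" using lenL by auto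
      moreover have "set L \<noteq> {}" using ql IH(5) by auto
      ultimately obtain a j where "a \<in> set L" "j \<in> S - set L" "link X a j"
        using conn IH(2) unfolding link_connected_def by blast
      moreover from this obtain r where "r < length L" "L ! r = a" by (auto simp: in_set_conv_nth)
      ultimately show False using IH(7) ql by blast
    qed
    show ?case
    proof (cases "\<exists>j\<in>S - set L. link X (L ! q) j")
      case False
      have "(L, Suc q, T) \<in> reach i (Suc m)" using IH(1) by force
      moreover have "\<forall>r<Suc q. \<forall>j\<in>S - set L. \<not> link X (L ! r) j" using False IH(7) less_Suc_eq by auto
      moreover have "Suc q \<le> length L" "length L + Suc q = Suc (Suc m)" using q IH(5) by auto
      ultimately show ?thesis using IH(2,3,6) by blast
    next
      case True
      then obtain j where j: "j \<in> S" "j \<notin> set L" "link X (L ! q) j" by auto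
      have keep: "\<forall>r<q. \<forall>j'\<in>S - set (L @ [j]). \<not> link X ((L @ [j]) ! r) j'"
        using IH(7) q by (auto simp: nth_append)
      from j(3) consider "j \<in> cyclic_nb N (L ! q)" | u w where "{u, w} \<in> NE" "X {u, w}" "bl u = L ! q" "bl w = j"
        unfolding link_def by blast
      then have "\<exists>T'. (L @ [j], q, T') \<in> reach i (Suc m) \<and> (\<forall>e\<in>T'. X e)"
      proof cases
        case 1
        have "(L @ [j], q, T) \<in> nexts (L, q, T)" using 1 j S q by auto
        then show ?thesis using IH(1,6) unfolding reach.simps by blast
      next
        case 2
        have "(L @ [j], q, insert {u, w} T) \<in> nexts (L, q, T)"
        proof -
          have "(u, w) \<in> {(u, w). {u, w} \<in> NE \<and> bl u = L ! q \<and> bl w \<notin> set L}" using 2 j by auto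
          then have "(\<lambda>(u, w). (L @ [bl w], q, insert {u, w} T)) (u, w) \<in>
              (\<lambda>(u, w). (L @ [bl w], q, insert {u, w} T)) ` {(u, w). {u, w} \<in> NE \<and> bl u = L ! q \<and> bl w \<notin> set L}"
            by (rule imageI)
          then show ?thesis using 2 q by simp
        qed
        moreover have "\<forall>e\<in>insert {u, w} T. X e" using IH(6) 2(2) by blast
        ultimately show ?thesis using IH(1) unfolding reach.simps by blast
      qed
      then obtain T' where T': "(L @ [j], q, T') \<in> reach i (Suc m)" "\<forall>e\<in>T'. X e" by blast
      have "set (L @ [j]) \<subseteq> S" "distinct (L @ [j])" "q \<le> length (L @ [j])" "length (L @ [j]) + q = Suc (Suc m)"
        using IH(2-5) j by auto
      then show ?thesis using keep T' by blast
    qed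
  qed
  have "0 < card S" using S card_gt_0_iff by blast
  then obtain L q T where L: "(L, q, T) \<in> reach i (2 * card S - 1)" "set L \<subseteq> S" "distinct L" "q \<le> length L"
      "length L + q = Suc (2 * card S - 1)" "\<forall>e\<in>T. X e" using claim[of "2 * card S - 1"] by auto
  then have "card S \<le> length L" using \<open>0 < card S\<close> by linarith
  then have "card S \<le> card (set L)" using distinct_card[OF L(3)] by simp
  then have "set L = S" by (rule card_seteq[OF S(1) L(2)])
  then show ?thesis using L by blast
qed

abbreviation \<P> :: "(nat set \<Rightarrow> bool) pmf" where "\<P> \<equiv> independent_edges NE p"

lemma branching_ge: "2 \<le> branching" using p01 by (simp add: branching_def)

text \<open>
  A union bound over the explorations with \<open>s\<close> blocks. The weight with \<open>y = 1 / branching\<close> at most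
  doubles in each of the \<open>2 s - 1\<close> moves.
\<close>

lemma union_bound_explorations:
  assumes s: "1 \<le> s" and Q: "0 \<le> Q"
    and bad: "\<And>L q T. consistent (L, q, T) \<Longrightarrow> length L = s \<Longrightarrow>
        measure_pmf.prob \<P> {X. (\<forall>e\<in>T. X e) \<and> Bad (set L) X} \<le> p ^ card T * Q"
  shows "measure_pmf.prob \<P> {X. \<exists>S\<subseteq>{..<N}. card S = s \<and> link_connected X S \<and> Bad S X}
      \<le> real n * (4 * branching) ^ s * Q"
proof -
  \<comment> \<open>balances the number of discoveries against their weight\<close>
  define y where "y = 1 / branching"
  have y: "0 < y" "branching * y = 1" using branching_ge by (auto simp: y_def)
  define R where "R i = {\<sigma>\<in>reach i (2 * s - 1). length (fst \<sigma>) = s}" for i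
  define ev where "ev \<sigma> = {X. (\<forall>e\<in>snd (snd \<sigma>). X e) \<and> Bad (set (fst \<sigma>)) X}" for \<sigma> :: exploration
  have fR: "finite (R i)" for i unfolding R_def using finite_reach by auto
  have "{X. \<exists>S\<subseteq>{..<N}. card S = s \<and> link_connected X S \<and> Bad S X} \<subseteq> (\<Union>i\<in>{..<N}. \<Union>\<sigma>\<in>R i. ev \<sigma>)"
  proof
    fix X assume "X \<in> {X. \<exists>S\<subseteq>{..<N}. card S = s \<and> link_connected X S \<and> Bad S X}"
    then obtain S where S: "S \<subseteq> {..<N}" "card S = s" "link_connected X S" "Bad S X" by auto
    then have "finite S" using finite_subset[OF S(1)] by simp
    have "S \<noteq> {}" using s S(2) by auto
    then obtain i where i: "i \<in> S" by auto
    obtain L q T where L: "(L, q, T) \<in> reach i (2 * s - 1)" "set L = S" "\<forall>e\<in>T. X e"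
      using exploration_exists[OF \<open>finite S\<close> S(1) i S(3)] S(2) by auto
    have iN: "i < N" using i S by auto
    have "distinct L" using consistent_reach[OF iN L(1)] by simp
    then have "length L = s" using L(2) S(2) distinct_card[of L] by simp
    then show "X \<in> (\<Union>i\<in>{..<N}. \<Union>\<sigma>\<in>R i. ev \<sigma>)"
      using L S iN by (intro UN_I[of i] UN_I[of "(L, q, T)"]) (auto simp: R_def ev_def)
  qed
  then have "measure_pmf.prob \<P> {X. \<exists>S\<subseteq>{..<N}. card S = s \<and> link_connected X S \<and> Bad S X}
      \<le> measure_pmf.prob \<P> (\<Union>i\<in>{..<N}. \<Union>\<sigma>\<in>R i. ev \<sigma>)"
    by (intro measure_pmf.finite_measure_mono) auto
  also have "\<dots> \<le> (\<Sum>i\<in>{..<N}. measure_pmf.prob \<P> (\<Union>\<sigma>\<in>R i. ev \<sigma>))"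
    by (intro measure_pmf.finite_measure_subadditive_finite) auto
  also have "\<dots> \<le> (\<Sum>i\<in>{..<N}. (4 * branching) ^ s * Q)"
  proof (rule sum_mono)
    fix i assume i: "i \<in> {..<N}"
    have "measure_pmf.prob \<P> (\<Union>\<sigma>\<in>R i. ev \<sigma>) \<le> (\<Sum>\<sigma>\<in>R i. measure_pmf.prob \<P> (ev \<sigma>))"
      using fR by (intro measure_pmf.finite_measure_subadditive_finite) auto
    also have "\<dots> \<le> (\<Sum>\<sigma>\<in>R i. branching ^ s * Q * weight y \<sigma>)"
    proof (rule sum_mono)
      fix \<sigma> assume \<sigma>: "\<sigma> \<in> R i"
      obtain L q T where e: "\<sigma> = (L, q, T)" by (cases \<sigma>)
      have iN: "i < N" and r: "(L, q, T) \<in> reach i (2 * s - 1)" using \<sigma> i by (simp_all add: R_def e)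
      have "consistent (L, q, T)" by (rule consistent_reach[OF iN r])
      then have "measure_pmf.prob \<P> (ev \<sigma>) \<le> p ^ card T * Q" using bad[of L q T] \<sigma> by (simp add: R_def e ev_def)
      also have "\<dots> = (branching * y) ^ s * (p ^ card T * Q)" unfolding y(2) by simp
      also have "\<dots> = branching ^ s * Q * weight y \<sigma>"
        using \<sigma> by (simp add: e R_def power_mult_distrib mult_ac)
      finally show "measure_pmf.prob \<P> (ev \<sigma>) \<le> branching ^ s * Q * weight y \<sigma>" .
    qed
    also have "\<dots> = branching ^ s * Q * (\<Sum>\<sigma>\<in>R i. weight y \<sigma>)" by (simp only: sum_distrib_left)
    also have "\<dots> \<le> branching ^ s * Q * 4 ^ s"
    proof (rule mult_left_mono)
      have "(\<Sum>\<sigma>\<in>R i. weight y \<sigma>) \<le> (\<Sum>\<sigma>\<in>reach i (2 * s - 1). weight y \<sigma>)"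
        unfolding R_def using y finite_reach by (intro sum_mono2 weight_nonneg) auto
      also have "\<dots> \<le> (1 + branching * y) ^ (2 * s - 1) * y" using y i by (intro weight_reach) auto
      also have "\<dots> \<le> 2 ^ (2 * s - 1) * 1"
        unfolding y(2) using branching_ge by (intro mult_mono) (auto simp: y_def)
      also have "\<dots> \<le> 2 ^ (2 * s)" by simp
      also have "\<dots> = (4::real) ^ s" by (simp add: power_mult)
      finally show "(\<Sum>\<sigma>\<in>R i. weight y \<sigma>) \<le> 4 ^ s" .
    qed (use Q branching_ge in auto)
    finally show "measure_pmf.prob \<P> (\<Union>\<sigma>\<in>R i. ev \<sigma>) \<le> (4 * branching) ^ s * Q"
      by (simp add: power_mult_distrib mult_ac)
  qed
  also have "\<dots> = real N * ((4 * branching) ^ s * Q)" by simp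
  also have "\<dots> \<le> real n * ((4 * branching) ^ s * Q)"
    using Q branching_ge by (intro mult_right_mono) auto
  finally show ?thesis by (simp add: mult_ac)
qed

end

section \<open>Expansion of connected sets in the small world\<close>

context blocks begin

definition exits :: "nat set \<Rightarrow> nat set \<Rightarrow> nat set set" where
  "exits S F = {e \<in> NE. \<exists>u\<in>cell F. \<exists>w\<in>{1..n} - cell S. e = {u, w}}"

definition touching :: "nat set \<Rightarrow> nat set set" where
  "touching S = {e \<in> NE. e \<inter> cell S \<noteq> {}}"

definition few_exits :: "nat set \<Rightarrow> (nat set \<Rightarrow> bool) \<Rightarrow> bool" where
  "few_exits S X \<longleftrightarrow> (\<exists>F\<subseteq>S. real b * real (card S) * real n / 8 \<le> real (card (exits S F)) \<and>
      card {e \<in> exits S F. X e} < card S)"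

definition many_touching :: "nat \<Rightarrow> nat set \<Rightarrow> (nat set \<Rightarrow> bool) \<Rightarrow> bool" where
  "many_touching a S X \<longleftrightarrow> a \<le> card {e \<in> touching S. X e}"

lemma card_touching_le: "card (touching S) \<le> card (cell S) * n"
proof -
  have "touching S \<subseteq> (\<lambda>(u, w). {u, w}) ` (cell S \<times> {1..n})"
  proof
    fix e assume e: "e \<in> touching S"
    then have "e \<in> NE" by (simp add: touching_def)
    then have "e \<subseteq> {1..n}" "card e = 2" using nonedge_pair by auto
    then obtain x y where xy: "e = {x, y}" "x \<in> {1..n}" "y \<in> {1..n}" by (auto simp: card_2_iff)
    have "x \<in> cell S \<or> y \<in> cell S" using e xy by (auto simp: touching_def)
    then show "e \<in> (\<lambda>(u, w). {u, w}) ` (cell S \<times> {1..n})"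
    proof
      assume "x \<in> cell S"
      then have "(x, y) \<in> cell S \<times> {1..n}" using xy by simp
      then show ?thesis unfolding xy(1) by (rule rev_image_eqI) simp
    next
      assume "y \<in> cell S"
      then have "(y, x) \<in> cell S \<times> {1..n}" using xy by simp
      then show ?thesis unfolding xy(1) by (rule rev_image_eqI) (simp add: insert_commute)
    qed
  qed
  then have "card (touching S) \<le> card ((\<lambda>(u, w). {u, w}) ` (cell S \<times> {1..n}))" by (intro card_mono) auto
  also have "\<dots> \<le> card (cell S \<times> {1..n})" by (intro card_image_le) auto
  finally show ?thesis by (simp add: card_cartesian_product)
qed

lemma finite_exits: "finite (exits S F)" unfolding exits_def using finite_nonedges[of n k] by simp

lemma cell_mono: "F \<subseteq> S \<Longrightarrow> cell F \<subseteq> cell S" by (auto simp: cells_def)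

text \<open>
  A vertex in a block of \<open>F\<close> has a potential shortcut to every vertex outside the blocks of \<open>S\<close>, except
  for its at most \<open>2 k\<close> ring neighbours.
\<close>

lemma card_exits_ge:
  assumes "F \<subseteq> S" shows "card (cell F) * (n - card (cell S) - 2 * k) \<le> card (exits S F)"
proof -
  define W where "W u = {1..n} - cell S - neighbours (ring_edges n k) u" for u
  have W: "n - card (cell S) - 2 * k \<le> card (W u)" for u
  proof -
    have fin: "finite (neighbours (ring_edges n k) u)"
      by (rule finite_subset[of _ "{1..n}"]) (auto simp: neighbours_def ring_edge_iff)
    have "card ({1..n} - cell S) - card (neighbours (ring_edges n k) u) \<le> card (W u)"
      unfolding W_def by (rule diff_card_le_card_Diff[OF fin])
    moreover have "card {1..n} - card (cell S) \<le> card ({1..n} - cell S)"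
      by (rule diff_card_le_card_Diff) simp
    moreover have "card (neighbours (ring_edges n k) u) \<le> 2 * k" by (rule ring_degree_le)
    ultimately show ?thesis by simp
  qed
  have "card (cell F) * (n - card (cell S) - 2 * k) = (\<Sum>u\<in>cell F. n - card (cell S) - 2 * k)" by simp
  also have "\<dots> \<le> (\<Sum>u\<in>cell F. card (W u))" by (intro sum_mono W)
  also have "\<dots> = card (Sigma (cell F) W)" by (rule card_SigmaI[symmetric]) (auto simp: W_def)
  also have "\<dots> \<le> card (exits S F)"
  proof (rule card_inj_on_le[where f = "\<lambda>(u, w). {u, w}"])
    show "inj_on (\<lambda>(u, w). {u, w}) (Sigma (cell F) W)"
      using cell_mono[OF assms] by (auto simp: inj_on_def W_def doubleton_eq_iff)
    show "(\<lambda>(u, w). {u, w}) ` Sigma (cell F) W \<subseteq> exits S F"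
    proof
      fix e assume "e \<in> (\<lambda>(u, w). {u, w}) ` Sigma (cell F) W"
      then obtain u w where uw: "e = {u, w}" "u \<in> cell F" "w \<in> W u" by auto
      have "u \<noteq> w" using uw cell_mono[OF assms] by (auto simp: W_def)
      then have "{u, w} \<in> NE" using uw unfolding nonedge_iff by (auto simp: W_def neighbours_def cells_def)
      moreover have "w \<in> {1..n} - cell S" using uw(3) by (simp add: W_def)
      ultimately show "e \<in> exits S F" using uw(1,2) unfolding exits_def by blast
    qed
  qed (rule finite_exits)
  finally show ?thesis .
qed

text \<open>
  The exits avoid the shortcuts of the exploration, which stay inside \<open>S\<close>, so that the exploration and
  the exits are independent. The factor \<open>2 ^ s\<close> pays for the choice of \<open>F\<close>.
\<close>

lemma prob_few_exits:
  assumes s: "1 \<le> s"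
  shows "measure_pmf.prob \<P> {X. \<exists>S\<subseteq>{..<N}. card S = s \<and> link_connected X S \<and> few_exits S X}
      \<le> real n * (4 * branching) ^ s * (2 ^ s * exp (real s - p * (real b * real s * real n) / 16))"
proof (rule union_bound_explorations[OF s])
  fix L q T assume c: "consistent (L, q, T)" and L: "length L = s"
  have inv: "finite T" "T \<subseteq> NE" "\<Union>T \<subseteq> cell (set L)" "distinct L" using c by auto
  have cs: "card (set L) = s" using inv L distinct_card by auto
  define S where "S = set L"
  define FF where "FF = {F\<in>Pow S. real b * real (card S) * real n / 8 \<le> real (card (exits S F))}"
  have fF: "finite FF" by (simp add: FF_def S_def)
  have "card FF \<le> card (Pow S)" unfolding FF_def by (intro card_mono) (auto simp: S_def)
  then have cF: "real (card FF) \<le> 2 ^ s" using cs by (simp add: card_Pow S_def flip: of_nat_le_iff)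
  have "{X. (\<forall>e\<in>T. X e) \<and> few_exits S X} \<subseteq> (\<Union>F\<in>FF. {X. (\<forall>e\<in>T. X e) \<and> card {e\<in>exits S F. X e} < s})"
    using cs by (auto simp: few_exits_def FF_def S_def)
  then have "measure_pmf.prob \<P> {X. (\<forall>e\<in>T. X e) \<and> few_exits S X}
      \<le> measure_pmf.prob \<P> (\<Union>F\<in>FF. {X. (\<forall>e\<in>T. X e) \<and> card {e\<in>exits S F. X e} < s})"
    by (intro measure_pmf.finite_measure_mono) auto
  also have "\<dots> \<le> (\<Sum>F\<in>FF. measure_pmf.prob \<P> {X. (\<forall>e\<in>T. X e) \<and> card {e\<in>exits S F. X e} < s})"
    by (intro measure_pmf.finite_measure_subadditive_finite fF) auto
  also have "\<dots> \<le> (\<Sum>F\<in>FF. p ^ card T * exp (real s - p * (real b * real s * real n) / 16))"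
  proof (rule sum_mono)
    fix F assume F: "F \<in> FF"
    have disj: "T \<inter> exits S F = {}"
    proof (rule ccontr)
      assume "T \<inter> exits S F \<noteq> {}"
      then obtain e u w where "e \<in> T" "w \<notin> cell S" "e = {u, w}" by (auto simp: exits_def)
      then show False using inv(3) by (auto simp: S_def)
    qed
    have "measure_pmf.prob \<P> {X. (\<forall>e\<in>T. X e) \<and> card {e\<in>exits S F. X e} < s}
        \<le> p ^ card T * exp (real s - p * real (card (exits S F)) / 2)"
      by (rule few_open[OF finite_nonedges inv(2) _ disj p01]) (auto simp: exits_def)
    also have "\<dots> \<le> p ^ card T * exp (real s - p * (real b * real s * real n) / 16)"
    proof -
      have "p * (real b * real s * real n / 8) \<le> p * real (card (exits S F))"
        using F cs p01 by (intro mult_left_mono) (auto simp: FF_def S_def)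
      then have "real s - p * real (card (exits S F)) / 2 \<le> real s - p * (real b * real s * real n) / 16" by (simp add: mult_ac)
      then show ?thesis using p01 by (intro mult_left_mono) auto
    qed
    finally show "measure_pmf.prob \<P> {X. (\<forall>e\<in>T. X e) \<and> card {e\<in>exits S F. X e} < s}
        \<le> p ^ card T * exp (real s - p * (real b * real s * real n) / 16)" .
  qed
  also have "\<dots> = real (card FF) * (p ^ card T * exp (real s - p * (real b * real s * real n) / 16))" by simp
  also have "\<dots> \<le> 2 ^ s * (p ^ card T * exp (real s - p * (real b * real s * real n) / 16))"
    using cF p01 by (intro mult_right_mono) auto
  finally show "measure_pmf.prob \<P> {X. (\<forall>e\<in>T. X e) \<and> few_exits (set L) X}
      \<le> p ^ card T * (2 ^ s * exp (real s - p * (real b * real s * real n) / 16))"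
    by (simp add: S_def mult_ac)
qed simp

lemma prob_many_touching:
  assumes s: "1 \<le> s"
  shows "measure_pmf.prob \<P> {X. \<exists>S\<subseteq>{..<N}. card S = s \<and> link_connected X S \<and> many_touching a S X}
      \<le> real n * (4 * branching) ^ s * exp (real s - real a + 4 * p * (real b * real s * real n))"
proof (rule union_bound_explorations[OF s])
  fix L q T assume c: "consistent (L, q, T)" and L: "length L = s"
  have inv: "finite T" "T \<subseteq> NE" "Suc (card T) \<le> s" "distinct L" using c L by auto
  have cs: "card (set L) = s" using inv L distinct_card by auto
  have "measure_pmf.prob \<P> {X. (\<forall>e\<in>T. X e) \<and> a \<le> card {e\<in>touching (set L). X e}}
      \<le> p ^ card T * exp (real (card T) - real a + 2 * p * real (card (touching (set L))))"
    by (rule many_open[OF finite_nonedges inv(2) _ p01]) (auto simp: touching_def)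
  also have "\<dots> \<le> p ^ card T * exp (real s - real a + 4 * p * (real b * real s * real n))"
  proof -
    have "card (touching (set L)) \<le> card (cell (set L)) * n" by (rule card_touching_le)
    also have "\<dots> \<le> (2 * b * s) * n" using card_cells_le[OF b1, of "set L" n] cs by simp
    finally have "real (card (touching (set L))) \<le> real (2 * b * s * n)" by (simp only: of_nat_le_iff)
    then have "p * real (card (touching (set L))) \<le> p * (2 * (real b * real s * real n))"
      using p01 by (intro mult_left_mono) auto
    then have "real (card T) - real a + 2 * p * real (card (touching (set L))) \<le> real s - real a + 4 * p * (real b * real s * real n)"
      using inv(3) by simp
    then show ?thesis using p01 by (intro mult_left_mono) auto
  qed
  finally show "measure_pmf.prob \<P> {X. (\<forall>e\<in>T. X e) \<and> many_touching a (set L) X}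
      \<le> p ^ card T * exp (real s - real a + 4 * p * (real b * real s * real n))"
    by (simp add: many_touching_def)
qed simp

text \<open>
  The two events whose absence yields expansion: too few open shortcuts leaving a large part of a
  connected family of blocks, and too many open shortcuts touching such a family. Families of fewer
  than \<open>s0\<close> blocks may have no exits at all; for them only the volume is bounded, in terms of \<open>s0\<close>.
\<close>

definition good :: "nat \<Rightarrow> nat \<Rightarrow> (nat set \<Rightarrow> bool) \<Rightarrow> bool" where
  "good m s0 X \<longleftrightarrow> (\<forall>S\<subseteq>{..<N}. S \<noteq> {} \<and> link_connected X S \<longrightarrow>
     (s0 \<le> card S \<longrightarrow> \<not> few_exits S X) \<and> \<not> many_touching (m * max (card S) s0) S X)"

text \<open>
  The hypotheses say that the probabilistic gain per block beats the number of explorations: the first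
  by the length of the blocks, the second by the size of \<open>m\<close>.
\<close>

lemma prob_not_good:
  assumes A1: "4 * branching * (2 * exp 1) * exp (- (p * real n * real b / 16)) \<le> exp (-1)"
    and A2: "ln (4 * branching) + 2 + 4 * (p * real n * real b) \<le> real m"
  shows "measure_pmf.prob \<P> {X. \<not> good m s0 X} \<le> 2 * (real n)\<^sup>2 * exp (- real s0)"
proof -
  define B1 where "B1 s = {X. \<exists>S\<subseteq>{..<N}. card S = s \<and> link_connected X S \<and> few_exits S X}" for s
  define B2 where "B2 s = {X. \<exists>S\<subseteq>{..<N}. card S = s \<and> link_connected X S \<and> many_touching (m * max s s0) S X}" for s
  define Bd where "Bd s = (if s0 \<le> s then B1 s else {}) \<union> B2 s" for s
  have br: "0 < branching" using branching_ge by simp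
  have 1: "measure_pmf.prob \<P> (B1 s) \<le> real n * exp (- real s0)" if "1 \<le> s" "s0 \<le> s" for s
  proof -
    have "(4 * branching) ^ s * (2 ^ s * exp (real s - p * (real b * real s * real n) / 16))
        = (4 * branching * (2 * exp 1) * exp (- (p * real n * real b / 16))) ^ s"
    proof -
      have "exp (real s - p * (real b * real s * real n) / 16) = exp 1 ^ s * exp (- (p * real n * real b / 16)) ^ s"
        unfolding exp_of_nat_mult[symmetric] mult_exp_exp by (simp add: algebra_simps)
      then show ?thesis by (simp only: power_mult_distrib mult_ac)
    qed
    also have "\<dots> \<le> exp (-1) ^ s" using A1 br by (intro power_mono) auto
    also have "\<dots> = exp (- real s)" by (simp add: exp_of_nat_mult[symmetric])
    also have "\<dots> \<le> exp (- real s0)" using that by simp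
    finally have "real n * ((4 * branching) ^ s * (2 ^ s * exp (real s - p * (real b * real s * real n) / 16))) \<le> real n * exp (- real s0)"
      by (intro mult_left_mono) auto
    then show ?thesis using prob_few_exits[OF that(1)] unfolding B1_def by (simp add: mult.assoc)
  qed
  have 2: "measure_pmf.prob \<P> (B2 s) \<le> real n * exp (- real s0)" if "1 \<le> s" for s
  proof -
    \<comment> \<open>the threshold \<open>m * M\<close> exceeds the entropy of \<open>s \<le> M\<close> blocks by at least \<open>M\<close>\<close>
    define M where "M = real (max s s0)"
    have "(4 * branching) ^ s * exp (real s - real (m * max s s0) + 4 * p * (real b * real s * real n))
        = exp (real s * ln (4 * branching)) * exp (real s - real m * M + 4 * p * (real b * real s * real n))"
      using br by (simp add: exp_of_nat_mult M_def)
    also have "\<dots> = exp (real s * (ln (4 * branching) + 1 + 4 * (p * real n * real b)) - real m * M)"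
      unfolding mult_exp_exp by (simp add: algebra_simps)
    also have "\<dots> \<le> exp (- real s0)"
    proof -
      have sM: "real s \<le> M" "real s0 \<le> M" by (auto simp: M_def)
      have lb: "0 \<le> ln (4 * branching)" using branching_ge by simp
      have "real s * (ln (4 * branching) + 1 + 4 * (p * real n * real b)) \<le> M * (real m - 1)"
        using sM A2 lb p01 by (intro mult_mono) auto
      then have "real s * (ln (4 * branching) + 1 + 4 * (p * real n * real b)) - real m * M \<le> - M"
        by (simp add: algebra_simps)
      then show ?thesis using sM by simp
    qed
    finally have "real n * ((4 * branching) ^ s * exp (real s - real (m * max s s0) + 4 * p * (real b * real s * real n))) \<le> real n * exp (- real s0)"
      by (intro mult_left_mono) auto
    then show ?thesis using prob_many_touching[OF that, of "m * max s s0"] unfolding B2_def by (simp add: mult.assoc)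
  qed
  have "{X. \<not> good m s0 X} \<subseteq> (\<Union>s\<in>{1..n}. Bd s)"
  proof
    fix X assume "X \<in> {X. \<not> good m s0 X}"
    then obtain S where S: "S \<subseteq> {..<N}" "S \<noteq> {}" "link_connected X S"
      "(s0 \<le> card S \<and> few_exits S X) \<or> many_touching (m * max (card S) s0) S X" by (auto simp: good_def)
    have fS: "finite S" using S finite_subset by blast
    then have "1 \<le> card S" using S card_gt_0_iff[of S] by simp
    moreover have "card S \<le> n"
    proof -
      have "card S \<le> card {..<N}" using S by (intro card_mono) auto
      then have "card S \<le> N" by simp
      then show ?thesis using div_le_dividend by (rule order_trans)
    qed
    ultimately have "card S \<in> {1..n}" by simp
    moreover have "X \<in> Bd (card S)" using S unfolding Bd_def B1_def B2_def by auto
    ultimately show "X \<in> (\<Union>s\<in>{1..n}. Bd s)" by blast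
  qed
  then have "measure_pmf.prob \<P> {X. \<not> good m s0 X} \<le> measure_pmf.prob \<P> (\<Union>s\<in>{1..n}. Bd s)"
    by (intro measure_pmf.finite_measure_mono) auto
  also have "\<dots> \<le> (\<Sum>s\<in>{1..n}. measure_pmf.prob \<P> (Bd s))"
    by (intro measure_pmf.finite_measure_subadditive_finite) auto
  also have "\<dots> \<le> (\<Sum>s\<in>{1..n}. 2 * (real n * exp (- real s0)))"
  proof (rule sum_mono)
    fix s assume s: "s \<in> {1..n}"
    have "measure_pmf.prob \<P> (Bd s) \<le> measure_pmf.prob \<P> (if s0 \<le> s then B1 s else {}) + measure_pmf.prob \<P> (B2 s)"
      unfolding Bd_def by (intro measure_Un_le) auto
    also have "\<dots> \<le> real n * exp (- real s0) + real n * exp (- real s0)"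
      using 1[of s] 2[of s] s by (intro add_mono) auto
    finally show "measure_pmf.prob \<P> (Bd s) \<le> 2 * (real n * exp (- real s0))" by simp
  qed
  also have "\<dots> = 2 * (real n)\<^sup>2 * exp (- real s0)" by (simp add: power2_eq_square)
  finally show ?thesis .
qed

lemma link_connected_image:
  assumes S: "S \<subseteq> {1..n}" and conn: "internally_connected (small_world n k X) S"
  shows "link_connected X (bl ` S)"
  unfolding link_connected_def
proof (intro allI impI)
  fix A assume A: "A \<subseteq> bl ` S \<and> A \<noteq> {} \<and> A \<noteq> bl ` S"
  define A' where "A' = {v\<in>S. bl v \<in> A}"
  have "A' \<subseteq> S" "A' \<noteq> {}" "A' \<noteq> S" using A unfolding A'_def by blast+
  then obtain u w where uw: "u \<in> A'" "w \<in> S - A'" "{u, w} \<in> small_world n k X"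
    using conn unfolding internally_connected_def by blast
  have blk: "bl u \<in> A" "bl w \<in> bl ` S - A" using uw by (auto simp: A'_def)
  have "link X (bl u) (bl w)"
  proof (cases "{u, w} \<in> ring_edges n k")
    case True
    have "bl w = bl u \<or> bl w \<in> cyclic_nb N (bl u)" by (rule ring_blocks[OF b1 bn kb True])
    then show ?thesis using blk by (auto simp: link_def)
  next
    case False
    then have "{u, w} \<in> NE" "X {u, w}" using uw(3) by (auto simp: small_world_def)
    then show ?thesis unfolding link_def by blast
  qed
  then show "\<exists>i\<in>A. \<exists>j\<in>bl ` S - A. link X i j" using blk by blast
qed

lemma image_blocks: "bl ` S \<subseteq> {..<N}" using block_lt[OF b1 bn] by auto

lemma subset_cell: "S \<subseteq> {1..n} \<Longrightarrow> S \<subseteq> cell (bl ` S)" by (auto simp: cells_def)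

lemma degree_small_world_le:
  "degree (small_world n k X) v \<le> 2 * k + card {e\<in>NE. X e \<and> v \<in> e}"
proof -
  define B where "B = {w. {v, w} \<in> NE \<and> X {v, w}}"
  have fin: "finite {e\<in>NE. X e \<and> v \<in> e}" using finite_nonedges[of n k] by simp
  have "neighbours (small_world n k X) v = neighbours (ring_edges n k) v \<union> B"
    by (auto simp: neighbours_def small_world_def B_def)
  then have "degree (small_world n k X) v \<le> card (neighbours (ring_edges n k) v) + card B"
    unfolding degree_def by (simp only: card_Un_le)
  moreover have "card B \<le> card {e\<in>NE. X e \<and> v \<in> e}"
    by (rule card_inj_on_le[where f = "\<lambda>w. {v, w}", OF _ _ fin]) (auto simp: B_def inj_on_def doubleton_eq_iff)
  ultimately show ?thesis using ring_degree_le[of n k v] by linarith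
qed

text \<open>
  Ring edges give at most \<open>2 k\<close> per vertex, and every open shortcut is counted at most twice.
\<close>

lemma vol_le_touching:
  assumes S: "S \<subseteq> {1..n}"
  shows "vol (small_world n k X) S \<le> real (2 * k * card S + 2 * card {e\<in>touching (bl ` S). X e})"
proof -
  define OE where "OE = {e\<in>touching (bl ` S). X e}"
  have fO: "finite OE" unfolding OE_def touching_def using finite_nonedges[of n k] by simp
  have fS: "finite S" using S finite_subset by blast
  have "(\<Sum>v\<in>S. degree (small_world n k X) v) \<le> (\<Sum>v\<in>S. 2 * k + card {e\<in>OE. v \<in> e})"
  proof (rule sum_mono)
    fix v assume v: "v \<in> S"
    have "{e\<in>NE. X e \<and> v \<in> e} = {e\<in>OE. v \<in> e}"
      using v subset_cell[OF S] by (auto simp: OE_def touching_def)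
    then show "degree (small_world n k X) v \<le> 2 * k + card {e\<in>OE. v \<in> e}"
      using degree_small_world_le[of X v] by simp
  qed
  also have "\<dots> = 2 * k * card S + (\<Sum>v\<in>S. card {e\<in>OE. v \<in> e})" by (simp add: sum.distrib)
  also have "(\<Sum>v\<in>S. card {e\<in>OE. v \<in> e}) = (\<Sum>v\<in>S. \<Sum>e\<in>{e\<in>OE. v \<in> e}. 1)" by simp
  also have "\<dots> = (\<Sum>e\<in>OE. \<Sum>v\<in>{v\<in>S. v \<in> e}. 1)" by (rule sum.swap_restrict[OF fS fO])
  also have "\<dots> \<le> (\<Sum>e\<in>OE. 2)"
  proof (rule sum_mono)
    fix e assume "e \<in> OE"
    then have "card e = 2" using nonedge_pair by (auto simp: OE_def touching_def)
    moreover have "card {v\<in>S. v \<in> e} \<le> card e"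
    proof (rule card_mono)
      show "finite e" by (rule card_ge_0_finite) (simp add: \<open>card e = 2\<close>)
    qed auto
    ultimately show "(\<Sum>v\<in>{v\<in>S. v \<in> e}. 1) \<le> (2::nat)" by simp
  qed
  finally have le: "(\<Sum>v\<in>S. degree (small_world n k X) v) \<le> 2 * k * card S + 2 * card OE" by simp
  have "vol (small_world n k X) S = real (\<Sum>v\<in>S. degree (small_world n k X) v)"
    unfolding vol_def by (rule of_nat_sum[symmetric])
  then show ?thesis using le unfolding OE_def by (simp only: of_nat_le_iff)
qed

lemma vol_le_good:
  assumes g: "good m s0 X" and S: "S \<subseteq> {1..n}" "S \<noteq> {}" and conn: "internally_connected (small_world n k X) S"
  shows "vol (small_world n k X) S \<le> real (4 * k * b + 2 * m) * real (max (card (bl ` S)) s0)"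
proof -
  define r where "r = max (card (bl ` S)) s0"
  have fS: "finite S" using S finite_subset by blast
  have "\<not> many_touching (m * r) (bl ` S) X"
    using g link_connected_image[OF S(1) conn] image_blocks S(2) unfolding good_def r_def by blast
  then have "card {e\<in>touching (bl ` S). X e} \<le> m * r" by (simp add: many_touching_def)
  moreover have "card S \<le> 2 * b * r"
  proof -
    have "card S \<le> card (cell (bl ` S))" using subset_cell[OF S(1)] by (intro card_mono) auto
    also have "\<dots> \<le> 2 * b * card (bl ` S)" using fS by (intro card_cells_le b1) auto
    also have "\<dots> \<le> 2 * b * r" by (intro mult_left_mono) (auto simp: r_def)
    finally show ?thesis .
  qed
  then have "2 * k * card S \<le> 2 * k * (2 * b * r)" by (intro mult_left_mono) auto
  ultimately have "2 * k * card S + 2 * card {e\<in>touching (bl ` S). X e} \<le> 2 * k * (2 * b * r) + 2 * (m * r)"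
    by linarith
  also have "\<dots> = (4 * k * b + 2 * m) * r" by (simp add: algebra_simps)
  finally have "2 * k * card S + 2 * card {e\<in>touching (bl ` S). X e} \<le> (4 * k * b + 2 * m) * r" .
  then have "real (2 * k * card S + 2 * card {e\<in>touching (bl ` S). X e}) \<le> real ((4 * k * b + 2 * m) * r)"
    by (simp only: of_nat_le_iff)
  then show ?thesis using vol_le_touching[OF S(1), of X] unfolding r_def[symmetric] by simp
qed

lemma finite_nb_sw: "finite (neighbours (small_world n k X) v)"
  by (rule finite_subset[of _ "{1..n}"]) (auto simp: neighbours_def small_world_def ring_edge_iff nonedge_iff)

text \<open>
  A block that \<open>S\<close> meets without containing it has two consecutive vertices of which exactly one is in
  \<open>S\<close>; distinct blocks give distinct boundary edges.
\<close>

lemma partial_blocks_boundary: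
  assumes S: "S \<subseteq> {1..n}"
  shows "card {i\<in>bl ` S. \<not> cell {i} \<subseteq> S} \<le> boundary (small_world n k X) S"
proof -
  let ?E = "small_world n k X"
  define P where "P = Sigma S (\<lambda>v. neighbours ?E v - S)"
  have fS: "finite S" using S finite_subset by blast
  have fP: "finite P" unfolding P_def using fS finite_nb_sw by auto
  have mono: "bl x \<le> bl y" if "x \<le> y" for x y
  proof -
    have "(x - 1) div b \<le> (y - 1) div b" using that by (intro div_le_mono) simp
    then show ?thesis by (simp add: block_def min_def)
  qed
  have "{i\<in>bl ` S. \<not> cell {i} \<subseteq> S} \<subseteq> (\<lambda>(u, w). bl u) ` P"
  proof
    fix i assume "i \<in> {i\<in>bl ` S. \<not> cell {i} \<subseteq> S}"
    then obtain u w where u: "u \<in> S" "bl u = i" and w: "w \<notin> S" "w \<in> {1..n}" "bl w = i" by (auto simp: cells_def)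
    have u1: "u \<in> {1..n}" using u S by auto
    define x where "x = min u w"
    define y where "y = max u w"
    have xy: "x < y" "(x \<in> S) \<noteq> (y \<in> S)" "1 \<le> x" "y \<le> n" "bl x = i" "bl y = i"
      using u w u1 by (auto simp: x_def y_def min_def max_def nat_neq_iff intro: le_neq_implies_less)
    obtain j where j: "x \<le> j" "j < y" "(j \<in> S) \<noteq> (Suc j \<in> S)" using consecutive_change[OF xy(1,2)] by blast
    have bj: "bl j = i" "bl (Suc j) = i" using mono[of x j] mono[of j y] mono[of x "Suc j"] mono[of "Suc j" y] j xy by auto
    have e: "{j, Suc j} \<in> ?E" using ring_step[OF k1, of j n] j xy by (auto simp: small_world_def)
    show "i \<in> (\<lambda>(u, w). bl u) ` P"
    proof (cases "j \<in> S")
      case True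
      then have "(j, Suc j) \<in> P" using j e by (auto simp: P_def neighbours_def)
      then show ?thesis using bj by (intro rev_image_eqI) auto
    next
      case False
      then have "(Suc j, j) \<in> P" using j e by (auto simp: P_def neighbours_def insert_commute)
      then show ?thesis using bj by (intro rev_image_eqI) auto
    qed
  qed
  then have "card {i\<in>bl ` S. \<not> cell {i} \<subseteq> S} \<le> card P" by (intro surj_card_le fP)
  then show ?thesis unfolding P_def using boundary_card_Sigma[OF fS finite_nb_sw] by simp
qed

lemma open_exits_boundary:
  assumes S: "S \<subseteq> {1..n}" and F: "cell F \<subseteq> S" "F \<subseteq> bl ` S"
  shows "card {e\<in>exits (bl ` S) F. X e} \<le> boundary (small_world n k X) S"
proof -
  let ?E = "small_world n k X"
  define P where "P = Sigma S (\<lambda>v. neighbours ?E v - S)"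
  have fS: "finite S" using S finite_subset by blast
  have fP: "finite P" unfolding P_def using fS finite_nb_sw by auto
  have "{e\<in>exits (bl ` S) F. X e} \<subseteq> (\<lambda>(u, w). {u, w}) ` P"
  proof
    fix e assume "e \<in> {e\<in>exits (bl ` S) F. X e}"
    then obtain u w where e: "e = {u, w}" "u \<in> cell F" "w \<notin> cell (bl ` S)" "e \<in> NE" "X e" by (auto simp: exits_def)
    have "(u, w) \<in> P" using e F subset_cell[OF S] by (auto simp: P_def neighbours_def small_world_def)
    then show "e \<in> (\<lambda>(u, w). {u, w}) ` P" using e by (intro rev_image_eqI) auto
  qed
  then have "card {e\<in>exits (bl ` S) F. X e} \<le> card P" by (intro surj_card_le fP)
  then show ?thesis unfolding P_def using boundary_card_Sigma[OF fS finite_nb_sw] by simp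
qed

text \<open>
  If a sixteenth of the blocks that \<open>S\<close> meets are not contained in \<open>S\<close>, then these already supply the
  boundary. Otherwise the family \<open>F\<close> of the contained blocks is almost everything; the blocks met by
  \<open>S\<close> leave a quarter of all vertices uncovered, and the open shortcuts from \<open>F\<close> to the uncovered
  vertices are boundary edges of \<open>S\<close>.
\<close>

lemma boundary_ge_good:
  assumes g: "good m s0 X" and S: "S \<subseteq> {1..n}" "S \<noteq> {}" and conn: "internally_connected (small_world n k X) S"
    and half: "2 * card S \<le> n" and s0: "s0 \<le> card (bl ` S)" and nk: "16 * k \<le> n"
  shows "real (card (bl ` S)) / 16 \<le> real (boundary (small_world n k X) S)"
proof -
  define I where "I = bl ` S"
  define s where "s = card I"
  define Pt where "Pt = {i\<in>I. \<not> cell {i} \<subseteq> S}"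
  have fS: "finite S" using S finite_subset by blast
  then have fI: "finite I" by (simp add: I_def)
  have PB: "card Pt \<le> boundary (small_world n k X) S" unfolding Pt_def I_def by (rule partial_blocks_boundary[OF S(1)])
  show ?thesis
  proof (cases "real s / 16 \<le> real (card Pt)")
    case True
    then show ?thesis using PB unfolding s_def I_def by linarith
  next
    case False
    define F where "F = I - Pt"
    have IN: "I \<subseteq> {..<N}" unfolding I_def by (rule image_blocks)
    have FS: "cell F \<subseteq> S" by (auto simp: F_def Pt_def cells_def)
    have FI: "F \<subseteq> I" by (auto simp: F_def)
    have "card F = s - card Pt" unfolding F_def s_def using fI by (intro card_Diff_subset) (auto simp: Pt_def)
    moreover have "card Pt \<le> s" unfolding s_def using fI by (intro card_mono) (auto simp: Pt_def)
    ultimately have cF: "real (card F) = real s - real (card Pt)" by simp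
    have "b * card F \<le> card (cell F)" using FI IN by (intro card_cells_ge b1) auto
    then have "real b * real (card F) \<le> real (card (cell F))" by (metis of_nat_le_iff of_nat_mult)
    moreover have "real b * (15/16 * real s) \<le> real b * real (card F)" using cF False by (intro mult_left_mono) auto
    ultimately have cellF: "15/16 * (real b * real s) \<le> real (card (cell F))" by simp
    have bsn: "real b * real s \<le> real n"
    proof -
      have "s \<le> N" unfolding s_def using card_mono[OF _ IN] by simp
      then have "b * s \<le> b * N" by simp
      also have "\<dots> \<le> n" by simp
      finally show ?thesis by (metis of_nat_le_iff of_nat_mult)
    qed
    have cellI: "real (card (cell I)) \<le> 5/8 * real n"
    proof -
      have "cell I \<subseteq> cell F \<union> cell Pt" by (auto simp: F_def cells_def)
      then have "card (cell I) \<le> card (cell F \<union> cell Pt)" by (intro card_mono) auto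
      also have "\<dots> \<le> card (cell F) + card (cell Pt)" by (rule card_Un_le)
      also have "\<dots> \<le> card S + 2 * b * card Pt"
        using FS fS fI by (intro add_mono card_mono card_cells_le b1) (auto simp: Pt_def)
      finally have sum_le: "card (cell I) \<le> card S + 2 * b * card Pt" .
      have "real (card (cell I)) \<le> real (card S) + 2 * (real b * real (card Pt))"
      proof -
        from sum_le have "real (card (cell I)) \<le> real (card S + 2 * b * card Pt)" by (simp only: of_nat_le_iff)
        then show ?thesis by simp
      qed
      moreover have "real b * real (card Pt) \<le> real b * (real s / 16)" using False by (intro mult_left_mono) auto
      ultimately show ?thesis using bsn half by linarith
    qed
    have ex: "real b * real (card I) * real n / 8 \<le> real (card (exits I F))"
    proof -
      have "card (cell F) * (n - card (cell I) - 2 * k) \<le> card (exits I F)" by (rule card_exits_ge[OF FI])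
      then have "real (card (cell F)) * real (n - card (cell I) - 2 * k) \<le> real (card (exits I F))"
        by (metis of_nat_le_iff of_nat_mult)
      moreover have "(15/16 * (real b * real s)) * (real n / 4) \<le> real (card (cell F)) * real (n - card (cell I) - 2 * k)"
        using cellF cellI nk by (intro mult_mono) linarith+
      moreover have "real b * real s * real n / 8 \<le> (15/16 * (real b * real s)) * (real n / 4)"
        by (simp add: field_simps)
      ultimately show ?thesis by (simp add: s_def)
    qed
    have "\<not> few_exits I X"
      using g link_connected_image[OF S(1) conn] IN S(2) s0 unfolding good_def I_def by blast
    then have "s \<le> card {e\<in>exits I F. X e}" using FI ex unfolding few_exits_def s_def by (meson not_less)
    also have "\<dots> \<le> boundary (small_world n k X) S" unfolding I_def
      by (rule open_exits_boundary[OF S(1) FS]) (use FI in \<open>simp add: I_def\<close>)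
    finally have "real s \<le> real (boundary (small_world n k X) S)" by simp
    then show ?thesis unfolding s_def I_def by linarith
  qed
qed

lemma isoperimetry_good:
  assumes g: "good m s0 X" and nk: "16 * k \<le> n"
    and S: "S \<subseteq> {1..n}" "S \<noteq> {}" and conn: "internally_connected (small_world n k X) S"
    and half: "2 * card S \<le> n"
    and large: "real (4 * k * b + 2 * m) * real s0 < vol (small_world n k X) S"
  shows "1 / (16 * real (4 * k * b + 2 * m)) * vol (small_world n k X) S \<le> real (boundary (small_world n k X) S)"
proof -
  define Q where "Q = real (4 * k * b + 2 * m)"
  have Q: "0 < Q" unfolding Q_def of_nat_0_less_iff using k1 b1 by simp
  have v: "vol (small_world n k X) S \<le> Q * real (max (card (bl ` S)) s0)"
    unfolding Q_def by (rule vol_le_good[OF g S conn])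
  have "s0 < card (bl ` S)"
  proof (rule ccontr)
    assume "\<not> s0 < card (bl ` S)"
    then have "max (card (bl ` S)) s0 = s0" by simp
    then show False using v large unfolding Q_def[symmetric] by simp
  qed
  then have s: "s0 \<le> card (bl ` S)" "max (card (bl ` S)) s0 = card (bl ` S)" by auto
  have "vol (small_world n k X) S / Q \<le> real (card (bl ` S))" using v s(2) Q by (simp add: pos_divide_le_eq mult.commute)
  then have "vol (small_world n k X) S / Q / 16 \<le> real (card (bl ` S)) / 16" by (intro divide_right_mono) auto
  also have "\<dots> \<le> real (boundary (small_world n k X) S)" by (rule boundary_ge_good[OF g S conn half s(1) nk])
  finally show ?thesis unfolding Q_def[symmetric] by (simp add: mult.commute)
qed

end

section \<open>Confinement to an interval without shortcuts\<close>

context connected_graph begin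

lemma drift_lower_bound:
  assumes drift: "\<And>y. y \<in> V \<Longrightarrow> h y - \<delta> \<le> step h y" and x: "x \<in> V"
  shows "h x - real t * \<delta> \<le> stp t h x"
  using x
proof (induction t arbitrary: x)
  case (Suc t)
  have "h x - real (Suc t) * \<delta> \<le> step h x + (- (real t * \<delta>))" using drift[OF Suc.prems] by (simp add: algebra_simps)
  also have "\<dots> = step (\<lambda>y. h y + (- (real t * \<delta>))) x" using Suc.prems by (simp only: step_add step_const)
  also have "\<dots> \<le> step (stp t h) x" using Suc by (intro step_mono_V) auto
  finally show ?case by simp
qed simp

text \<open>
  A function \<open>h\<close> below the indicator of \<open>I\<close> that loses at most \<open>\<delta>\<close> per step shows that after \<open>t\<close> steps the
  walk is in \<open>I\<close> with probability at least \<open>1 - t \<delta>\<close>. This plays the role of a maximal inequality for the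
  displacement.
\<close>

lemma tv_ge_confined:
  assumes I: "I \<subseteq> V" and x: "x \<in> V" and drift: "\<And>y. y \<in> V \<Longrightarrow> h y - \<delta> \<le> step h y"
    and h: "h x = 1" "\<And>y. y \<in> V \<Longrightarrow> h y \<le> of_bool (y \<in> I)"
    and t: "real t * \<delta> \<le> 1/8" and small: "(\<Sum>v\<in>I. d v) \<le> real (card V) / 8"
  shows "1/4 < tv_dist V (pmf (lazy_walk E t x)) (stationary V E)"
proof -
  define \<mu> where "\<mu> = pmf (lazy_walk E t x)"
  have fI: "finite I" using I finite_V finite_subset by blast
  have "7/8 \<le> stp t h x" using drift_lower_bound[OF drift x, of t] h t by simp
  also have "\<dots> = (\<Sum>y\<in>V. \<mu> y * h y)" unfolding \<mu>_def by (rule walk_stp[OF x, symmetric])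
  also have "\<dots> \<le> (\<Sum>y\<in>V. \<mu> y * of_bool (y \<in> I))" using h(2) by (intro sum_mono mult_left_mono) (auto simp: \<mu>_def)
  also have "\<dots> = (\<Sum>y\<in>I. \<mu> y)" using I finite_V by (intro sum.mono_neutral_cong_right) auto
  finally have \<mu>: "7/8 \<le> (\<Sum>y\<in>I. \<mu> y)" .
  have \<pi>: "(\<Sum>y\<in>I. stationary V E y) \<le> 1/8"
  proof -
    have "(\<Sum>x\<in>V. 1) \<le> (\<Sum>x\<in>V. d x)" by (intro sum_mono d_ge1)
    then have "real (card V) / 8 \<le> 1/8 * (\<Sum>x\<in>V. d x)" by simp
    then have "(\<Sum>v\<in>I. d v) \<le> 1/8 * (\<Sum>x\<in>V. d x)" using small by linarith
    then have "(\<Sum>v\<in>I. d v) / (\<Sum>x\<in>V. d x) \<le> 1/8" using vol_pos by (simp only: pos_divide_le_eq)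
    then show ?thesis by (simp add: stationary_eq sum_divide_distrib)
  qed
  have "(\<Sum>y\<in>I. \<mu> y) - (\<Sum>y\<in>I. stationary V E y) \<le> (\<Sum>y\<in>I. \<bar>\<mu> y - stationary V E y\<bar>)"
    unfolding sum_subtractf[symmetric] by (intro sum_mono) auto
  also have "\<dots> \<le> (\<Sum>y\<in>V. \<bar>\<mu> y - stationary V E y\<bar>)" using I finite_V by (intro sum_mono2) auto
  finally show ?thesis using \<mu> \<pi> unfolding tv_dist_def \<mu>_def by simp
qed

end

lemma ring_neighbours_interior:
  assumes "k < y" "y + k \<le> n" "1 \<le> k"
  shows "neighbours (ring_edges n k) y = (\<lambda>l. y + l) ` {1..k} \<union> (\<lambda>l. y - l) ` {1..k}"
proof (intro equalityI subsetI)
  fix w assume "w \<in> neighbours (ring_edges n k) y"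
  then obtain l where l: "l \<in> {1..k}" "[w = y + l] (mod n) \<or> [y = w + l] (mod n)" and w: "w \<in> {1..n}"
    by (auto simp: neighbours_def ring_edge_iff)
  from l(2) show "w \<in> (\<lambda>l. y + l) ` {1..k} \<union> (\<lambda>l. y - l) ` {1..k}"
  proof
    assume "[w = y + l] (mod n)"
    then have "w = y + l" by (rule cong_interval_unique) (use w l assms in auto)
    then show ?thesis using l by auto
  next
    assume "[y = w + l] (mod n)"
    then have "[(y - l) + l = w + l] (mod n)" using l assms by auto
    then have "[y - l = w] (mod n)" by (simp only: cong_add_rcancel_nat)
    then have "y - l = w" by (rule cong_interval_unique) (use w l assms in auto)
    then show ?thesis using l by auto
  qed
next
  fix w assume "w \<in> (\<lambda>l. y + l) ` {1..k} \<union> (\<lambda>l. y - l) ` {1..k}"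
  then obtain l where l: "l \<in> {1..k}" "w = y + l \<or> w = y - l" by blast
  then have "{y, w} \<in> ring_edges n k" unfolding ring_edge_iff using assms by (auto intro!: bexI[of _ l])
  then show "w \<in> neighbours (ring_edges n k) y" by (simp add: neighbours_def)
qed

lemma sum_ring_neighbours:
  fixes g :: "nat \<Rightarrow> real"
  assumes "k < y" "y + k \<le> n" "1 \<le> k"
  shows "(\<Sum>w\<in>neighbours (ring_edges n k) y. g w) = (\<Sum>l\<in>{1..k}. g (y + l) + g (y - l))"
proof -
  have "(\<Sum>w\<in>neighbours (ring_edges n k) y. g w) = (\<Sum>w\<in>(\<lambda>l. y + l) ` {1..k}. g w) + (\<Sum>w\<in>(\<lambda>l. y - l) ` {1..k}. g w)"
    unfolding ring_neighbours_interior[OF assms] using assms by (intro sum.union_disjoint) auto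
  also have "(\<Sum>w\<in>(\<lambda>l. y + l) ` {1..k}. g w) = (\<Sum>l\<in>{1..k}. g (y + l))"
    by (subst sum.reindex) (auto simp: inj_on_def)
  also have "(\<Sum>w\<in>(\<lambda>l. y - l) ` {1..k}. g w) = (\<Sum>l\<in>{1..k}. g (y - l))"
    using assms by (subst sum.reindex) (auto simp: inj_on_def)
  finally show ?thesis by (simp add: sum.distrib)
qed

text \<open>
  On an interval without shortcuts the walk has symmetric jumps of length at most \<open>k\<close>, so the parabola
  \<open>1 - (y - x)\<^sup>2 / (L + 1)\<^sup>2\<close>, cut off at 0, loses at most \<open>k\<^sup>2 / (L + 1)\<^sup>2\<close> per step.
\<close>

lemma clean_interval_mixing:
  assumes k: "1 \<le> k" and I: "k + L < x" "x + L + k \<le> n"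
    and clean: "\<And>e. e \<in> ring_nonedges n k \<Longrightarrow> X e \<Longrightarrow> e \<inter> {x - L..x + L} = {}"
    and n: "16 * k * (2 * L + 1) \<le> n"
    and t: "8 * real t * (real k)\<^sup>2 \<le> (real L + 1)\<^sup>2"
  shows "1/4 < tv_dist {1..n} (pmf (lazy_walk (small_world n k X) t x)) (stationary {1..n} (small_world n k X))"
proof -
  let ?E = "small_world n k X"
  interpret connected_graph "{1..n}" ?E by (rule small_world_connected) (use k n in auto)
  define q where "q w = 1 - (real w - real x)\<^sup>2 / (real L + 1)\<^sup>2" for w
  define h where "h w = max 0 (q w)" for w
  define \<delta> where "\<delta> = (real k)\<^sup>2 / (real L + 1)\<^sup>2"
  define J where "J = {x - L..x + L}"
  have JV: "J \<subseteq> {1..n}" using I by (auto simp: J_def)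
  have nbJ: "nb y = neighbours (ring_edges n k) y" if "y \<in> J" for y
    using clean that by (fastforce simp: neighbours_def small_world_def J_def)
  have yb: "k < y" "y + k \<le> n" if "y \<in> J" for y using that I by (auto simp: J_def)
  have dJ: "d y = 2 * real k" if "y \<in> J" for y
  proof -
    have "d y = (\<Sum>w\<in>neighbours (ring_edges n k) y. 1)" using nbJ[OF that] by (simp add: degree_def)
    also have "\<dots> = 2 * real k" unfolding sum_ring_neighbours[OF yb[OF that] k] by simp
    finally show ?thesis .
  qed
  have qJ: "0 \<le> q y" if "y \<in> J" for y
  proof -
    have "\<bar>real y - real x\<bar> \<le> real L + 1" using that by (auto simp: J_def)
    then have "(real y - real x)\<^sup>2 \<le> (real L + 1)\<^sup>2" using abs_le_square_iff[of "real y - real x" "real L + 1"] by simp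
    then show ?thesis by (simp add: q_def divide_le_eq)
  qed
  have q_off: "q y \<le> 0" if "y \<notin> J" for y
  proof -
    have "\<bar>real L + 1\<bar> \<le> \<bar>real y - real x\<bar>" using that by (auto simp: J_def abs_if)
    then have "(real L + 1)\<^sup>2 \<le> (real y - real x)\<^sup>2" by (simp only: abs_le_square_iff)
    then show ?thesis by (simp add: q_def le_divide_eq)
  qed
  have drift: "h y - \<delta> \<le> step h y" if "y \<in> {1..n}" for y
  proof (cases "y \<in> J")
    case False
    then have "h y = 0" using q_off by (auto simp: h_def)
    moreover have "0 \<le> step h y" by (intro step_nonneg) (simp add: h_def)
    moreover have "0 \<le> \<delta>" by (simp add: \<delta>_def)
    ultimately show ?thesis by linarith
  next
    case True
    have "2 * real k * (q y - \<delta>) = (\<Sum>l\<in>{1..k}. 2 * (q y - \<delta>))" by simp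
    also have "\<dots> \<le> (\<Sum>l\<in>{1..k}. h (y + l) + h (y - l))"
    proof (rule sum_mono)
      fix l assume l: "l \<in> {1..k}"
      have r: "real (y - l) = real y - real l" using l yb[OF True] by simp
      have parallelogram: "(a + e - z)\<^sup>2 + (a - e - z)\<^sup>2 = 2 * (a - z)\<^sup>2 + 2 * e\<^sup>2" for a e z :: real
        by (simp add: power2_eq_square algebra_simps)
      have "q (y + l) + q (y - l)
          = 2 - ((real y + real l - real x)\<^sup>2 + (real y - real l - real x)\<^sup>2) / (real L + 1)\<^sup>2"
        unfolding q_def r of_nat_add add_divide_distrib by simp
      also have "\<dots> = 2 * (q y - (real l)\<^sup>2 / (real L + 1)\<^sup>2)"
        unfolding parallelogram q_def add_divide_distrib by simp
      finally have "q (y + l) + q (y - l) = 2 * (q y - (real l)\<^sup>2 / (real L + 1)\<^sup>2)" .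
      then have sum_eq: "2 * (q y - (real l)\<^sup>2 / (real L + 1)\<^sup>2) = q (y + l) + q (y - l)" by (rule sym)
      have "(real l)\<^sup>2 / (real L + 1)\<^sup>2 \<le> \<delta>"
        unfolding \<delta>_def using l by (intro divide_right_mono power_mono) auto
      then have "2 * (q y - \<delta>) \<le> 2 * (q y - (real l)\<^sup>2 / (real L + 1)\<^sup>2)" by simp
      also have "\<dots> = q (y + l) + q (y - l)" by (rule sum_eq)
      also have "\<dots> \<le> h (y + l) + h (y - l)" unfolding h_def by (intro add_mono) auto
      finally show "2 * (q y - \<delta>) \<le> h (y + l) + h (y - l)" .
    qed
    also have "\<dots> = (\<Sum>w\<in>nb y. h w)" unfolding nbJ[OF True] by (rule sum_ring_neighbours[OF yb[OF True] k, symmetric])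
    finally have "(q y - \<delta>) \<le> (\<Sum>w\<in>nb y. h w) / d y" unfolding dJ[OF True] using k by (simp add: pos_le_divide_eq mult_ac)
    moreover have "h y = q y" using qJ[OF True] by (simp add: h_def)
    moreover have "0 \<le> \<delta>" by (simp add: \<delta>_def)
    moreover have avg: "a - e \<le> (a + A) / 2" if "a - e \<le> A" "0 \<le> e" for a e A :: real
      using that by (simp add: field_simps)
    ultimately show ?thesis unfolding step_def by (intro avg) simp_all
  qed
  show ?thesis
  proof (rule tv_ge_confined[OF JV _ drift])
    show "x \<in> {1..n}" using I by auto
    show "h x = 1" by (simp add: h_def q_def)
    show "h y \<le> of_bool (y \<in> J)" for y
      using q_off[of y] by (auto simp: h_def q_def)
    have "real t * (real k)\<^sup>2 / (real L + 1)\<^sup>2 \<le> 1/8" using t by (simp add: divide_le_eq)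
    then show "real t * \<delta> \<le> 1/8" by (simp add: \<delta>_def)
    have "(\<Sum>v\<in>J. d v) = (\<Sum>v\<in>J. 2 * real k)" by (intro sum.cong dJ) auto
    also have "\<dots> = real (card J) * (2 * real k)" by simp
    also have "card J = 2 * L + 1" using I by (simp add: J_def)
    finally have "8 * (\<Sum>v\<in>J. d v) = real (16 * k * (2 * L + 1))" by (simp add: algebra_simps)
    also have "\<dots> \<le> real n" using n by (simp only: of_nat_le_iff)
    finally show "(\<Sum>v\<in>J. d v) \<le> real (card {1..n}) / 8" by simp
  qed
qed

section \<open>Intervals without shortcuts exist\<close>

text \<open>
  Independence of the events \<open>\<exists>e\<in>Z i. X e\<close>, by inclusion-exclusion: removing one group \<open>Z i\<close> replaces
  the event by its difference with the event in which all of \<open>Z i\<close> is closed as well. The set \<open>C\<close> makes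
  the induction possible.
\<close>

lemma prob_groups_all_hit:
  assumes A: "finite A" and p: "0 \<le> p" "p \<le> 1" and I: "finite I"
    and Z: "\<And>i. i \<in> I \<Longrightarrow> Z i \<subseteq> A" and disj: "disjoint_family_on Z I"
    and C: "C \<subseteq> A" "\<And>i. i \<in> I \<Longrightarrow> Z i \<inter> C = {}"
  shows "measure_pmf.prob (independent_edges A p) {X. (\<forall>i\<in>I. \<exists>e\<in>Z i. X e) \<and> (\<forall>e\<in>C. \<not> X e)}
     = (\<Prod>i\<in>I. 1 - (1 - p) ^ card (Z i)) * (1 - p) ^ card C"
  using I Z disj C
proof (induction I arbitrary: C rule: finite_induct)
  case empty
  have fC: "finite C" using empty A finite_subset by blast
  have "measure_pmf.prob (independent_edges A p) {X. \<forall>e\<in>C. \<not> X e}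
      = measure_pmf.expectation (independent_edges A p) (indicator {X. \<forall>e\<in>C. \<not> X e})" by simp
  also have "(indicator {X. \<forall>e\<in>C. \<not> X e} :: _ \<Rightarrow> real) = (\<lambda>X. of_bool (\<forall>e\<in>{}. X e) * 0 ^ card {e\<in>C. X e})"
    using fC by (auto simp: indicator_def power_0_left fun_eq_iff)
  also have "measure_pmf.expectation (independent_edges A p) \<dots> = (1 - p) ^ card C"
    by (subst exponential_moment) (use A p empty in auto)
  finally show ?case by simp
next
  case (insert i I)
  let ?P = "measure_pmf.prob (independent_edges A p)"
  define R where "R C = {X. (\<forall>i\<in>I. \<exists>e\<in>Z i. X e) \<and> (\<forall>e\<in>C. \<not> X e)}" for C
  have dI: "disjoint_family_on Z I" using insert.prems(2) by (auto simp: disjoint_family_on_def)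
  have ii: "Z j \<inter> Z i = {}" if "j \<in> I" for j
    using insert.prems(2) insert.hyps(2) that by (auto simp: disjoint_family_on_def)
  have fin: "finite C" "finite (Z i)" using insert.prems A finite_subset by (meson insertI1)+
  have 1: "?P (R C) = (\<Prod>i\<in>I. 1 - (1 - p) ^ card (Z i)) * (1 - p) ^ card C"
    unfolding R_def using insert.prems dI by (intro insert.IH) auto
  have 2: "?P (R (C \<union> Z i)) = (\<Prod>i\<in>I. 1 - (1 - p) ^ card (Z i)) * (1 - p) ^ card (C \<union> Z i)"
    unfolding R_def
  proof (rule insert.IH[OF _ dI])
    show "Z j \<subseteq> A" if "j \<in> I" for j using insert.prems(1) that by auto
    show "C \<union> Z i \<subseteq> A" using insert.prems by auto
    show "Z j \<inter> (C \<union> Z i) = {}" if "j \<in> I" for j using insert.prems(4)[of j] ii[OF that] that by auto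
  qed
  have cU: "card (C \<union> Z i) = card C + card (Z i)" using fin insert.prems(4)[of i] by (intro card_Un_disjoint) auto
  have "{X. (\<forall>j\<in>insert i I. \<exists>e\<in>Z j. X e) \<and> (\<forall>e\<in>C. \<not> X e)} = R C - R (C \<union> Z i)"
    by (auto simp: R_def)
  then have "?P {X. (\<forall>j\<in>insert i I. \<exists>e\<in>Z j. X e) \<and> (\<forall>e\<in>C. \<not> X e)} = ?P (R C) - ?P (R (C \<union> Z i))"
    by (simp only:) (rule measure_pmf.finite_measure_Diff, auto simp: R_def)
  then show ?case unfolding 1 2 cU using insert.hyps by (simp add: power_add algebra_simps)
qed

lemma prob_many_open:
  assumes A: "finite A" and p: "0 \<le> p" "p \<le> 1" and Z: "Z \<subseteq> A" and l: "1 \<le> l"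
  shows "measure_pmf.prob (independent_edges A p) {X. a \<le> card {e\<in>Z. X e}} \<le> exp (p * l * real (card Z)) / l ^ a"
proof -
  have "measure_pmf.prob (independent_edges A p) {X. a \<le> card {e\<in>Z. X e}}
      \<le> measure_pmf.expectation (independent_edges A p) (\<lambda>X. (1 / l ^ a) * (of_bool (\<forall>e\<in>{}. X e) * l ^ card {e\<in>Z. X e}))"
  proof (intro prob_le_expectation finite_set_independent_edges A)
    fix X assume "X \<in> {X. a \<le> card {e\<in>Z. X e}}"
    then have "l ^ a \<le> l ^ card {e\<in>Z. X e}" using l by (intro power_increasing) auto
    then show "1 \<le> (1 / l ^ a) * (of_bool (\<forall>e\<in>{}. X e) * l ^ card {e\<in>Z. X e})" using l by simp
  qed (use l in auto)
  also have "\<dots> = (1 / l ^ a) * measure_pmf.expectation (independent_edges A p) (\<lambda>X. of_bool (\<forall>e\<in>{}. X e) * l ^ card {e\<in>Z. X e})"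
    by (rule integral_mult_right_zero)
  also have "\<dots> \<le> (1 / l ^ a) * (p ^ card ({} :: 'a set) * exp (p * (l - 1) * real (card Z)))"
    using A p Z l by (intro mult_left_mono exponential_moment_le) auto
  also have "\<dots> \<le> (1 / l ^ a) * exp (p * l * real (card Z))"
  proof -
    have "p * (l - 1) * real (card Z) \<le> p * l * real (card Z)" using p by (intro mult_right_mono mult_left_mono) auto
    then show ?thesis using l by (intro mult_left_mono) auto
  qed
  finally show ?thesis by simp
qed

text \<open>
  Take \<open>16 m\<close> disjoint intervals of length \<open>2 L + 1\<close>, in 16 groups of \<open>m\<close>, with union \<open>U\<close>. Shortcuts from
  different intervals to the complement of \<open>U\<close> are independent, so that every group contains an interval
  without them, up to the second term. Shortcuts inside \<open>U\<close> are so rare that fewer than 8 are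
  open, up to the first term; these touch fewer than 16 intervals and hence miss one of the 16 chosen ones.
\<close>

lemma shortcut_free_interval_prob:
  fixes n k L m :: nat and p l :: real
  assumes p: "0 \<le> p" "p \<le> 1" and l: "1 \<le> l" and fit: "2 * k + 16 * m * (2 * L + 1) \<le> n"
  shows "measure_pmf.prob (independent_edges (ring_nonedges n k) p)
     {X. \<not> (\<exists>x. k + L < x \<and> x + L + k \<le> n \<and> (\<forall>e\<in>ring_nonedges n k. X e \<longrightarrow> e \<inter> {x - L..x + L} = {}))}
    \<le> exp (p * l * (16 * real m * (2 * real L + 1))\<^sup>2) / l ^ 8
      + 16 * (1 - (1 - p) ^ ((2 * L + 1) * n)) ^ m"
proof -
  let ?NE = "ring_nonedges n k"
  let ?P = "measure_pmf.prob (independent_edges ?NE p)"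
  \<comment> \<open>the intervals keep distance \<open>k\<close> from both ends of \<open>{1..n}\<close>, so that no ring edge from them wraps around\<close>
  define W where "W = 2 * L + 1"
  define I where "I j = {k + j * W + 1..k + (j + 1) * W}" for j
  define U where "U = {k + 1..k + 16 * m * W}"
  define Z where "Z j = {e\<in>?NE. \<exists>u\<in>I j. \<exists>w\<in>{1..n} - U. e = {u, w}}" for j
  define Y where "Y = {e\<in>?NE. e \<subseteq> U}"
  have fit': "2 * k + 16 * m * W \<le> n" using fit by (simp add: W_def)
  have IU: "I j \<subseteq> U" if "j < 16 * m" for j
  proof -
    have "(j + 1) * W \<le> 16 * m * W" using that by (intro mult_le_mono1) auto
    then show ?thesis by (auto simp: I_def U_def)
  qed
  have UV: "U \<subseteq> {1..n}" using fit' by (auto simp: U_def)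
  have I_disj: "j = j'" if "u \<in> I j" "u \<in> I j'" for u j j'
  proof -
    have "(u - k - 1) div W = i" if "u \<in> I i" for i
      using that by (intro div_nat_eqI) (auto simp: I_def mult.commute W_def)
    then show ?thesis using that by metis
  qed
  have Zdisj: "disjoint_family_on Z {..<16 * m}"
    unfolding disjoint_family_on_def
  proof (intro ballI impI)
    fix j j' assume j: "j \<in> {..<16 * m}" "j' \<in> {..<16 * m}" "j \<noteq> j'"
    show "Z j \<inter> Z j' = {}"
    proof (rule ccontr)
      assume "Z j \<inter> Z j' \<noteq> {}"
      then obtain u w u' w' where e: "{u, w} = {u', w'}" "u \<in> I j" "w \<notin> U" "u' \<in> I j'" "w' \<notin> U"
        unfolding Z_def by blast
      then have "u = u'" using IU[of j] IU[of j'] j by (auto simp: doubleton_eq_iff)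
      then show False using I_disj e j by blast
    qed
  qed
  have cZ: "card (Z j) \<le> W * n" for j
  proof -
    have "Z j \<subseteq> (\<lambda>(u, w). {u, w}) ` (I j \<times> {1..n})" unfolding Z_def by auto
    then have "card (Z j) \<le> card (I j \<times> {1..n})" by (intro surj_card_le) (auto simp: I_def)
    also have "\<dots> = W * n" by (simp add: card_cartesian_product I_def)
    finally show ?thesis .
  qed
  have cY: "card Y \<le> (16 * m * W)\<^sup>2"
  proof -
    have "Y \<subseteq> (\<lambda>(u, w). {u, w}) ` (U \<times> U)"
    proof
      fix e assume "e \<in> Y"
      then have "e \<subseteq> U" "card e = 2" using nonedge_pair by (auto simp: Y_def)
      then obtain u w where "e = {u, w}" by (auto simp: card_2_iff)
      moreover from this have "(u, w) \<in> U \<times> U" using \<open>e \<subseteq> U\<close> by simp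
      ultimately show "e \<in> (\<lambda>(u, w). {u, w}) ` (U \<times> U)"
        using imageI[of "(u, w)" "U \<times> U" "\<lambda>(u, w). {u, w}"] by simp
    qed
    then have "card Y \<le> card (U \<times> U)" by (intro surj_card_le) (auto simp: U_def)
    also have "\<dots> = (16 * m * W)\<^sup>2" by (simp add: card_cartesian_product U_def power2_eq_square)
    finally show ?thesis .
  qed
  define B0 where "B0 = {X. 8 \<le> card {e\<in>Y. X e}}"
  define B where "B g = {X. \<forall>j\<in>{g * m..<(g + 1) * m}. \<exists>e\<in>Z j. X e}" for g
  have "{X. \<not> (\<exists>x. k + L < x \<and> x + L + k \<le> n \<and> (\<forall>e\<in>?NE. X e \<longrightarrow> e \<inter> {x - L..x + L} = {}))} \<subseteq> B0 \<union> (\<Union>g\<in>{..<16}. B g)"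
  proof (rule subsetI, rule ccontr)
    fix X assume no: "X \<in> {X. \<not> (\<exists>x. k + L < x \<and> x + L + k \<le> n \<and> (\<forall>e\<in>?NE. X e \<longrightarrow> e \<inter> {x - L..x + L} = {}))}"
      and nB: "X \<notin> B0 \<union> (\<Union>g\<in>{..<16}. B g)"
    have "\<forall>g\<in>{..<16}. \<exists>j. j \<in> {g * m..<(g + 1) * m} \<and> (\<forall>e\<in>Z j. \<not> X e)"
    proof
      fix g :: nat assume "g \<in> {..<16}"
      then have "X \<notin> B g" using nB by blast
      then show "\<exists>j. j \<in> {g * m..<(g + 1) * m} \<and> (\<forall>e\<in>Z j. \<not> X e)" unfolding B_def by blast
    qed
    from bchoice[OF this] obtain J where
      "\<forall>g\<in>{..<16}. J g \<in> {g * m..<(g + 1) * m} \<and> (\<forall>e\<in>Z (J g). \<not> X e)" by blast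
    then have J: "\<And>g. g < 16 \<Longrightarrow> J g \<in> {g * m..<(g + 1) * m}" "\<And>g e. g < 16 \<Longrightarrow> e \<in> Z (J g) \<Longrightarrow> \<not> X e"
      by blast+
    have Jm: "J g < 16 * m" if "g < 16" for g
    proof -
      have "J g < (g + 1) * m" using J(1)[OF that] by simp
      also have "\<dots> \<le> 16 * m" using that by (intro mult_le_mono1) auto
      finally show ?thesis .
    qed
    have hitU: "\<exists>u. u \<in> I (J g) \<and> u \<in> \<Union>{e\<in>Y. X e}" if g: "g < 16" for g
    proof -
      define x where "x = k + J g * W + L + 1"
      have Ix: "{x - L..x + L} = I (J g)" by (auto simp: x_def I_def W_def)
      have "(J g + 1) * W \<le> 16 * m * W" using Jm[OF g] by (intro mult_le_mono1) auto
      then have "k + L < x" "x + L + k \<le> n" using fit' by (auto simp: x_def W_def algebra_simps)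
      then have "\<not> (\<forall>e\<in>?NE. X e \<longrightarrow> e \<inter> I (J g) = {})" using no unfolding Ix[symmetric] by blast
      then obtain e u where e: "e \<in> ?NE" "X e" "u \<in> e" "u \<in> I (J g)" by auto
      have "e \<subseteq> {1..n}" "card e = 2" using e(1) nonedge_pair by auto
      then obtain a b where "e = {a, b}" by (auto simp: card_2_iff)
      then have "e = {u, a} \<or> e = {u, b}" using e(3) by auto
      then obtain w where w: "e = {u, w}" "w \<in> {1..n}" using \<open>e \<subseteq> {1..n}\<close> by blast
      have "w \<in> U"
      proof (rule ccontr)
        assume "w \<notin> U"
        then have "e \<in> Z (J g)" using e w unfolding Z_def by blast
        then show False using J(2)[OF g] e by blast
      qed
      then have "e \<in> {e\<in>Y. X e}" using e w IU[OF Jm[OF g]] by (auto simp: Y_def)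
      then show ?thesis using e by blast
    qed
    define u where "u g = (SOME u. u \<in> I (J g) \<and> u \<in> \<Union>{e\<in>Y. X e})" for g
    have u: "u g \<in> I (J g)" "u g \<in> \<Union>{e\<in>Y. X e}" if "g < 16" for g
      using someI_ex[OF hitU[OF that]] unfolding u_def by blast+
    have fY: "finite {e\<in>Y. X e}" unfolding Y_def using finite_nonedges[of n k] by simp
    have fUY: "finite (\<Union>{e\<in>Y. X e})"
      by (rule finite_subset[of _ U]) (auto simp: Y_def U_def)
    have "inj_on u {..<16}"
    proof (rule inj_onI)
      fix g g' assume g: "g \<in> {..<16}" "g' \<in> {..<16}" "u g = u g'"
      then have eq: "J g = J g'" using u(1)[of g] u(1)[of g'] I_disj by auto
      have quot: "J h div m = h" if "h < 16" for h
      proof -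
        have "h * m \<le> J h" "J h < (h + 1) * m" using J(1)[OF that] by simp_all
        then show ?thesis by (intro div_nat_eqI) (simp_all add: mult.commute)
      qed
      show "g = g'" using quot[of g] quot[of g'] g(1,2) unfolding eq by simp
    qed
    moreover have fin_e: "finite e" if "e \<in> {e\<in>Y. X e}" for e
      using that by (intro finite_subset[of e U]) (auto simp: Y_def U_def)
    ultimately have "card {..<16::nat} \<le> card (\<Union>{e\<in>Y. X e})"
      using u(2) by (intro card_inj_on_le[OF _ _ fUY]) auto
    also have "\<dots> \<le> (\<Sum>e\<in>{e\<in>Y. X e}. card e)" 
      by (rule card_Union_le_sum_card_weak) (use fin_e in blast)
    also have "\<dots> = (\<Sum>e\<in>{e\<in>Y. X e}. 2)" using nonedge_pair by (intro sum.cong) (auto simp: Y_def)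
    also have "\<dots> = 2 * card {e\<in>Y. X e}" by simp
    finally have "8 \<le> card {e\<in>Y. X e}" by simp
    then show False using nB by (simp add: B0_def)
  qed
  then have "?P {X. \<not> (\<exists>x. k + L < x \<and> x + L + k \<le> n \<and> (\<forall>e\<in>?NE. X e \<longrightarrow> e \<inter> {x - L..x + L} = {}))} \<le> ?P (B0 \<union> (\<Union>g\<in>{..<16}. B g))"
    by (intro measure_pmf.finite_measure_mono) auto
  also have "\<dots> \<le> ?P B0 + ?P (\<Union>g\<in>{..<16}. B g)" by (intro measure_Un_le) auto
  also have "?P (\<Union>g\<in>{..<16}. B g) \<le> (\<Sum>g\<in>{..<16}. ?P (B g))"
    by (intro measure_pmf.finite_measure_subadditive_finite) auto
  also have "\<dots> \<le> (\<Sum>g\<in>{..<16::nat}. (1 - (1 - p) ^ (W * n)) ^ m)"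
  proof (rule sum_mono)
    fix g :: nat assume g: "g \<in> {..<16}"
    have sub: "{g * m..<(g + 1) * m} \<subseteq> {..<16 * m}"
    proof
      fix j assume "j \<in> {g * m..<(g + 1) * m}"
      then have "j < (g + 1) * m" by simp
      also have "\<dots> \<le> 16 * m" using g by (intro mult_le_mono1) auto
      finally show "j \<in> {..<16 * m}" by simp
    qed
    have dj: "disjoint_family_on Z {g * m..<(g + 1) * m}"
      using Zdisj sub by (rule disjoint_family_on_mono[rotated])
    have "?P (B g) = ?P {X. (\<forall>j\<in>{g * m..<(g + 1) * m}. \<exists>e\<in>Z j. X e) \<and> (\<forall>e\<in>{}. \<not> X e)}" by (simp add: B_def)
    also have "\<dots> = (\<Prod>j\<in>{g * m..<(g + 1) * m}. 1 - (1 - p) ^ card (Z j)) * (1 - p) ^ card ({} :: nat set set)"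
      by (rule prob_groups_all_hit[OF finite_nonedges p _ _ dj]) (auto simp: Z_def)
    also have "\<dots> \<le> (\<Prod>j\<in>{g * m..<(g + 1) * m}. 1 - (1 - p) ^ (W * n))"
    proof -
      have "1 - (1 - p) ^ card (Z j) \<le> 1 - (1 - p) ^ (W * n)" "0 \<le> 1 - (1 - p) ^ card (Z j)" for j
        using p cZ[of j] by (auto intro!: power_decreasing power_le_one)
      then have "(\<Prod>j\<in>{g * m..<(g + 1) * m}. 1 - (1 - p) ^ card (Z j)) \<le> (\<Prod>j\<in>{g * m..<(g + 1) * m}. 1 - (1 - p) ^ (W * n))"
        by (intro prod_mono conjI)
      then show ?thesis unfolding card.empty power_0 mult_1_right .
    qed
    also have "\<dots> = (1 - (1 - p) ^ (W * n)) ^ m" by simp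
    finally show "?P (B g) \<le> (1 - (1 - p) ^ (W * n)) ^ m" .
  qed
  also have "?P B0 \<le> exp (p * l * real (card Y)) / l ^ 8"
    unfolding B0_def by (rule prob_many_open[OF finite_nonedges p _ l]) (auto simp: Y_def)
  also have "\<dots> \<le> exp (p * l * (16 * real m * (2 * real L + 1))\<^sup>2) / l ^ 8"
  proof (intro divide_right_mono)
    have "real (card Y) \<le> real ((16 * m * W)\<^sup>2)" using cY by (simp only: of_nat_le_iff)
    also have "\<dots> = (real (16 * m * W))\<^sup>2" by (rule of_nat_power)
    also have "real (16 * m * W) = 16 * real m * (2 * real L + 1)" by (simp add: W_def algebra_simps)
    finally show "exp (p * l * real (card Y)) \<le> exp (p * l * (16 * real m * (2 * real L + 1))\<^sup>2)"
      using p l by (simp add: mult_left_mono)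
  qed (use l in auto)
  finally show ?thesis by (simp add: W_def)
qed

section \<open>Mixing time of the small world\<close>

context connected_graph begin

lemma V_internally_connected: "internally_connected E V"
  unfolding internally_connected_def using cut by blast

text \<open>
  Every connected graph mixes in polynomial time. Besides serving the exceptional event in the
  expectation, this shows that the times whose minimum defines the mixing time exist.
\<close>

lemma crude_mixing:
  obtains t where "real t \<le> 2400 * real (card V) ^ 5"
    "\<And>x. x \<in> V \<Longrightarrow> tv_dist V (pmf (lazy_walk E t x)) (stationary V E) \<le> 1/4"
proof -
  have d_le: "d x \<le> real (card V)" for x
    unfolding degree_def using card_mono[OF finite_V nb_sub] by simp
  then have "vol E V \<le> (\<Sum>x\<in>V. real (card V))" unfolding vol_def by (intro sum_mono)
  then have v2: "vol E V \<le> real (card V) * real (card V)" by simp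
  have "(\<Sum>x\<in>V. 1) \<le> vol E V" unfolding vol_def by (intro sum_mono d_ge1)
  then have v1: "1 \<le> vol E V" using card_V by simp
  have n1: "1 \<le> real (card V)" using card_V by simp
  have "1 \<le> (vol E V)\<^sup>2" using v1 by simp
  then have K1: "1 \<le> 2 * (vol E V)\<^sup>2" by simp
  obtain t where t: "real t \<le> 1200 * real (card V) * (2 * (vol E V)\<^sup>2)"
    "\<And>x. x \<in> V \<Longrightarrow> tv_dist V (pmf (lazy_walk E t x)) (stationary V E) \<le> 1/4"
    using mixing_from_hitting[OF hitting_crude K1 n1] v2 unfolding vol_V by metis
  have "(vol E V)\<^sup>2 \<le> (real (card V) * real (card V))\<^sup>2" using v1 v2 by (intro power_mono) auto
  then have "1200 * real (card V) * (2 * (vol E V)\<^sup>2) \<le> 1200 * real (card V) * (2 * (real (card V) * real (card V))\<^sup>2)"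
    by (intro mult_left_mono) auto
  also have "\<dots> = 2400 * real (card V) ^ 5" by (simp add: power2_eq_square power_numeral_reduce)
  finally show ?thesis using t by (intro that[of t]) auto
qed

end

lemma mixing_time_crude:
  assumes "1 \<le> k" "2 \<le> n"
  shows "real (mixing_time {1..n} (small_world n k X)) \<le> 2400 * real n ^ 5"
proof -
  interpret connected_graph "{1..n}" "small_world n k X" by (rule small_world_connected[OF assms])
  obtain t where t: "real t \<le> 2400 * real (card {1..n}) ^ 5"
    "\<And>x. x \<in> {1..n} \<Longrightarrow> tv_dist {1..n} (pmf (lazy_walk (small_world n k X) t x)) (stationary {1..n} (small_world n k X)) \<le> 1/4"
    using crude_mixing by blast
  have "mixing_time {1..n} (small_world n k X) \<le> t" by (rule mixing_time_le[OF t(2)])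
  then have "real (mixing_time {1..n} (small_world n k X)) \<le> real t" by simp
  also have "\<dots> \<le> 2400 * real n ^ 5" using t(1) by simp
  finally show ?thesis .
qed

lemma mixing_time_lower:
  assumes k: "1 \<le> k" and n: "16 * k * (2 * L + 1) \<le> n"
    and ex: "\<exists>x. k + L < x \<and> x + L + k \<le> n \<and> (\<forall>e\<in>ring_nonedges n k. X e \<longrightarrow> e \<inter> {x - L..x + L} = {})"
  shows "(real L + 1)\<^sup>2 / (8 * (real k)\<^sup>2) \<le> real (mixing_time {1..n} (small_world n k X))"
proof -
  have "2 \<le> n" using k n by (cases k) auto
  interpret connected_graph "{1..n}" "small_world n k X" by (rule small_world_connected[OF k \<open>2 \<le> n\<close>])
  obtain t where t: "\<And>x. x \<in> {1..n} \<Longrightarrow> tv_dist {1..n} (pmf (lazy_walk (small_world n k X) t x)) (stationary {1..n} (small_world n k X)) \<le> 1/4"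
    using crude_mixing by blast
  obtain x where x: "k + L < x" "x + L + k \<le> n" "\<And>e. e \<in> ring_nonedges n k \<Longrightarrow> X e \<Longrightarrow> e \<inter> {x - L..x + L} = {}"
    using ex by blast
  \<comment> \<open>before time \<open>s\<close> the walk from the midpoint has hardly left the interval\<close>
  define s where "s = nat \<lceil>(real L + 1)\<^sup>2 / (8 * (real k)\<^sup>2)\<rceil>"
  have "s \<le> mixing_time {1..n} (small_world n k X)"
  proof (rule mixing_time_ge[OF t])
    show "x \<in> {1..n}" using x by auto
    fix r assume "r < s"
    then have "real r < (real L + 1)\<^sup>2 / (8 * (real k)\<^sup>2)" unfolding s_def by linarith
    then have "8 * real r * (real k)\<^sup>2 \<le> (real L + 1)\<^sup>2" using k by (simp add: pos_less_divide_eq mult_ac)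
    then show "1/4 < tv_dist {1..n} (pmf (lazy_walk (small_world n k X) r x)) (stationary {1..n} (small_world n k X))"
      by (intro clean_interval_mixing[OF k x(1,2) x(3) n]) auto
  qed
  then have "real s \<le> real (mixing_time {1..n} (small_world n k X))" by simp
  moreover have "(real L + 1)\<^sup>2 / (8 * (real k)\<^sup>2) \<le> real s" unfolding s_def by linarith
  ultimately show ?thesis by linarith
qed

text \<open>
  Here \<open>L0 = Q s0\<close> and \<open>\<phi>\<close> is constant, so that \<open>s0\<^sup>2\<close> and the number \<open>J\<close> of dyadic scales are
  added and not multiplied.
\<close>

lemma (in blocks) mixing_time_good:
  assumes g: "good m s0 X" and nk: "16 * k \<le> n" and s0: "1 \<le> s0" "s0 \<le> n" and J: "real n \<le> 2 ^ J"
    and Q: "Q = real (4 * k * b + 2 * m)"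
  shows "real (mixing_time {1..n} (small_world n k X)) \<le> 1200 * Q ^ 3 * (2 * (real s0)\<^sup>2 + 1024 * real J)"
proof -
  let ?E = "small_world n k X"
  have n2: "2 \<le> n" using nk k1 by linarith
  interpret connected_graph "{1..n}" ?E by (rule small_world_connected[OF k1 n2])
  have "1 * 1 \<le> k * b" using k1 b1 by (intro mult_le_mono)
  then have "4 * (1 * 1) \<le> 4 * (k * b)" by (rule mult_le_mono2)
  also have "\<dots> \<le> 4 * k * b + 2 * m" by (simp only: mult.assoc le_add1)
  finally have Q4: "4 \<le> Q" unfolding Q by linarith
  have vol: "vol ?E {1..n} \<le> Q * real n"
  proof -
    have "vol ?E {1..n} \<le> Q * real (max (card (bl ` {1..n})) s0)"
      unfolding Q by (rule vol_le_good[OF g _ _ V_internally_connected]) (use n2 in auto)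
    also have "max (card (bl ` {1..n})) s0 \<le> n"
      using s0 card_image_le[of "{1..n}" bl] by simp
    then have "Q * real (max (card (bl ` {1..n})) s0) \<le> Q * real n" using Q4 by (intro mult_left_mono) auto
    finally show ?thesis .
  qed
  define K where "K = 2 * (Q * real s0)\<^sup>2 + 4 * real J / (1 / (16 * Q))\<^sup>2"
  have hit: "hitting_bound K" unfolding K_def
  proof (rule hitting_from_isoperimetry)
    show "0 < Q * real s0" "0 < 1 / (16 * Q)" using Q4 s0 by auto
    have "Q * real n \<le> Q * (2 ^ J * real s0)"
    proof (rule mult_left_mono)
      have "2 ^ J * 1 \<le> 2 ^ J * real s0" using s0 by (intro mult_left_mono) auto
      then show "real n \<le> 2 ^ J * real s0" using J by linarith
    qed (use Q4 in simp)
    then show "vol ?E {1..n} \<le> 2 ^ J * (Q * real s0)" using vol by (simp add: mult_ac)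
    fix S assume S: "S \<subseteq> {1..n}" "S \<noteq> {}" "internally_connected ?E S" "2 * card S \<le> card {1..n}" "Q * real s0 < vol ?E S"
    then show "1 / (16 * Q) * vol ?E S \<le> real (boundary ?E S)"
      unfolding Q by (intro isoperimetry_good[OF g nk]) auto
  qed
  have K: "K = Q\<^sup>2 * (2 * (real s0)\<^sup>2 + 1024 * real J)"
    unfolding K_def using Q4 by (simp add: power2_eq_square field_simps)
  have "1 * 1 \<le> Q\<^sup>2 * (2 * (real s0)\<^sup>2 + 1024 * real J)"
  proof (rule mult_mono)
    show "1 \<le> Q\<^sup>2" using Q4 by simp
    have "1 \<le> (real s0)\<^sup>2" using s0 by simp
    then show "1 \<le> 2 * (real s0)\<^sup>2 + 1024 * real J" by (simp add: add_increasing2)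
  qed auto
  then have K1: "1 \<le> K" by (simp add: K)
  have Q1: "1 \<le> Q" using Q4 by simp
  have volr: "(\<Sum>x\<in>{1..n}. d x) \<le> Q * real (card {1..n})" using vol by (simp add: vol_def)
  obtain t where t: "real t \<le> 1200 * Q * K"
    "\<And>x. x \<in> {1..n} \<Longrightarrow> tv_dist {1..n} (pmf (lazy_walk ?E t x)) (stationary {1..n} ?E) \<le> 1/4"
    using mixing_from_hitting[OF hit K1 Q1 volr] by blast
  have "mixing_time {1..n} ?E \<le> t" by (rule mixing_time_le[OF t(2)])
  then have "real (mixing_time {1..n} ?E) \<le> 1200 * Q * K" using t(1) by linarith
  then show ?thesis by (simp add: K power2_eq_square power3_eq_cube mult_ac)
qed

lemma newman_watts_eq:
  "newman_watts n k p = map_pmf (small_world n k) (independent_edges (ring_nonedges n k) p)"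
  by (simp add: newman_watts_def small_world_def[abs_def] independent_edges_def)

text \<open>
  The block length \<open>b\<close> and the bound \<open>m\<close> are constants depending on \<open>c\<close> and \<open>k\<close>; families of
  \<open>s0 \<approx> 8 log n\<close> blocks make the probability \<open>2 n\<^sup>2 exp (- s0)\<close> of a bad event as small as \<open>2 / n\<^sup>6\<close>, which
  the crude bound \<open>2400 n\<^sup>5\<close> of the mixing time requires.
\<close>

lemma upper_bound_whp:
  fixes c :: real assumes k: "1 \<le> k" and c: "0 < c"
  obtains C n0 where "0 < C"
    "\<And>n. n0 \<le> n \<Longrightarrow> measure_pmf.prob (independent_edges (ring_nonedges n k) (c / real n))
      {X. \<not> real (mixing_time {1..n} (small_world n k X)) \<le> C * (ln (real n))\<^sup>2} \<le> 2 / real n ^ 6"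
proof -
  have "((\<lambda>b::nat. 4 * (2 + 2 * real b * c) * (2 * exp 1) * exp (- (c * real b / 16))) \<longlongrightarrow> 0) at_top"
    using c by real_asymp
  then have "eventually (\<lambda>b::nat. 4 * (2 + 2 * real b * c) * (2 * exp 1) * exp (- (c * real b / 16)) < exp (-1)) at_top"
    by (rule order_tendstoD(2)) simp
  then obtain b where b: "k \<le> b" "4 * (2 + 2 * real b * c) * (2 * exp 1) * exp (- (c * real b / 16)) < exp (-1)"
    unfolding eventually_at_top_linorder by (meson linear order_trans)
  define m where "m = nat \<lceil>ln (4 * (2 + 2 * real b * c)) + 2 + 4 * (c * real b)\<rceil>"
  define Q where "Q = real (4 * k * b + 2 * m)"
  define C where "C = 1200 * Q ^ 3 * 3234 + 1"
  have "eventually (\<lambda>x::real. 9 * ln x \<le> x) at_top" by real_asymp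
  then obtain x0 :: real where x0: "\<And>x. x0 \<le> x \<Longrightarrow> 9 * ln x \<le> x" unfolding eventually_at_top_linorder by blast
  define n0 where "n0 = b + 16 * k + 3 + nat \<lceil>c\<rceil> + nat \<lceil>x0\<rceil>"
  have Q0: "0 \<le> Q" by (simp add: Q_def)
  then have C0: "0 < C" unfolding C_def by (intro add_nonneg_pos) auto
  show ?thesis
  proof (rule that[OF C0])
    fix n assume n: "n0 \<le> n"
    have big: "b \<le> n" "16 * k \<le> n" "3 \<le> n" using n by (auto simp: n0_def)
    have nc: "c \<le> real n" "x0 \<le> real n"
      using n real_nat_ceiling_ge[of c] real_nat_ceiling_ge[of x0] by (auto simp: n0_def simp flip: of_nat_le_iff)
    define p where "p = c / real n"
    have pn: "p * real n = c" using big by (simp add: p_def)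
    have p01: "0 \<le> p" "p \<le> 1" using c nc big by (auto simp: p_def)
    interpret blocks n k b p by unfold_locales (use k b big p01 in auto)
    have br: "branching = 2 + 2 * real b * c" unfolding branching_def using pn by (simp add: mult.commute mult.left_commute)
    define s0 where "s0 = nat \<lceil>8 * ln (real n)\<rceil>"
    have "exp 1 \<le> real n" using exp_le big by linarith
    then have ln1: "1 \<le> ln (real n)" using big by (subst ln_ge_iff) auto
    have s0: "8 * ln (real n) \<le> real s0" "real s0 \<le> 9 * ln (real n)" using ln1 unfolding s0_def by linarith+
    have s01: "1 \<le> s0" using s0 ln1 by linarith
    have s0n: "s0 \<le> n" using s0(2) x0[OF nc(2)] by linarith
    define J where "J = nat \<lceil>ln (real n) / ln 2\<rceil>"
    have J1: "ln (real n) / ln 2 \<le> real J" unfolding J_def by linarith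
    have J2: "real J \<le> 3 * ln (real n)"
    proof -
      have "ln (real n) / ln 2 \<le> ln (real n) / (2/3)" using ln1 ln2_ge_two_thirds by (intro divide_left_mono) auto
      also have "ln (real n) / (2/3) \<le> 2 * ln (real n)" using ln1 by simp
      finally have "ln (real n) / ln 2 \<le> 2 * ln (real n)" .
      moreover have "0 \<le> ln (real n) / ln 2" using ln1 by simp
      ultimately show ?thesis unfolding J_def using ln1 by linarith
    qed
    have J3: "real n \<le> 2 ^ J"
    proof -
      have "ln (real n) \<le> real J * ln 2" using J1 by (simp add: pos_divide_le_eq)
      then have "exp (ln (real n)) \<le> exp (real J * ln 2)" by simp
      then show ?thesis using big by (simp add: exp_of_nat_mult)
    qed
    have det: "real (mixing_time {1..n} (small_world n k X)) \<le> C * (ln (real n))\<^sup>2" if "good m s0 X" for X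
    proof -
      have "(real s0)\<^sup>2 \<le> (9 * ln (real n))\<^sup>2" using s0 by (intro power_mono) auto
      moreover have "ln (real n) \<le> (ln (real n))\<^sup>2" using ln1 by (simp add: power2_eq_square)
      ultimately have "2 * (real s0)\<^sup>2 + 1024 * real J \<le> 3234 * (ln (real n))\<^sup>2"
        using J2 by (simp add: power_mult_distrib)
      then have "1200 * Q ^ 3 * (2 * (real s0)\<^sup>2 + 1024 * real J) \<le> 1200 * Q ^ 3 * (3234 * (ln (real n))\<^sup>2)"
        using Q0 by (intro mult_left_mono) auto
      also have "\<dots> \<le> C * (ln (real n))\<^sup>2" unfolding C_def by (simp add: distrib_right)
      finally show ?thesis using mixing_time_good[OF that big(2) s01 s0n J3 Q_def] by linarith
    qed
    have "measure_pmf.prob \<P> {X. \<not> real (mixing_time {1..n} (small_world n k X)) \<le> C * (ln (real n))\<^sup>2}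
        \<le> measure_pmf.prob \<P> {X. \<not> good m s0 X}"
      using det by (intro measure_pmf.finite_measure_mono) auto
    also have "\<dots> \<le> 2 * (real n)\<^sup>2 * exp (- real s0)"
    proof (rule prob_not_good)
      show "4 * branching * (2 * exp 1) * exp (- (p * real n * real b / 16)) \<le> exp (-1)"
        unfolding br pn using b(2) by simp
      show "ln (4 * branching) + 2 + 4 * (p * real n * real b) \<le> real m"
        unfolding br pn m_def by linarith
    qed
    also have "\<dots> \<le> 2 * (real n)\<^sup>2 * (1 / real n ^ 8)"
    proof (rule mult_left_mono)
      have "exp (- real s0) \<le> exp (- (8 * ln (real n)))" using s0 by simp
      also have "8 * ln (real n) = ln (real n ^ 8)" using big by (simp add: ln_realpow)
      also have "exp (- ln (real n ^ 8)) = 1 / real n ^ 8" using big by (simp add: exp_minus inverse_eq_divide)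
      finally show "exp (- real s0) \<le> 1 / real n ^ 8" .
    qed simp
    also have "\<dots> = 2 / real n ^ 6" using big by (simp add: power_numeral_reduce power2_eq_square)
    finally show "measure_pmf.prob (independent_edges (ring_nonedges n k) (c / real n))
      {X. \<not> real (mixing_time {1..n} (small_world n k X)) \<le> C * (ln (real n))\<^sup>2} \<le> 2 / real n ^ 6"
      unfolding p_def .
  qed
qed

text \<open>
  With \<open>\<eta> = 1 / (32 c)\<close> an interval of length about \<open>2 \<eta> log n\<close> has no shortcuts with probability of
  order \<open>n powr (-1/8)\<close>, while \<open>n powr (1/4)\<close> intervals per group are tried.
\<close>

lemma lower_bound_whp:
  fixes c :: real assumes k: "1 \<le> k" and c: "0 < c"
  obtains C n0 where "0 < C"
    "\<And>n. n0 \<le> n \<Longrightarrow> measure_pmf.prob (independent_edges (ring_nonedges n k) (c / real n))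
      {X. \<not> C * (ln (real n))\<^sup>2 \<le> real (mixing_time {1..n} (small_world n k X))} \<le> 4 / real n ^ 3"
proof -
  define \<eta> where "\<eta> = 1 / (32 * c)"
  have \<eta>: "0 < \<eta>" using c by (simp add: \<eta>_def)
  have kr: "1 \<le> real k" using k by simp
  have ev1: "eventually (\<lambda>x::real. 2 * real k + 16 * x powr (1/4) * (2 * (\<eta> * ln x) + 1) \<le> x) at_top"
    using \<eta> kr by real_asymp
  have ev2: "eventually (\<lambda>x::real. 16 * real k * (2 * (\<eta> * ln x) + 1) \<le> x) at_top"
    using \<eta> kr by real_asymp
  have ev3: "eventually (\<lambda>x::real. c / x * x powr (3/8) * (16 * x powr (1/4) * (2 * (\<eta> * ln x) + 1))\<^sup>2 \<le> 1) at_top"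
    using \<eta> c by real_asymp
  have ev4: "eventually (\<lambda>x::real. 16 * exp (- ((x powr (1/4) - 1) * (exp (- (2 * c)) * x powr (-1/8)))) \<le> 1 / x ^ 3) at_top"
  proof -
    have "0 < exp (- (2 * c))" by simp
    then have "eventually (\<lambda>x::real. 16 * exp (- ((x powr (1/4) - 1) * (a * x powr (-1/8)))) \<le> 1 / x ^ 3) at_top"
      if "0 < a" for a :: real using that by real_asymp
    then show ?thesis by simp
  qed
  have ev5: "eventually (\<lambda>x::real. 2 * c \<le> x \<and> 3 \<le> x) at_top"
    by (intro eventually_conj eventually_ge_at_top)
  obtain x0 where x0: "\<And>x. x0 \<le> x \<Longrightarrow> 2 * real k + 16 * x powr (1/4) * (2 * (\<eta> * ln x) + 1) \<le> x
      \<and> 16 * real k * (2 * (\<eta> * ln x) + 1) \<le> x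
      \<and> c / x * x powr (3/8) * (16 * x powr (1/4) * (2 * (\<eta> * ln x) + 1))\<^sup>2 \<le> 1
      \<and> 16 * exp (- ((x powr (1/4) - 1) * (exp (- (2 * c)) * x powr (-1/8)))) \<le> 1 / x ^ 3
      \<and> 2 * c \<le> x \<and> 3 \<le> x"
    using eventually_conj[OF ev1 eventually_conj[OF ev2 eventually_conj[OF ev3 eventually_conj[OF ev4 ev5]]]]
    unfolding eventually_at_top_linorder by blast
  define C where "C = \<eta>\<^sup>2 / (8 * (real k)\<^sup>2)"
  have C0: "0 < C" using \<eta> kr by (simp add: C_def)
  show ?thesis
  proof (rule that[OF C0])
    fix n assume "nat \<lceil>x0\<rceil> \<le> n"
    then have "x0 \<le> real n" using real_nat_ceiling_ge[of x0] by linarith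
    note N = x0[OF this]
    define x where "x = real n"
    have x3: "3 \<le> x" and xc: "2 * c \<le> x" using N by (auto simp: x_def)
    have lnx: "0 \<le> ln x" using x3 by simp
    define L where "L = nat \<lfloor>\<eta> * ln x\<rfloor>"
    have \<eta>l: "0 \<le> \<eta> * ln x" using \<eta> lnx by simp
    have L: "real L \<le> \<eta> * ln x" "\<eta> * ln x \<le> real L + 1" using \<eta>l unfolding L_def by linarith+
    define m where "m = nat \<lfloor>x powr (1/4)\<rfloor>"
    have m: "real m \<le> x powr (1/4)" "x powr (1/4) - 1 \<le> real m" unfolding m_def using x3 by (auto simp: of_nat_floor; linarith)+
    \<comment> \<open>chosen such that \<open>l ^ 8 = n\<^sup>3\<close>, while \<open>l\<close> times the mean number of shortcuts inside \<open>U\<close> still tends to 0\<close>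
    define l where "l = x powr (3/8)"
    have l1: "1 \<le> l" unfolding l_def using x3 by (intro ge_one_powr_ge_zero) auto
    define p where "p = c / x"
    have p: "0 \<le> p" "p \<le> 1/2" using c xc x3 by (auto simp: p_def pos_divide_le_eq)
    have W: "2 * real L + 1 \<le> 2 * (\<eta> * ln x) + 1" using L by simp
    have fit: "2 * k + 16 * m * (2 * L + 1) \<le> n"
    proof -
      have "16 * real m * (2 * real L + 1) \<le> 16 * x powr (1/4) * (2 * (\<eta> * ln x) + 1)"
        using m W \<eta>l by (intro mult_mono) auto
      moreover have "2 * real k + 16 * x powr (1/4) * (2 * (\<eta> * ln x) + 1) \<le> real n" using N by (simp add: x_def)
      moreover have "real (2 * k + 16 * m * (2 * L + 1)) = 2 * real k + 16 * real m * (2 * real L + 1)"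
        by (simp add: algebra_simps)
      ultimately have "real (2 * k + 16 * m * (2 * L + 1)) \<le> real n" by linarith
      then show ?thesis by (simp only: of_nat_le_iff)
    qed
    have fit2: "16 * k * (2 * L + 1) \<le> n"
    proof -
      have "16 * real k * (2 * real L + 1) \<le> 16 * real k * (2 * (\<eta> * ln x) + 1)"
        using W by (intro mult_left_mono) auto
      moreover have "16 * real k * (2 * (\<eta> * ln x) + 1) \<le> real n" using N by (simp add: x_def)
      moreover have "real (16 * k * (2 * L + 1)) = 16 * real k * (2 * real L + 1)" by (simp add: algebra_simps)
      ultimately have "real (16 * k * (2 * L + 1)) \<le> real n" by linarith
      then show ?thesis by (simp only: of_nat_le_iff)
    qed
    have A: "exp (p * l * (16 * real m * (2 * real L + 1))\<^sup>2) / l ^ 8 \<le> exp 1 / x ^ 3"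
    proof -
      have "p * l * (16 * real m * (2 * real L + 1))\<^sup>2 \<le> p * l * (16 * x powr (1/4) * (2 * (\<eta> * ln x) + 1))\<^sup>2"
        using m W \<eta>l p l1 by (intro mult_left_mono power_mono mult_mono) auto
      also have "\<dots> \<le> 1" using N unfolding p_def l_def x_def by simp
      finally have "exp (p * l * (16 * real m * (2 * real L + 1))\<^sup>2) \<le> exp 1" by simp
      moreover have "l ^ 8 = x ^ 3"
      proof -
        have "l ^ 8 = l powr real 8" using l1 by (subst powr_realpow) auto
        also have "\<dots> = x powr 3" unfolding l_def by (simp add: powr_powr)
        also have "\<dots> = x ^ 3" using x3 by simp
        finally show ?thesis .
      qed
      ultimately show ?thesis using x3 by (simp add: divide_right_mono)
    qed
    have B: "16 * (1 - (1 - p) ^ ((2 * L + 1) * n)) ^ m \<le> 1 / x ^ 3"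
    proof -
      define q where "q = (1 - p) ^ ((2 * L + 1) * n)"
      have q01: "0 \<le> q" "q \<le> 1" using p by (auto simp: q_def intro!: power_le_one)
      have "exp (- (2 * c)) * x powr (-1/8) \<le> exp (- (2 * p)) ^ ((2 * L + 1) * n)"
      proof -
        have pn: "p * real n = c" using x3 by (simp add: p_def x_def)
        have "exp (- (2 * p)) ^ ((2 * L + 1) * n) = exp (- (2 * (p * real n) * (2 * real L + 1)))"
          by (simp add: exp_of_nat_mult[symmetric] algebra_simps)
        also have "\<dots> = exp (- (2 * c * (2 * real L + 1)))" unfolding pn ..
        also have "\<dots> \<ge> exp (- (2 * c * (2 * (\<eta> * ln x) + 1)))"
          using mult_left_mono[OF W, of "2 * c"] c by simp
        also have "- (2 * c * (2 * (\<eta> * ln x) + 1)) = - (2 * c) + (-1/8) * ln x"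
          using c by (simp add: \<eta>_def field_simps)
        also have "exp (- (2 * c) + (-1/8) * ln x) = exp (- (2 * c)) * x powr (-1/8)"
          unfolding exp_add powr_def using x3 by simp
        finally show ?thesis by simp
      qed
      also have "\<dots> \<le> q" unfolding q_def using one_minus_ge_exp[OF p] by (intro power_mono) auto
      finally have qlow: "exp (- (2 * c)) * x powr (-1/8) \<le> q" .
      have "(x powr (1/4) - 1) * (exp (- (2 * c)) * x powr (-1/8)) \<le> real m * q"
      proof (rule mult_mono[OF m(2) qlow])
      qed auto
      then have e: "exp (- (real m * q)) \<le> exp (- ((x powr (1/4) - 1) * (exp (- (2 * c)) * x powr (-1/8))))" by simp
      have "(1 - q) ^ m \<le> exp (- q) ^ m"
        using exp_ge_add_one_self[of "- q"] q01 by (intro power_mono) auto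
      also have "\<dots> = exp (- (real m * q))" by (simp add: exp_of_nat_mult[symmetric])
      also note e
      finally have "16 * (1 - q) ^ m \<le> 16 * exp (- ((x powr (1/4) - 1) * (exp (- (2 * c)) * x powr (-1/8))))"
        by (rule mult_left_mono) simp
      then show ?thesis using N unfolding q_def x_def by linarith
    qed
    let ?ok = "\<lambda>X. \<exists>x. k + L < x \<and> x + L + k \<le> n \<and> (\<forall>e\<in>ring_nonedges n k. X e \<longrightarrow> e \<inter> {x - L..x + L} = {})"
    have det: "C * (ln (real n))\<^sup>2 \<le> real (mixing_time {1..n} (small_world n k X))" if "?ok X" for X
    proof -
      have "(\<eta> * ln x)\<^sup>2 \<le> (real L + 1)\<^sup>2" using L \<eta>l by (intro power_mono) auto
      then have "(\<eta> * ln x)\<^sup>2 / (8 * (real k)\<^sup>2) \<le> (real L + 1)\<^sup>2 / (8 * (real k)\<^sup>2)" by (intro divide_right_mono) auto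
      also have "\<dots> \<le> real (mixing_time {1..n} (small_world n k X))" by (rule mixing_time_lower[OF k fit2 that])
      finally show ?thesis by (simp add: C_def x_def power_mult_distrib)
    qed
    have "measure_pmf.prob (independent_edges (ring_nonedges n k) p)
      {X. \<not> C * (ln (real n))\<^sup>2 \<le> real (mixing_time {1..n} (small_world n k X))}
      \<le> measure_pmf.prob (independent_edges (ring_nonedges n k) p) {X. \<not> ?ok X}"
      by (intro measure_pmf.finite_measure_mono) (use det in blast, simp)
    also have "\<dots> \<le> exp (p * l * (16 * real m * (2 * real L + 1))\<^sup>2) / l ^ 8 + 16 * (1 - (1 - p) ^ ((2 * L + 1) * n)) ^ m"
      by (rule shortcut_free_interval_prob[OF p(1) _ l1 fit]) (use p in simp)
    also have "\<dots> \<le> exp 1 / x ^ 3 + 1 / x ^ 3" using A B by (rule add_mono)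
    also have "\<dots> \<le> 3 / x ^ 3 + 1 / x ^ 3" using exp_le x3 by (intro add_mono divide_right_mono) auto
    finally show "measure_pmf.prob (independent_edges (ring_nonedges n k) (c / real n))
      {X. \<not> C * (ln (real n))\<^sup>2 \<le> real (mixing_time {1..n} (small_world n k X))} \<le> 4 / real n ^ 3"
      by (simp add: p_def x_def)
  qed
qed

text \<open>
  Outside the event \<open>f \<le> a\<close> the crude bound \<open>U\<close> is used.
\<close>

lemma expectation_bound:
  fixes M :: "'a pmf"
  assumes fin: "finite (set_pmf M)" and f: "\<And>x. f x \<le> U" and A: "measure_pmf.prob M {x. \<not> f x \<le> a} \<le> \<epsilon>"
    and U: "0 \<le> U" and a: "0 \<le> a"
  shows "measure_pmf.expectation M f \<le> a + U * \<epsilon>"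
proof -
  have "measure_pmf.expectation M f \<le> measure_pmf.expectation M (\<lambda>x. a + U * indicator {x. \<not> f x \<le> a} x)"
    using fin f U a by (intro integral_mono integrable_measure_pmf_finite) (auto simp: indicator_def intro: add_increasing)
  also have "\<dots> = a + U * measure_pmf.prob M {x. \<not> f x \<le> a}"
    using fin by (subst Bochner_Integration.integral_add) (auto intro: integrable_measure_pmf_finite)
  also have "\<dots> \<le> a + U * \<epsilon>" using A U by (intro add_left_mono mult_left_mono)
  finally show ?thesis .
qed

theorem theorem1:
  fixes k :: nat and c :: real
  assumes "k \<ge> 1" and "c > 0"
  shows "\<exists>C0 > 0.
    (\<exists>A::real. \<forall>n::nat. n \<ge> k \<and> real n > c \<longrightarrow>
       measure_pmf.prob (newman_watts n k (c / real n))
         {E. inverse C0 * (ln (real n))\<^sup>2 \<le> real (mixing_time {1..n} E)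
             \<and> real (mixing_time {1..n} E) \<le> C0 * (ln (real n))\<^sup>2}
       \<ge> 1 - A / real n ^ 3) \<and>
    (\<forall>n::nat. n \<ge> k \<and> real n > c \<longrightarrow>
       measure_pmf.expectation (newman_watts n k (c / real n))
         (\<lambda>E. real (mixing_time {1..n} E))
       \<le> C0 * ((ln (real n))\<^sup>2 + 1))"
proof -
  obtain Cu nu where Cu: "0 < Cu" and up: "\<And>n. nu \<le> n \<Longrightarrow> measure_pmf.prob (independent_edges (ring_nonedges n k) (c / real n))
      {X. \<not> real (mixing_time {1..n} (small_world n k X)) \<le> Cu * (ln (real n))\<^sup>2} \<le> 2 / real n ^ 6"
    using upper_bound_whp[OF assms] by blast
  obtain Cl nl where Cl: "0 < Cl" and lo: "\<And>n. nl \<le> n \<Longrightarrow> measure_pmf.prob (independent_edges (ring_nonedges n k) (c / real n))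
      {X. \<not> Cl * (ln (real n))\<^sup>2 \<le> real (mixing_time {1..n} (small_world n k X))} \<le> 4 / real n ^ 3"
    using lower_bound_whp[OF assms] by blast
  define n0 where "n0 = nu + nl + 2"
  define ex where "ex n = measure_pmf.expectation (newman_watts n k (c / real n)) (\<lambda>E. real (mixing_time {1..n} E))" for n
  \<comment> \<open>\<open>4800 / n\<close> bounds the share of the exceptional event, and the sum takes care of the finitely many small \<open>n\<close>\<close>
  define C0 where "C0 = Cu + 1 / Cl + 4800 + (\<Sum>n<n0. \<bar>ex n\<bar>)"
  have sum0: "0 \<le> (\<Sum>n<n0. \<bar>ex n\<bar>)" by (intro sum_nonneg) auto
  have C0: "0 < C0" "Cu \<le> C0" "1 / Cl \<le> C0" "4800 \<le> C0 - Cu"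
  proof -
    have "0 < 1 / Cl" using Cl by simp
    then show "0 < C0" "Cu \<le> C0" "1 / Cl \<le> C0" "4800 \<le> C0 - Cu" using Cu sum0 unfolding C0_def by linarith+
  qed
  have inv: "inverse C0 \<le> Cl"
    using C0(3) Cl C0(1) by (simp add: inverse_eq_divide pos_divide_le_eq mult.commute)
  \<comment> \<open>for \<open>n < n0\<close> the claimed lower bound is not positive\<close>
  define A where "A = 6 + real n0 ^ 3"
  have P: "1 - A / real n ^ 3 \<le> measure_pmf.prob (newman_watts n k (c / real n))
         {E. inverse C0 * (ln (real n))\<^sup>2 \<le> real (mixing_time {1..n} E)
             \<and> real (mixing_time {1..n} E) \<le> C0 * (ln (real n))\<^sup>2}" (is "_ \<le> measure_pmf.prob _ ?G")
    if n: "n \<ge> k \<and> real n > c" for n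
  proof (cases "n0 \<le> n")
    case False
    have "1 \<le> n" using n assms by simp
    have "real n ^ 3 \<le> real n0 ^ 3" using False by (intro power_mono) auto
    then have "1 * real n ^ 3 \<le> A" unfolding A_def by linarith
    then have "1 \<le> A / real n ^ 3" using \<open>1 \<le> n\<close> by (subst pos_le_divide_eq) simp_all
    then have "1 - A / real n ^ 3 \<le> 0" by simp
    also have "0 \<le> measure_pmf.prob (newman_watts n k (c / real n)) ?G" by simp
    finally show ?thesis .
  next
    case True
    then have n1: "nu \<le> n" "nl \<le> n" "1 \<le> real n" by (auto simp: n0_def)
    let ?D = "independent_edges (ring_nonedges n k) (c / real n)"
    let ?Bu = "{X. \<not> real (mixing_time {1..n} (small_world n k X)) \<le> Cu * (ln (real n))\<^sup>2}"
    let ?Bl = "{X. \<not> Cl * (ln (real n))\<^sup>2 \<le> real (mixing_time {1..n} (small_world n k X))}"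
    have "- (?Bu \<union> ?Bl) \<subseteq> small_world n k -` ?G"
    proof
      fix X assume "X \<in> - (?Bu \<union> ?Bl)"
      then have X: "real (mixing_time {1..n} (small_world n k X)) \<le> Cu * (ln (real n))\<^sup>2"
        "Cl * (ln (real n))\<^sup>2 \<le> real (mixing_time {1..n} (small_world n k X))" by auto
      have "Cu * (ln (real n))\<^sup>2 \<le> C0 * (ln (real n))\<^sup>2" using C0 by (intro mult_right_mono) auto
      moreover have "inverse C0 * (ln (real n))\<^sup>2 \<le> Cl * (ln (real n))\<^sup>2" using inv by (intro mult_right_mono) auto
      ultimately show "X \<in> small_world n k -` ?G" using X by simp
    qed
    then have "measure_pmf.prob ?D (- (?Bu \<union> ?Bl)) \<le> measure_pmf.prob (newman_watts n k (c / real n)) ?G"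
      unfolding newman_watts_eq measure_map_pmf by (intro measure_pmf.finite_measure_mono) auto
    moreover have "measure_pmf.prob ?D (- (?Bu \<union> ?Bl)) = 1 - measure_pmf.prob ?D (?Bu \<union> ?Bl)"
      using measure_pmf.prob_compl[of "?Bu \<union> ?Bl" ?D] by (simp add: Compl_eq_Diff_UNIV)
    moreover have "measure_pmf.prob ?D (?Bu \<union> ?Bl) \<le> measure_pmf.prob ?D ?Bu + measure_pmf.prob ?D ?Bl"
      by (intro measure_Un_le) auto
    moreover have "2 / real n ^ 6 \<le> 2 / real n ^ 3"
      using n1 by (intro divide_left_mono power_increasing) auto
    moreover have "2 / real n ^ 3 + 4 / real n ^ 3 \<le> A / real n ^ 3"
      unfolding add_divide_distrib[symmetric] A_def by (intro divide_right_mono) auto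
    ultimately show ?thesis using up[OF n1(1)] lo[OF n1(2)] by linarith
  qed
  have Ex: "ex n \<le> C0 * ((ln (real n))\<^sup>2 + 1)" if n: "n \<ge> k \<and> real n > c" for n
  proof (cases "n0 \<le> n")
    case False
    then have "\<bar>ex n\<bar> \<le> (\<Sum>n<n0. \<bar>ex n\<bar>)" by (intro member_le_sum) auto
    then have "ex n \<le> C0 * 1" using Cu Cl unfolding C0_def by (simp add: add_increasing)
    also have "\<dots> \<le> C0 * ((ln (real n))\<^sup>2 + 1)" using C0 by (intro mult_left_mono) auto
    finally show ?thesis .
  next
    case True
    then have n1: "nu \<le> n" "2 \<le> n" "1 \<le> real n" by (auto simp: n0_def)
    have "ex n = measure_pmf.expectation (independent_edges (ring_nonedges n k) (c / real n))
        (\<lambda>X. real (mixing_time {1..n} (small_world n k X)))"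
      unfolding ex_def newman_watts_eq by simp
    also have "\<dots> \<le> Cu * (ln (real n))\<^sup>2 + 2400 * real n ^ 5 * (2 / real n ^ 6)"
      using mixing_time_crude[OF assms(1) n1(2)] Cu
      by (intro expectation_bound finite_set_independent_edges finite_nonedges up n1(1)) auto
    also have "2400 * real n ^ 5 * (2 / real n ^ 6) = 4800 / real n" using n1 by (simp add: power_numeral_reduce)
    also have "\<dots> \<le> 4800" using n1 by (simp add: pos_divide_le_eq)
    also have "Cu * (ln (real n))\<^sup>2 + 4800 \<le> C0 * (ln (real n))\<^sup>2 + C0"
      using C0 Cu by (intro add_mono mult_right_mono) auto
    finally show ?thesis by (simp add: distrib_left)
  qed
  show ?thesis using C0(1) P Ex unfolding ex_def by blast
qed

end
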